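(* Let $X\subset\mathbb{R}^m$ and $Y\subset\mathbb{R}^n$ be open and let $h\in\mathcal{C}^\infty(X\times Y)$. Let $\widehat{h}:\mathcal{E}'(Y)\to\mathcal{C}^\infty(X)$ be the classical operator $\widehat{h}(T)(x)=\langle T,h(x,\cdot)\rangle$, and let $\widehat{\sigma(h)}:\mathcal{G}_C(Y)\to\mathcal{G}(X)$ be the generalized integral operator with kernel $\sigma(h)\in\mathcal{G}(X\times Y)$. Then $$\sigma\circ\widehat{h}=\widehat{\sigma(h)}\circ i_S\quad\text{on }\mathcal{E}'(Y),$$ where $i_S:\mathcal{E}'(Y)\to\mathcal{G}_C(Y)$ is the embedding of distributions and $\sigma$ is the canonical embedding of smooth functions into generalized functions.
   Context: For $\Omega\subset\mathbb{R}^d$ open, $K\Subset\Omega$ means that $K$ is a compact subset of $\Omega$, and $p_{K,l}(f)=\sup_{x\in K,|\alpha|\le l}|\partial^\alpha f(x)|$ for $l\in\mathbb{N}$, $f\in\mathcal{C}^\infty(\Omega)$. $\mathcal{E}_M(\Omega)$ is the set of nets $(u_\varepsilon)_{\varepsilon\in(0,1]}$ in $\mathcal{C}^\infty(\Omega)$ such that for all $K\Subset\Omega$, $l\in\mathbb{N}$ there is $n\in\mathbb{N}$ with $p_{K,l}(u_\varepsilon)=O(\varepsilon^{-n})$ as $\varepsilon\to0$; $\mathcal{I}(\Omega)$ is the set of nets such that for all $K,l,n$, $p_{K,l}(u_\varepsilon)=O(\varepsilon^{n})$. $\mathcal{G}(\Omega)=\mathcal{E}_M(\Omega)/\mathcal{I}(\Omega)$;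 $Cl(u_\varepsilon)_\varepsilon$ is the class. The support of $u\in\mathcal{G}(\Omega)$ is the complement of the largest open subset on which $u$ restricts to $0$; $\mathcal{G}_C(\Omega)$ is the set of elements of $\mathcal{G}(\Omega)$ with compact support. Every $f\in\mathcal{G}_C(\Omega)$ has a representative $(f_\varepsilon)_\varepsilon$ all of whose members are supported in one common compact set. Embeddings: $\sigma(f)=Cl(f)_\varepsilon$ (constant net) for $f\in\mathcal{C}^\infty(\Omega)$. Fix $\rho\in\mathcal{S}(\mathbb{R}^d)$ with $\int\rho=1$ and $\int x^m\rho(x)\,\mathrm{d}x=0$ for all $m\in\mathbb{N}^d\setminus\{0\}$, put $\rho_\varepsilon=\varepsilon^{-d}\rho(\cdot/\varepsilon)$, let $\chi\in\mathcal{D}(\mathbb{R}^d)$ be even with $0\le\chi\le1$, $\chi=1$ on $\bar B(0,1)$, $\chi=0$ outside $B(0,2)$, and $\Theta_\varepsilon(x)=\rho_\varepsilon(x)\chi(|\ln\varepsilon|x)$. Let $\gamma_\varepsilon\in\mathcal{D}(\Omega)$, $0\le\gamma_\varepsilon\le1$, $\gamma_\varepsilon=1$ on $\{x\in\Omega: d(x,\mathbb{R}^d\setminus\Omega)\ge\varepsilon,\ |x|\le1/\varepsilon\}$. Then $i_S(T)=Cl\big((\gamma_\varepsilon T*\Theta_\varepsilon)|_\Omega\big)_\varepsilon$ for $T\in\mathcal{D}'(\Omega)$. It is known that $i_S$ is an injective linear map $\mathcal{D}'(\Omega)\to\mathcal{G}(\Omega)$, with $i_S=\sigma$ on $\mathcal{C}^\infty(\Omega)$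 and $i_S(\mathcal{E}'(\Omega))\subset\mathcal{G}_C(\Omega)$. Generalized operator on $\mathcal{G}_C(Y)$: for $H=Cl(H_\varepsilon)_\varepsilon\in\mathcal{G}(X\times Y)$ and $f\in\mathcal{G}_C(Y)$ with representative $(f_\varepsilon)_\varepsilon$ such that every $f_\varepsilon$ is supported in a fixed compact $K\subset Y$, $\widehat H(f)=Cl\big(x\mapsto\int_K H_\varepsilon(x,y)f_\varepsilon(y)\,\mathrm{d}y\big)_\varepsilon\in\mathcal{G}(X)$ (well defined). *)

theory Defs
  imports "HOL-Analysis.Analysis" "HOL-Library.Landau_Symbols"
begin

text \<open>
  Functions on an open set \<open>\<Omega>\<close> are total functions of which only the values on \<open>\<Omega>\<close> matter.
  A multi-index is a function \<open>\<alpha>\<close> of which only the values on \<^term>\<open>Basis\<close> matter.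
\<close>

definition partial :: "'a::euclidean_space \<Rightarrow> ('a \<Rightarrow> 'c::real_normed_vector) \<Rightarrow> 'a \<Rightarrow> 'c" where
  "partial b f x = frechet_derivative f (at x) b"

primrec Ck_on :: "nat \<Rightarrow> 'a::euclidean_space set \<Rightarrow> ('a \<Rightarrow> 'c::real_normed_vector) \<Rightarrow> bool" where
  "Ck_on 0 \<Omega> f \<longleftrightarrow> continuous_on \<Omega> f"
| "Ck_on (Suc k) \<Omega> f \<longleftrightarrow>
     (\<forall>x\<in>\<Omega>. f differentiable (at x)) \<and> (\<forall>b\<in>Basis. Ck_on k \<Omega> (partial b f))"

definition smooth_fns :: "'a::euclidean_space set \<Rightarrow> ('a \<Rightarrow> 'c::real_normed_vector) set" where
  "smooth_fns \<Omega> = {f. \<forall>k. Ck_on k \<Omega> f}"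

definition test_fns :: "'a::euclidean_space set \<Rightarrow> ('a \<Rightarrow> 'c::real_normed_vector) set" where
  "test_fns \<Omega> = {f \<in> smooth_fns UNIV. compact (closure {x. f x \<noteq> 0}) \<and> closure {x. f x \<noteq> 0} \<subseteq> \<Omega>}"

text \<open>
  An enumeration of the basis fixes the order in which the partial derivatives in
  \<open>\<partial>\<^sup>\<alpha>\<close> are taken; for smooth functions the result does not depend on it.
\<close>

definition basis_list :: "'a::euclidean_space list" where
  "basis_list = (SOME bs. distinct bs \<and> set bs = Basis)"

lemma basis_list: "distinct (basis_list :: 'a::euclidean_space list)"
    "set (basis_list :: 'a list) = Basis"
proof -
  have "\<exists>bs :: 'a list. distinct bs \<and> set bs = Basis"
    using finite_distinct_list[OF finite_Basis] by blast
  from someI_ex[OF this] show "distinct (basis_list :: 'a list)" "set (basis_list :: 'a list) = Basis"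
    unfolding basis_list_def by auto
qed

definition mi_size :: "('a::euclidean_space \<Rightarrow> nat) \<Rightarrow> nat" where
  "mi_size \<alpha> = (\<Sum>b\<in>Basis. \<alpha> b)"

definition mi_deriv ::
  "('a::euclidean_space \<Rightarrow> nat) \<Rightarrow> ('a \<Rightarrow> 'c::real_normed_vector) \<Rightarrow> 'a \<Rightarrow> 'c" where
  "mi_deriv \<alpha> f = foldr (\<lambda>b. partial b ^^ \<alpha> b) basis_list f"

definition mi_monom :: "('a::euclidean_space \<Rightarrow> nat) \<Rightarrow> 'a \<Rightarrow> real" where
  "mi_monom \<alpha> x = (\<Prod>b\<in>Basis. (x \<bullet> b) ^ \<alpha> b)"

text \<open>Inserting \<open>0\<close> makes the supremum of the empty family, for \<open>K = {}\<close>, equal to \<open>0\<close>.\<close>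

definition seminorm ::
  "'a::euclidean_space set \<Rightarrow> nat \<Rightarrow> ('a \<Rightarrow> 'c::real_normed_vector) \<Rightarrow> real" where
  "seminorm K l f = Sup (insert 0 {norm (mi_deriv \<alpha> f x) | x \<alpha>. x \<in> K \<and> mi_size \<alpha> \<le> l})"

text \<open>
  Only the members with index in \<open>(0,1]\<close> of a net matter. Nets that differ outside
  \<open>(0,1]\<close> or outside \<open>\<Omega>\<close> are identified by passing to classes.
\<close>

type_synonym 'a net = "real \<Rightarrow> 'a \<Rightarrow> complex"

definition moderate_nets :: "'a::euclidean_space set \<Rightarrow> 'a net set" where
  "moderate_nets \<Omega> = {u. (\<forall>\<epsilon>\<in>{0<..1}. u \<epsilon> \<in> smooth_fns \<Omega>) \<and>
     (\<forall>K l. compact K \<and> K \<subseteq> \<Omega> \<longrightarrow>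
        (\<exists>n. (\<lambda>\<epsilon>. seminorm K l (u \<epsilon>)) \<in> O[at_right 0](\<lambda>\<epsilon>. 1 / \<epsilon> ^ n)))}"

definition null_nets :: "'a::euclidean_space set \<Rightarrow> 'a net set" where
  "null_nets \<Omega> = {u. (\<forall>\<epsilon>\<in>{0<..1}. u \<epsilon> \<in> smooth_fns \<Omega>) \<and>
     (\<forall>K l n. compact K \<and> K \<subseteq> \<Omega> \<longrightarrow>
        (\<lambda>\<epsilon>. seminorm K l (u \<epsilon>)) \<in> O[at_right 0](\<lambda>\<epsilon>. \<epsilon> ^ n))}"

definition net_rel :: "'a::euclidean_space set \<Rightarrow> ('a net \<times> 'a net) set" where
  "net_rel \<Omega> = {(u, v). u \<in> moderate_nets \<Omega> \<and> v \<in> moderate_nets \<Omega> \<and>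
     (\<lambda>\<epsilon> x. u \<epsilon> x - v \<epsilon> x) \<in> null_nets \<Omega>}"

definition Cl :: "'a::euclidean_space set \<Rightarrow> 'a net \<Rightarrow> 'a net set" where
  "Cl \<Omega> u = net_rel \<Omega> `` {u}"

definition gen_fns :: "'a::euclidean_space set \<Rightarrow> 'a net set set" where
  "gen_fns \<Omega> = moderate_nets \<Omega> // net_rel \<Omega>"

text \<open>
  A class restricts to \<open>0\<close> on an open \<open>V \<subseteq> \<Omega>\<close> iff its representatives lie in
  \<^term>\<open>null_nets V\<close>; the largest such \<open>V\<close> is the union of all of them.
\<close>

definition gen_support :: "'a::euclidean_space set \<Rightarrow> 'a net set \<Rightarrow> 'a set" where
  "gen_support \<Omega> U = \<Omega> - \<Union>{V. open V \<and> V \<subseteq> \<Omega> \<and> U \<subseteq> null_nets V}"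

definition gen_fns_C :: "'a::euclidean_space set \<Rightarrow> 'a net set set" where
  "gen_fns_C \<Omega> = {U \<in> gen_fns \<Omega>. compact (gen_support \<Omega> U)}"

definition sigma_emb :: "'a::euclidean_space set \<Rightarrow> ('a \<Rightarrow> complex) \<Rightarrow> 'a net set" where
  "sigma_emb \<Omega> f = Cl \<Omega> (\<lambda>\<epsilon>. f)"

text \<open>
  \<open>\<E>'(\<Omega>)\<close> is the topological dual of \<open>\<C>\<^sup>\<infinity>(\<Omega>)\<close>, whose topology is given by the seminorms above.
  It is included in \<open>\<D>'(\<Omega>)\<close> by restriction to \<^term>\<open>test_fns \<Omega>\<close>.
\<close>

definition compact_distributions ::
  "'a::euclidean_space set \<Rightarrow> (('a \<Rightarrow> complex) \<Rightarrow> complex) set" where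
  "compact_distributions \<Omega> = {T.
     (\<forall>f\<in>smooth_fns \<Omega>. \<forall>g\<in>smooth_fns \<Omega>. T (\<lambda>x. f x + g x) = T f + T g) \<and>
     (\<forall>c. \<forall>f\<in>smooth_fns \<Omega>. T (\<lambda>x. c * f x) = c * T f) \<and>
     (\<exists>K l C. compact K \<and> K \<subseteq> \<Omega> \<and> (\<forall>f\<in>smooth_fns \<Omega>. norm (T f) \<le> C * seminorm K l f))}"

definition schwartz_fns :: "('a::euclidean_space \<Rightarrow> complex) set" where
  "schwartz_fns = {f \<in> smooth_fns UNIV.
     \<forall>\<alpha> \<beta>. bounded (range (\<lambda>x. mi_monom \<alpha> x *\<^sub>R mi_deriv \<beta> f x))}"

definition mollifier :: "('a::euclidean_space \<Rightarrow> complex) \<Rightarrow> bool" where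
  "mollifier \<rho> \<longleftrightarrow> \<rho> \<in> schwartz_fns \<and> (LINT x|lborel. \<rho> x) = 1 \<and>
     (\<forall>m. mi_size m \<noteq> 0 \<longrightarrow> (LINT x|lborel. mi_monom m x *\<^sub>R \<rho> x) = 0)"

definition cutoff :: "('a::euclidean_space \<Rightarrow> real) \<Rightarrow> bool" where
  "cutoff \<kappa> \<longleftrightarrow> \<kappa> \<in> test_fns UNIV \<and> (\<forall>x. \<kappa> (- x) = \<kappa> x) \<and> (\<forall>x. 0 \<le> \<kappa> x \<and> \<kappa> x \<le> 1) \<and>
     (\<forall>x\<in>cball 0 1. \<kappa> x = 1) \<and> (\<forall>x. x \<notin> ball 0 2 \<longrightarrow> \<kappa> x = 0)"

text \<open>The case \<open>-\<Omega> = {}\<close> is separate because \<^term>\<open>infdist x {} = 0\<close>, while \<open>d(x, {}) = \<infinity>\<close>.\<close>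

definition truncation_net :: "'a::euclidean_space set \<Rightarrow> (real \<Rightarrow> 'a \<Rightarrow> real) \<Rightarrow> bool" where
  "truncation_net \<Omega> \<gamma> \<longleftrightarrow> (\<forall>\<epsilon>\<in>{0<..1}. \<gamma> \<epsilon> \<in> test_fns \<Omega> \<and> (\<forall>x. 0 \<le> \<gamma> \<epsilon> x \<and> \<gamma> \<epsilon> x \<le> 1) \<and>
     (\<forall>x\<in>\<Omega>. (- \<Omega> = {} \<or> \<epsilon> \<le> infdist x (- \<Omega>)) \<and> norm x \<le> 1 / \<epsilon> \<longrightarrow> \<gamma> \<epsilon> x = 1))"

definition rho_eps :: "('a::euclidean_space \<Rightarrow> complex) \<Rightarrow> 'a net" where
  "rho_eps \<rho> \<epsilon> x = \<rho> (x /\<^sub>R \<epsilon>) /\<^sub>R \<epsilon> ^ DIM('a)"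

definition Theta :: "('a::euclidean_space \<Rightarrow> complex) \<Rightarrow> ('a \<Rightarrow> real) \<Rightarrow> 'a net" where
  "Theta \<rho> \<kappa> \<epsilon> x = rho_eps \<rho> \<epsilon> x * complex_of_real (\<kappa> (\<bar>ln \<epsilon>\<bar> *\<^sub>R x))"

definition mult_distr ::
  "('a \<Rightarrow> real) \<Rightarrow> (('a \<Rightarrow> complex) \<Rightarrow> complex) \<Rightarrow> ('a \<Rightarrow> complex) \<Rightarrow> complex" where
  "mult_distr g T \<phi> = T (\<lambda>y. complex_of_real (g y) * \<phi> y)"

definition conv_distr ::
  "(('a::ab_group_add \<Rightarrow> complex) \<Rightarrow> complex) \<Rightarrow> ('a \<Rightarrow> complex) \<Rightarrow> 'a \<Rightarrow> complex" where
  "conv_distr T \<phi> x = T (\<lambda>y. \<phi> (x - y))"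

text \<open>Only the values of \<open>T\<close> on \<^term>\<open>test_fns \<Omega>\<close> enter, since \<^term>\<open>\<gamma> \<epsilon>\<close> is a test function.\<close>

definition i_S :: "'a::euclidean_space set \<Rightarrow> ('a \<Rightarrow> complex) \<Rightarrow> ('a \<Rightarrow> real) \<Rightarrow>
    (real \<Rightarrow> 'a \<Rightarrow> real) \<Rightarrow> (('a \<Rightarrow> complex) \<Rightarrow> complex) \<Rightarrow> 'a net set" where
  "i_S \<Omega> \<rho> \<kappa> \<gamma> T = Cl \<Omega> (\<lambda>\<epsilon>. conv_distr (mult_distr (\<gamma> \<epsilon>) T) (Theta \<rho> \<kappa> \<epsilon>))"

definition classical_op ::
  "('a \<times> 'b \<Rightarrow> complex) \<Rightarrow> (('b \<Rightarrow> complex) \<Rightarrow> complex) \<Rightarrow> 'a \<Rightarrow> complex" where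
  "classical_op h T x = T (\<lambda>y. h (x, y))"

text \<open>
  The class that results from every choice of a representative of \<open>H\<close>, a compact \<open>K \<subseteq> Y\<close>
  and a representative of \<open>F\<close> supported in \<open>K\<close>. As \<open>K\<close> is closed, no closure is
  needed in the support condition.
\<close>

definition gen_op :: "'a::euclidean_space set \<Rightarrow> 'b::euclidean_space set \<Rightarrow>
    ('a \<times> 'b) net set \<Rightarrow> 'b net set \<Rightarrow> 'a net set" where
  "gen_op X Y H F = (THE G. \<forall>u\<in>H. \<forall>f\<in>F. \<forall>K.
     compact K \<and> K \<subseteq> Y \<and> (\<forall>\<epsilon>\<in>{0<..1}. support_on Y (f \<epsilon>) \<subseteq> K) \<longrightarrow>
     G = Cl X (\<lambda>\<epsilon> x. LINT y:K|lborel. u \<epsilon> (x, y) * f \<epsilon> y))"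

end

theory Submission
  imports Defs "HOL-Probability.Sinc_Integral"
begin

text \<open>
  Let \<open>w\<^sub>\<epsilon> (y) = \<langle>T, \<gamma>\<^sub>\<epsilon> \<Theta>\<^sub>\<epsilon> (y - \<cdot>)\<rangle>\<close> be the net defining \<open>i\<^sub>S (T)\<close>, let \<open>\<eta>\<close> be a test function on \<open>Y\<close> that is \<open>1\<close>
  near the support of \<open>T\<close>, and put \<open>H (x, y) = h (x, y) \<eta> (y)\<close>. For small \<open>\<epsilon>\<close> the factor \<open>\<gamma>\<^sub>\<epsilon>\<close> is \<open>1\<close>
  near the support of \<open>T\<close> and \<open>w\<^sub>\<epsilon>\<close> vanishes where \<open>\<eta> \<noteq> 1\<close>, so \<open>\<eta> w\<^sub>\<epsilon>\<close> is a representative with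
  compact support. Exchanging \<open>T\<close> with the integral gives
  \<open>\<integral> H (x, y) w\<^sub>\<epsilon> (y) dy = \<langle>T, \<integral> H (x, \<cdot> + y) \<Theta>\<^sub>\<epsilon> (y) dy\<rangle>\<close>. By Taylor expansion and the vanishing moments of
  \<open>\<rho>\<close>, the argument of \<open>T\<close> differs from \<open>H (x, \<cdot>)\<close> by \<open>O(\<epsilon>\<^sup>N)\<close> for every \<open>N\<close>, together with all
  derivatives and locally uniformly. Other representatives of the kernel and of \<open>i\<^sub>S (T)\<close> change the
  integral only by a null net.
\<close>

section \<open>Smooth functions and iterated partial derivatives\<close>

text \<open>A compactly supported distribution is only known as a linear functional with a seminorm
  bound, so every limit taken inside \<open>T\<close> must be controlled together with all
  derivatives up to the order of \<open>T\<close>. Two observations keep this manageable.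
  Integration against a continuous function over a compact set is itself an element of
  \<open>compact_distributions\<close>; one differentiation theorem, for
  \<open>classical_op\<close>, therefore serves the distribution, the generalized integral operator
  and the regularization of the kernel. And derivatives of the regularized kernel are
  regularizations of derivatives, so one estimate for functions suffices. Truncation by
  \<open>\<kappa>\<close> destroys the exact moment conditions: the error carries powers of
  \<open>ln e\<close>, paid for with surplus powers of \<open>e\<close>, which are available because
  \<open>\<rho>\<close> has absolute moments of every order. Finally, \<open>gen_op\<close> is a
  definite description: besides independence of all choices, an admissible choice has to be
  exhibited, since otherwise its defining condition would hold for every class.\<close>

lemma partial_eqI: "(f has_derivative f') (at x) \<Longrightarrow> partial b f x = f' b"
  by (metis partial_def frechet_derivative_at)

lemma has_derivative_frechet:
  "f differentiable (at x) \<Longrightarrow> (f has_derivative frechet_derivative f (at x)) (at x)"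
  by (simp add: frechet_derivative_works)

lemma partial_cong:
  assumes "open U" "x \<in> U" "\<And>y. y \<in> U \<Longrightarrow> f y = g y"
  shows "partial b f x = partial b g x"
proof -
  have "(f has_derivative f') (at x) \<longleftrightarrow> (g has_derivative f') (at x)" for f'
    using has_derivative_transform_within_open[of f f' x UNIV U g]
      has_derivative_transform_within_open[of g f' x UNIV U f] assms by auto
  then show ?thesis
    by (simp add: partial_def frechet_derivative_def)
qed

lemma differentiable_cong_open:
  assumes "open U" "x \<in> U" "\<And>y. y \<in> U \<Longrightarrow> f y = g y" "f differentiable (at x)"
  shows "g differentiable (at x)"
  using assms unfolding differentiable_def
  by (meson has_derivative_transform_within_open)

lemma Ck_on_cong:
  assumes "open \<Omega>"
  shows "Ck_on k \<Omega> f \<Longrightarrow> (\<And>x. x \<in> \<Omega> \<Longrightarrow> f x = g x) \<Longrightarrow> Ck_on k \<Omega> g"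
proof (induction k arbitrary: f g)
  case 0
  then show ?case by (simp cong: continuous_on_cong)
next
  case (Suc k)
  have "g differentiable (at x)" if "x \<in> \<Omega>" for x
    using Suc.prems differentiable_cong_open[OF assms that, of f g] that by simp
  moreover have "Ck_on k \<Omega> (partial b g)" if "b \<in> Basis" for b
  proof (rule Suc.IH)
    show "Ck_on k \<Omega> (partial b f)" using Suc.prems that by simp
    show "partial b f x = partial b g x" if "x \<in> \<Omega>" for x
      by (rule partial_cong[OF assms that]) (rule Suc.prems)
  qed
  ultimately show ?case by simp
qed

lemma smooth_cong:
  assumes "f \<in> smooth_fns \<Omega>" "open \<Omega>" "\<And>x. x \<in> \<Omega> \<Longrightarrow> f x = g x"
  shows "g \<in> smooth_fns \<Omega>"
  using assms Ck_on_cong[of \<Omega> _ f g] by (auto simp: smooth_fns_def)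

lemma smooth_fns_unfold:
  assumes "f \<in> smooth_fns \<Omega>"
  shows "continuous_on \<Omega> f" "x \<in> \<Omega> \<Longrightarrow> f differentiable (at x)"
    "b \<in> Basis \<Longrightarrow> Ck_on k \<Omega> (partial b f)"
proof -
  have *: "Ck_on k \<Omega> f" for k using assms by (simp add: smooth_fns_def)
  show "continuous_on \<Omega> f" using *[of 0] by simp
  show "x \<in> \<Omega> \<Longrightarrow> f differentiable (at x)" "b \<in> Basis \<Longrightarrow> Ck_on k \<Omega> (partial b f)"
    using *[of "Suc k"] by simp_all
qed

lemma smooth_differentiable: "f \<in> smooth_fns \<Omega> \<Longrightarrow> x \<in> \<Omega> \<Longrightarrow> f differentiable (at x)"
  by (rule smooth_fns_unfold)

lemma smooth_partial: "f \<in> smooth_fns \<Omega> \<Longrightarrow> b \<in> Basis \<Longrightarrow> partial b f \<in> smooth_fns \<Omega>"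
  using smooth_fns_unfold(3)[of f \<Omega> b] by (subst smooth_fns_def) blast

lemma smooth_has_derivative:
  "f \<in> smooth_fns \<Omega> \<Longrightarrow> x \<in> \<Omega> \<Longrightarrow> (f has_derivative frechet_derivative f (at x)) (at x)"
  by (rule has_derivative_frechet[OF smooth_differentiable])

lemma smooth_continuous: "f \<in> smooth_fns \<Omega> \<Longrightarrow> continuous_on \<Omega> f"
  by (rule smooth_fns_unfold)

lemma Ck_on_mono: "Ck_on k \<Omega> f \<Longrightarrow> \<Omega>' \<subseteq> \<Omega> \<Longrightarrow> Ck_on k \<Omega>' f"
  by (induction k arbitrary: f) (auto intro: continuous_on_subset)

lemma smooth_mono: "f \<in> smooth_fns \<Omega> \<Longrightarrow> \<Omega>' \<subseteq> \<Omega> \<Longrightarrow> f \<in> smooth_fns \<Omega>'"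
  by (auto simp: smooth_fns_def intro: Ck_on_mono)

lemma Ck_on_Un:
  "open A \<Longrightarrow> open B \<Longrightarrow> Ck_on k A f \<Longrightarrow> Ck_on k B f \<Longrightarrow> Ck_on k (A \<union> B) f"
  by (induction k arbitrary: f) (auto intro: continuous_on_open_Un)

lemma smooth_Un:
  "open A \<Longrightarrow> open B \<Longrightarrow> f \<in> smooth_fns A \<Longrightarrow> f \<in> smooth_fns B \<Longrightarrow> f \<in> smooth_fns (A \<union> B)"
  by (auto simp: smooth_fns_def intro: Ck_on_Un)

text \<open>A formula for \<open>partial b f\<close> is usually available only on the open set,
  while \<open>Ck_on\<close> speaks of the total function. This is the common induction step of the
  smoothness proofs below.\<close>

lemma Ck_on_SucI:
  assumes "open \<Omega>" and "\<And>x. x \<in> \<Omega> \<Longrightarrow> f differentiable (at x)"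
    and "\<And>b x. b \<in> Basis \<Longrightarrow> x \<in> \<Omega> \<Longrightarrow> partial b f x = g b x"
    and "\<And>b. b \<in> Basis \<Longrightarrow> Ck_on k \<Omega> (g b)"
  shows "Ck_on (Suc k) \<Omega> f"
proof -
  have "Ck_on k \<Omega> (partial b f)" if "b \<in> Basis" for b
    by (rule Ck_on_cong[OF assms(1) assms(4)[OF that]]) (simp add: assms(3) that)
  then show ?thesis using assms(2) by simp
qed

lemma Ck_on_const: "Ck_on k \<Omega> (\<lambda>x. c)"
proof (induction k arbitrary: c)
  case (Suc k)
  have "partial b (\<lambda>x. c) = (\<lambda>x. 0)" for b :: 'a
    by (auto simp: partial_def)
  then show ?case using Suc by simp
qed simp

lemma smooth_const: "(\<lambda>x. c) \<in> smooth_fns \<Omega>"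
  by (simp add: smooth_fns_def Ck_on_const)

lemma partial_add:
  assumes "f differentiable (at x)" "g differentiable (at x)"
  shows "partial b (\<lambda>x. f x + g x) x = partial b f x + partial b g x"
  unfolding partial_def[of b f] partial_def[of b g]
  by (intro partial_eqI has_derivative_add has_derivative_frechet assms)

lemma Ck_on_add:
  assumes "open \<Omega>"
  shows "Ck_on k \<Omega> f \<Longrightarrow> Ck_on k \<Omega> g \<Longrightarrow> Ck_on k \<Omega> (\<lambda>x. f x + g x)"
proof (induction k arbitrary: f g)
  case 0
  then show ?case by (auto intro: continuous_intros)
next
  case (Suc k)
  show ?case
    by (rule Ck_on_SucI[OF assms, where g = "\<lambda>b x. partial b f x + partial b g x"])
      (use Suc in \<open>auto intro!: partial_add\<close>)
qed

lemma smooth_add: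
  "open \<Omega> \<Longrightarrow> f \<in> smooth_fns \<Omega> \<Longrightarrow> g \<in> smooth_fns \<Omega> \<Longrightarrow> (\<lambda>x. f x + g x) \<in> smooth_fns \<Omega>"
  by (simp add: smooth_fns_def Ck_on_add)

lemma partial_linear:
  assumes "bounded_linear L" "f differentiable (at x)"
  shows "partial b (\<lambda>x. L (f x)) x = L (partial b f x)"
  unfolding partial_def[of b f]
  by (rule partial_eqI[OF bounded_linear.has_derivative[OF assms(1) has_derivative_frechet[OF assms(2)]]])

lemma differentiable_linear:
  assumes "bounded_linear L" "f differentiable (at x)"
  shows "(\<lambda>x. L (f x)) differentiable (at x)"
  using bounded_linear.has_derivative[OF assms(1) has_derivative_frechet[OF assms(2)]]
  by (rule differentiableI)

lemma Ck_on_linear: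
  assumes "open \<Omega>" "bounded_linear L"
  shows "Ck_on k \<Omega> f \<Longrightarrow> Ck_on k \<Omega> (\<lambda>x. L (f x))"
proof (induction k arbitrary: f)
  case 0
  then show ?case using bounded_linear.continuous_on[OF assms(2), of \<Omega> f] by simp
next
  case (Suc k)
  show ?case
    by (rule Ck_on_SucI[OF assms(1), where g = "\<lambda>b x. L (partial b f x)"])
      (use Suc partial_linear[OF assms(2), of f] differentiable_linear[OF assms(2), of f] in auto)
qed

lemma smooth_linear:
  "open \<Omega> \<Longrightarrow> bounded_linear L \<Longrightarrow> f \<in> smooth_fns \<Omega> \<Longrightarrow> (\<lambda>x. L (f x)) \<in> smooth_fns \<Omega>"
  using Ck_on_linear[of \<Omega> L _ f] by (simp add: smooth_fns_def)

lemma smooth_minus: "open \<Omega> \<Longrightarrow> f \<in> smooth_fns \<Omega> \<Longrightarrow> (\<lambda>x. - f x) \<in> smooth_fns \<Omega>"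
  by (rule smooth_linear[of \<Omega> uminus]) (auto intro: bounded_linear_minus[OF bounded_linear_ident])

lemma smooth_diff:
  assumes "open \<Omega>" "f \<in> smooth_fns \<Omega>" "g \<in> smooth_fns \<Omega>"
  shows "(\<lambda>x. f x - g x) \<in> smooth_fns \<Omega>"
  using smooth_add[OF assms(1,2) smooth_minus[OF assms(1,3)]] by simp

lemma Ck_on_sum:
  assumes "open \<Omega>" "\<And>i. i \<in> I \<Longrightarrow> Ck_on k \<Omega> (f i)"
  shows "Ck_on k \<Omega> (\<lambda>x. \<Sum>i\<in>I. f i x)"
  using assms(2)
  by (induction I rule: infinite_finite_induct) (auto simp: Ck_on_const intro: Ck_on_add[OF assms(1)])

lemma smooth_sum:
  "open \<Omega> \<Longrightarrow> (\<And>i. i \<in> I \<Longrightarrow> f i \<in> smooth_fns \<Omega>) \<Longrightarrow> (\<lambda>x. \<Sum>i\<in>I. f i x) \<in> smooth_fns \<Omega>"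
  by (simp add: smooth_fns_def Ck_on_sum)

lemma partial_mult:
  fixes f g :: "'a::euclidean_space \<Rightarrow> 'c::real_normed_algebra"
  assumes "f differentiable (at x)" "g differentiable (at x)"
  shows "partial b (\<lambda>x. f x * g x) x = f x * partial b g x + partial b f x * g x"
  unfolding partial_def[of b f] partial_def[of b g]
  by (intro partial_eqI has_derivative_mult has_derivative_frechet assms)

lemma smooth_mult:
  fixes f g :: "'a::euclidean_space \<Rightarrow> 'c::real_normed_algebra"
  assumes "open \<Omega>" "f \<in> smooth_fns \<Omega>" "g \<in> smooth_fns \<Omega>"
  shows "(\<lambda>x. f x * g x) \<in> smooth_fns \<Omega>"
proof -
  \<comment> \<open>Both factors are assumed smooth rather than of class \<open>Suc k\<close>: the
    induction hypothesis is applied to pairs such as \<open>f\<close> and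
    \<open>partial b g\<close>, where only one factor loses an order.\<close>
  have "Ck_on k \<Omega> (\<lambda>x. f x * g x)" if "f \<in> smooth_fns \<Omega>" "g \<in> smooth_fns \<Omega>" for k and f g :: "'a \<Rightarrow> 'c"
    using that
  proof (induction k arbitrary: f g)
    case 0
    then show ?case by (simp add: continuous_on_mult smooth_continuous)
  next
    case (Suc k)
    show ?case
    proof (rule Ck_on_SucI[OF assms(1), where g = "\<lambda>b x. f x * partial b g x + partial b f x * g x"])
      fix x assume "x \<in> \<Omega>"
      then have d: "f differentiable (at x)" "g differentiable (at x)"
        using Suc.prems by (auto intro: smooth_differentiable)
      then show "(\<lambda>x. f x * g x) differentiable (at x)" by (rule differentiable_mult)
      show "partial b (\<lambda>x. f x * g x) x = f x * partial b g x + partial b f x * g x" for b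
        by (rule partial_mult[OF d])
    next
      show "Ck_on k \<Omega> (\<lambda>x. f x * partial b g x + partial b f x * g x)" if "b \<in> Basis" for b
        using Suc that by (intro Ck_on_add[OF assms(1)] Suc.IH) (auto intro: smooth_partial)
    qed
  qed
  then have "\<forall>k. Ck_on k \<Omega> (\<lambda>x. f x * g x)" using assms(2,3) by blast
  then show ?thesis by (simp add: smooth_fns_def)
qed

lemma partial_affine:
  assumes "(A has_derivative L) (at x)" "f differentiable (at (A x))"
  shows "partial b (\<lambda>x. f (A x)) x = partial (L b) f (A x)"
  using partial_eqI[OF has_derivative_compose[OF assms(1) has_derivative_frechet[OF assms(2)]], of b]
  unfolding partial_def[of "L b"] .

lemma partial_expand:
  assumes "f differentiable (at x)"
  shows "partial v f x = (\<Sum>b\<in>Basis. (v \<bullet> b) *\<^sub>R partial b f x)"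
proof -
  interpret linear "frechet_derivative f (at x)"
    using assms by (rule linear_frechet_derivative)
  have "partial v f x = frechet_derivative f (at x) (\<Sum>b\<in>Basis. (v \<bullet> b) *\<^sub>R b)"
    by (simp add: partial_def euclidean_representation)
  then show ?thesis by (simp add: sum scale partial_def)
qed

lemma partial_scaleR: "f differentiable (at x) \<Longrightarrow> partial (c *\<^sub>R v) f x = c *\<^sub>R partial v f x"
  by (simp add: partial_def linear_scale[OF linear_frechet_derivative])

text \<open>The derivative \<open>L\<close> does not depend on the point, so the chain rule yields
  linear combinations with constant coefficients \<open>L b \<bullet> c\<close>, and the induction
  stays among compositions with the same \<open>A\<close>.\<close>

lemma smooth_affine:
  assumes A: "\<And>x. (A has_derivative L) (at x)" and "open \<Omega>'" and sub: "\<And>x. x \<in> \<Omega>' \<Longrightarrow> A x \<in> \<Omega>"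
    and "f \<in> smooth_fns \<Omega>"
  shows "(\<lambda>x. f (A x)) \<in> smooth_fns \<Omega>'"
proof -
  have contA: "continuous_on \<Omega>' A"
    by (intro continuous_at_imp_continuous_on ballI has_derivative_continuous[OF A])
  have "Ck_on k \<Omega>' (\<lambda>x. f (A x))" if "f \<in> smooth_fns \<Omega>" for k f
    using that
  proof (induction k arbitrary: f)
    case 0
    then show ?case
      using continuous_on_compose2[OF smooth_continuous[OF 0] contA image_subsetI[OF sub]] by simp
  next
    case (Suc k)
    show ?case
    proof (rule Ck_on_SucI[OF assms(2),
          where g = "\<lambda>b x. \<Sum>c\<in>Basis. (L b \<bullet> c) *\<^sub>R partial c f (A x)"])
      fix x assume x: "x \<in> \<Omega>'"
      note d = smooth_differentiable[OF Suc.prems sub[OF x]]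
      show "(\<lambda>x. f (A x)) differentiable at x"
        by (rule differentiableI[OF has_derivative_compose[OF A has_derivative_frechet[OF d]]])
      fix b :: 'a
      show "partial b (\<lambda>x. f (A x)) x = (\<Sum>c\<in>Basis. (L b \<bullet> c) *\<^sub>R partial c f (A x))"
        by (rule trans[OF partial_affine[OF A d] partial_expand[OF d]])
    next
      fix b :: 'a
      show "Ck_on k \<Omega>' (\<lambda>x. \<Sum>c\<in>Basis. (L b \<bullet> c) *\<^sub>R partial c f (A x))"
      proof (rule Ck_on_sum[OF assms(2)])
        fix c :: 'b assume "c \<in> Basis"
        then have "Ck_on k \<Omega>' (\<lambda>x. partial c f (A x))"
          by (intro Suc.IH smooth_partial Suc.prems)
        then show "Ck_on k \<Omega>' (\<lambda>x. (L b \<bullet> c) *\<^sub>R partial c f (A x))"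
          by (rule Ck_on_linear[OF assms(2) bounded_linear_scaleR_right])
      qed
    qed
  qed
  then have "\<forall>k. Ck_on k \<Omega>' (\<lambda>x. f (A x))" using assms(4) by blast
  then show ?thesis by (simp add: smooth_fns_def)
qed

text \<open>
  Derivatives are indexed by lists rather than multi-indices: they compose by concatenation,
  and the order of the list is immaterial for smooth functions.
\<close>

definition pd :: "'a::euclidean_space list \<Rightarrow> ('a \<Rightarrow> 'c::real_normed_vector) \<Rightarrow> 'a \<Rightarrow> 'c" where
  "pd bs f = foldr partial bs f"

lemma pd_Nil [simp]: "pd [] f = f"
  and pd_Cons: "pd (b # bs) f = partial b (pd bs f)"
  and pd_append: "pd (bs @ cs) f = pd bs (pd cs f)"
  by (simp_all add: pd_def)

lemma smooth_pd: "f \<in> smooth_fns \<Omega> \<Longrightarrow> set bs \<subseteq> Basis \<Longrightarrow> pd bs f \<in> smooth_fns \<Omega>"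
  by (induction bs) (auto simp: pd_Cons intro: smooth_partial)

lemma pd_cong:
  assumes "open U" "\<And>y. y \<in> U \<Longrightarrow> f y = g y"
  shows "x \<in> U \<Longrightarrow> pd bs f x = pd bs g x"
proof (induction bs arbitrary: x)
  case (Cons b bs)
  then show ?case
    unfolding pd_Cons by (intro partial_cong[OF assms(1)])
qed (use assms(2) in simp)

lemma pd_zero: "pd bs (\<lambda>x::'a::euclidean_space. 0 :: 'b::real_normed_vector) x = 0"
proof -
  have "pd bs (\<lambda>x. 0 :: 'b) = (\<lambda>x::'a. 0)"
    by (induction bs) (auto simp: pd_Cons partial_def)
  then show ?thesis by simp
qed

lemma pd_add:
  assumes "open \<Omega>" "f \<in> smooth_fns \<Omega>" "g \<in> smooth_fns \<Omega>" "set bs \<subseteq> Basis"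
  shows "x \<in> \<Omega> \<Longrightarrow> pd bs (\<lambda>x. f x + g x) x = pd bs f x + pd bs g x"
  using assms(4)
proof (induction bs arbitrary: x)
  case (Cons b bs)
  have "partial b (pd bs (\<lambda>x. f x + g x)) x = partial b (\<lambda>x. pd bs f x + pd bs g x) x"
    by (rule partial_cong[OF assms(1)]) (use Cons in auto)
  also have "\<dots> = partial b (pd bs f) x + partial b (pd bs g) x"
    by (rule partial_add) (use Cons assms in \<open>auto intro!: smooth_differentiable smooth_pd\<close>)
  finally show ?case by (simp add: pd_Cons)
qed simp

lemma pd_linear:
  assumes "open \<Omega>" "bounded_linear L" "f \<in> smooth_fns \<Omega>" "set bs \<subseteq> Basis"
  shows "x \<in> \<Omega> \<Longrightarrow> pd bs (\<lambda>x. L (f x)) x = L (pd bs f x)"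
  using assms(4)
proof (induction bs arbitrary: x)
  case (Cons b bs)
  have "partial b (pd bs (\<lambda>x. L (f x))) x = partial b (\<lambda>x. L (pd bs f x)) x"
    by (rule partial_cong[OF assms(1)]) (use Cons in auto)
  also have "\<dots> = L (partial b (pd bs f) x)"
    by (rule partial_linear[OF assms(2)], rule smooth_differentiable[OF smooth_pd])
      (use Cons assms in auto)
  finally show ?case by (simp add: pd_Cons)
qed simp

lemma pd_minus:
  "open \<Omega> \<Longrightarrow> f \<in> smooth_fns \<Omega> \<Longrightarrow> set bs \<subseteq> Basis \<Longrightarrow> x \<in> \<Omega> \<Longrightarrow> pd bs (\<lambda>x. - f x) x = - pd bs f x"
  by (rule pd_linear[of \<Omega> uminus]) (auto intro: bounded_linear_minus[OF bounded_linear_ident])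

lemma pd_diff:
  assumes "open \<Omega>" "f \<in> smooth_fns \<Omega>" "g \<in> smooth_fns \<Omega>" "set bs \<subseteq> Basis" "x \<in> \<Omega>"
  shows "pd bs (\<lambda>x. f x - g x) x = pd bs f x - pd bs g x"
  using pd_add[OF assms(1,2) smooth_minus[OF assms(1,3)] assms(4,5)] pd_minus[OF assms(1,3,4,5)]
  by simp

lemma pd_sum:
  assumes "open \<Omega>" "\<And>i. i \<in> I \<Longrightarrow> f i \<in> smooth_fns \<Omega>" "set bs \<subseteq> Basis" "x \<in> \<Omega>"
  shows "pd bs (\<lambda>x. \<Sum>i\<in>I. f i x) x = (\<Sum>i\<in>I. pd bs (f i) x)"
  using assms(2)
proof (induction I rule: infinite_finite_induct)
  case (insert i I)
  then show ?case
    using pd_add[OF assms(1) _ smooth_sum[OF assms(1)] assms(3,4), of "f i" I f] by simp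
qed (simp_all add: pd_zero)

text \<open>When \<open>L\<close> sends the occurring directions to basis vectors, as for slices and
  for exchanged coordinates, each derivative becomes a single basis derivative of \<open>f\<close>
  and no sums arise.\<close>

lemma pd_affine:
  assumes A: "\<And>x. (A has_derivative L) (at x)" and "open \<Omega>'" and sub: "\<And>x. x \<in> \<Omega>' \<Longrightarrow> A x \<in> \<Omega>"
    and f: "f \<in> smooth_fns \<Omega>"
  shows "x \<in> \<Omega>' \<Longrightarrow> L ` set bs \<subseteq> Basis \<Longrightarrow> pd bs (\<lambda>x. f (A x)) x = pd (map L bs) f (A x)"
proof (induction bs arbitrary: x)
  case (Cons b bs)
  have "partial b (pd bs (\<lambda>x. f (A x))) x = partial b (\<lambda>x. pd (map L bs) f (A x)) x"
    by (rule partial_cong[OF assms(2)]) (use Cons in auto)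
  also have "\<dots> = partial (L b) (pd (map L bs) f) (A x)"
    by (rule partial_affine[OF A smooth_differentiable])
      (use Cons f sub in \<open>auto intro!: smooth_pd\<close>)
  finally show ?case by (simp add: pd_Cons)
qed simp

lemma smooth_has_vector_derivative_line:
  assumes "f \<in> smooth_fns \<Omega>" "x + s *\<^sub>R a \<in> \<Omega>"
  shows "((\<lambda>s. f (x + s *\<^sub>R a)) has_vector_derivative partial a f (x + s *\<^sub>R a)) (at s within S)"
proof -
  have "((\<lambda>s. f (x + s *\<^sub>R a)) has_derivative
      (\<lambda>t. frechet_derivative f (at (x + s *\<^sub>R a)) (t *\<^sub>R a))) (at s within S)"
    by (rule has_derivative_compose[where g = f and f = "\<lambda>s. x + s *\<^sub>R a", OF _ smooth_has_derivative[OF assms]])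
      (auto intro!: derivative_eq_intros)
  moreover have "frechet_derivative f (at (x + s *\<^sub>R a)) (t *\<^sub>R a)
      = t *\<^sub>R frechet_derivative f (at (x + s *\<^sub>R a)) a" for t
    using linear_frechet_derivative[OF smooth_differentiable[OF assms]] by (simp add: linear_scale)
  ultimately show ?thesis
    by (simp add: has_vector_derivative_def partial_def)
qed

text \<open>The mean value inequality for \<open>g s - s *\<^sub>R D\<close>, whose derivative is
  small as long as \<open>g'\<close> stays near \<open>D\<close>.\<close>

lemma vector_mvt_bound:
  fixes g :: "real \<Rightarrow> 'c::real_normed_vector"
  assumes "0 \<le> r" "\<And>s. s \<in> {0..r} \<Longrightarrow> (g has_vector_derivative g' s) (at s within {0..r})"
    and "\<And>s. s \<in> {0..r} \<Longrightarrow> norm (g' s - D) \<le> B"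
  shows "norm (g r - g 0 - r *\<^sub>R D) \<le> r * B"
proof -
  have "((\<lambda>s. g s - s *\<^sub>R D) has_derivative (\<lambda>h. h *\<^sub>R (g' s - D))) (at s within {0..r})"
    if "s \<in> {0..r}" for s
    using assms(2)[OF that] unfolding has_vector_derivative_def
    by (auto intro!: derivative_eq_intros simp: algebra_simps)
  moreover have "onorm (\<lambda>h. h *\<^sub>R (g' s - D)) \<le> B" if "s \<in> {0..r}" for s
    using assms(3)[OF that] by (intro onorm_le) (simp add: mult.commute[of B] mult_left_mono)
  ultimately have "norm ((g r - r *\<^sub>R D) - (g 0 - 0 *\<^sub>R D)) \<le> B * norm (r - 0)"
    using assms(1) by (intro differentiable_bound[of "{0..r}"]) auto
  then show ?thesis using assms(1) by (simp add: algebra_simps)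
qed



text \<open>Clairaut: both mixed derivatives approximate the same second difference quotient.\<close>

lemma second_difference_bound:
  assumes f: "f \<in> smooth_fns \<Omega>" and ab: "a \<in> Basis" "b \<in> Basis" and "0 < r"
    and sub: "\<And>s t. s \<in> {0..r} \<Longrightarrow> t \<in> {0..r} \<Longrightarrow> x + s *\<^sub>R a + t *\<^sub>R b \<in> \<Omega>"
    and B: "\<And>s t. s \<in> {0..r} \<Longrightarrow> t \<in> {0..r} \<Longrightarrow>
      norm (partial b (partial a f) (x + s *\<^sub>R a + t *\<^sub>R b) - D) \<le> e"
  shows "norm (f (x + r *\<^sub>R a + r *\<^sub>R b) - f (x + r *\<^sub>R a) - f (x + r *\<^sub>R b) + f x - (r * r) *\<^sub>R D) \<le> r * r * e"
proof -
  have sub': "x + r *\<^sub>R b + s *\<^sub>R a \<in> \<Omega>" "x + s *\<^sub>R a \<in> \<Omega>" if "s \<in> {0..r}" for s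
    using sub[OF that, of r] sub[OF that, of 0] \<open>0 < r\<close> by (auto simp: algebra_simps)
  have inner: "norm (partial a f (x + r *\<^sub>R b + s *\<^sub>R a) - partial a f (x + s *\<^sub>R a) - r *\<^sub>R D) \<le> r * e"
    if s: "s \<in> {0..r}" for s
    using vector_mvt_bound[where g = "\<lambda>t. partial a f (x + s *\<^sub>R a + t *\<^sub>R b)" and r = r and D = D and B = e,
        OF _ smooth_has_vector_derivative_line[OF smooth_partial[OF f ab(1)] sub[OF s]] B[OF s]]
      \<open>0 < r\<close> by (simp add: algebra_simps)
  have "norm ((f (x + r *\<^sub>R b + r *\<^sub>R a) - f (x + r *\<^sub>R a)) - (f (x + r *\<^sub>R b + 0 *\<^sub>R a) - f (x + 0 *\<^sub>R a)) - r *\<^sub>R (r *\<^sub>R D)) \<le> r * (r * e)"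
    by (rule vector_mvt_bound[where g = "\<lambda>s. f (x + r *\<^sub>R b + s *\<^sub>R a) - f (x + s *\<^sub>R a)",
        OF _ has_vector_derivative_diff inner])
      (use \<open>0 < r\<close> in \<open>auto intro!: smooth_has_vector_derivative_line f sub'\<close>)
  then show ?thesis by (simp add: algebra_simps)
qed

lemma partial_commute:
  assumes f: "f \<in> smooth_fns \<Omega>" and "open \<Omega>" and x: "x \<in> \<Omega>" and ab: "a \<in> Basis" "b \<in> Basis"
  shows "partial a (partial b f) x = partial b (partial a f) x"
proof (rule ccontr)
  let ?P = "partial a (partial b f)" and ?Q = "partial b (partial a f)"
  assume ne: "?P x \<noteq> ?Q x"
  \<comment> \<open>One third of the assumed gap: two approximations of the same second difference,
    each with error \<open>r * r * e\<close>, cannot belong to values that are \<open>3 * e\<close>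
    apart.\<close>
  define e where "e = norm (?P x - ?Q x) / 3"
  have "e > 0" using ne by (simp add: e_def)
  have cont: "isCont ?P x" "isCont ?Q x"
    using smooth_continuous[OF smooth_partial[OF smooth_partial[OF f]]] ab assms(2) x
    by (simp_all add: continuous_on_eq_continuous_at)
  obtain d1 where d1: "d1 > 0" "\<And>y. dist y x < d1 \<Longrightarrow> dist (?P y) (?P x) < e"
    using cont(1) \<open>e > 0\<close> unfolding continuous_at_eps_delta by blast
  obtain d2 where d2: "d2 > 0" "\<And>y. dist y x < d2 \<Longrightarrow> dist (?Q y) (?Q x) < e"
    using cont(2) \<open>e > 0\<close> unfolding continuous_at_eps_delta by blast
  obtain d3 where d3: "d3 > 0" "ball x d3 \<subseteq> \<Omega>"
    using assms(2) x open_contains_ball by blast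
  define d where "d = Min {d1, d2, d3}"
  \<comment> \<open>Two displacements of length at most \<open>r\<close> stay strictly within the
    radius \<open>d\<close>.\<close>
  define r where "r = d / 3"
  have d: "d > 0" "d \<le> d1" "d \<le> d2" "d \<le> d3" using d1 d2 d3 by (auto simp: d_def)
  have "r > 0" using d by (simp add: r_def)
  have near: "dist (x + s *\<^sub>R u + t *\<^sub>R v) x < d"
    if "s \<in> {0..r}" "t \<in> {0..r}" "u \<in> Basis" "v \<in> Basis" for s t u v
  proof -
    have "dist (x + s *\<^sub>R u + t *\<^sub>R v) x \<le> norm (s *\<^sub>R u) + norm (t *\<^sub>R v)"
      by (metis add.assoc add_diff_cancel_left' dist_norm norm_triangle_ineq)
    also have "\<dots> \<le> r + r" using that by simp
    also have "\<dots> < d" using d by (simp add: r_def)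
    finally show ?thesis .
  qed
  let ?\<Delta> = "f (x + r *\<^sub>R a + r *\<^sub>R b) - f (x + r *\<^sub>R a) - f (x + r *\<^sub>R b) + f x"
  have 1: "norm (?\<Delta> - (r * r) *\<^sub>R ?Q x) \<le> r * r * e"
  proof (rule second_difference_bound[OF f ab \<open>r > 0\<close>])
    fix s t assume "s \<in> {0..r}" "t \<in> {0..r}"
    from near[OF this ab] d d2(2)[of "x + s *\<^sub>R a + t *\<^sub>R b"] d3(2)
    show "x + s *\<^sub>R a + t *\<^sub>R b \<in> \<Omega>" "norm (?Q (x + s *\<^sub>R a + t *\<^sub>R b) - ?Q x) \<le> e"
      by (auto simp: dist_norm[symmetric] dist_commute)
  qed
  have "norm (f (x + r *\<^sub>R b + r *\<^sub>R a) - f (x + r *\<^sub>R b) - f (x + r *\<^sub>R a) + f x - (r * r) *\<^sub>R ?P x) \<le> r * r * e"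
  proof (rule second_difference_bound[OF f ab(2,1) \<open>r > 0\<close>])
    fix s t assume "s \<in> {0..r}" "t \<in> {0..r}"
    from near[OF this ab(2,1)] d d1(2)[of "x + s *\<^sub>R b + t *\<^sub>R a"] d3(2)
    show "x + s *\<^sub>R b + t *\<^sub>R a \<in> \<Omega>" "norm (?P (x + s *\<^sub>R b + t *\<^sub>R a) - ?P x) \<le> e"
      by (auto simp: dist_norm[symmetric] dist_commute)
  qed
  then have 2: "norm (?\<Delta> - (r * r) *\<^sub>R ?P x) \<le> r * r * e"
    by (simp add: algebra_simps)
  have "norm ((r * r) *\<^sub>R (?P x - ?Q x)) = norm ((?\<Delta> - (r * r) *\<^sub>R ?Q x) - (?\<Delta> - (r * r) *\<^sub>R ?P x))"
    by (simp add: algebra_simps)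
  also have "\<dots> \<le> r * r * e + r * r * e"
    using 1 2 norm_triangle_ineq4 by (meson add_mono order_trans)
  finally have "(r * r) * (3 * e) \<le> (r * r) * (2 * e)"
    by (simp add: e_def)
  then show False using \<open>r > 0\<close> \<open>e > 0\<close> by simp
qed

text \<open>\<open>partial_commute\<close> interchanges neighbours, so \<open>b\<close> is carried
  past \<open>bs\<close> one entry at a time.\<close>

lemma pd_move:
  assumes f: "f \<in> smooth_fns \<Omega>" and "open \<Omega>" "b \<in> Basis" "set bs \<subseteq> Basis" "set cs \<subseteq> Basis"
  shows "x \<in> \<Omega> \<Longrightarrow> pd (bs @ b # cs) f x = pd (b # bs @ cs) f x"
  using assms(4)
proof (induction bs arbitrary: x)
  case (Cons c bs)
  have "partial c (pd (bs @ b # cs) f) x = partial c (partial b (pd (bs @ cs) f)) x"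
    using Cons by (intro partial_cong[OF assms(2)]) (auto simp: pd_Cons)
  also have "\<dots> = partial b (partial c (pd (bs @ cs) f)) x"
    using Cons assms by (intro partial_commute[of _ \<Omega>] smooth_pd) auto
  finally show ?case by (simp add: pd_Cons)
qed simp

lemma pd_perm:
  assumes f: "f \<in> smooth_fns \<Omega>" and "open \<Omega>"
  shows "mset bs = mset cs \<Longrightarrow> set bs \<subseteq> Basis \<Longrightarrow> x \<in> \<Omega> \<Longrightarrow> pd bs f x = pd cs f x"
proof (induction bs arbitrary: cs x)
  case (Cons b bs)
  have "b \<in> set cs" using Cons.prems by (metis list.set_intros(1) mset_eq_setD)
  then obtain cs1 cs2 where cs: "cs = cs1 @ b # cs2" by (meson split_list)
  have sub: "set cs \<subseteq> Basis" using Cons.prems mset_eq_setD by blast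
  have "partial b (pd bs f) x = partial b (pd (cs1 @ cs2) f) x"
    using Cons cs by (intro partial_cong[OF assms(2)]) auto
  also have "\<dots> = pd cs f x"
    using pd_move[OF f assms(2), of b cs1 cs2 x] sub Cons.prems cs by (simp add: pd_Cons)
  finally show ?case by (simp add: pd_Cons)
qed simp

section \<open>Seminorms and compactly supported distributions\<close>

definition mi_list :: "('a::euclidean_space \<Rightarrow> nat) \<Rightarrow> 'a list" where
  "mi_list \<alpha> = concat (map (\<lambda>b. replicate (\<alpha> b) b) basis_list)"

lemma mi_deriv_eq_pd: "mi_deriv \<alpha> f = pd (mi_list \<alpha>) f"
proof -
  have rep: "pd (replicate n b @ bs) f = (partial b ^^ n) (pd bs f)" for n b bs
    by (induction n) (simp_all add: pd_Cons)
  have "foldr (\<lambda>b. partial b ^^ \<alpha> b) bs f = pd (concat (map (\<lambda>b. replicate (\<alpha> b) b) bs)) f" for bs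
    by (induction bs) (simp_all add: rep)
  then show ?thesis by (simp add: mi_deriv_def mi_list_def)
qed

lemma set_mi_list: "set (mi_list \<alpha>) \<subseteq> Basis"
  by (auto simp: mi_list_def basis_list)

lemma length_mi_list: "length (mi_list \<alpha>) = mi_size \<alpha>"
proof -
  have "length (mi_list \<alpha>) = sum_list (map \<alpha> basis_list)"
    by (simp add: mi_list_def length_concat comp_def)
  also have "\<dots> = mi_size \<alpha>"
    by (simp add: mi_size_def sum_list_distinct_conv_sum_set basis_list)
  finally show ?thesis .
qed

text \<open>\<open>count_list\<close> inverts \<open>mi_list\<close> up to order; for smooth
  functions, lists and multi-indices thus describe the same derivatives.\<close>

lemma mset_mi_list_count_list:
  assumes "set bs \<subseteq> Basis"
  shows "mset (mi_list (count_list bs)) = mset bs"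
proof (rule multiset_eqI)
  fix c :: 'a
  have "count (mset (concat (map (\<lambda>b. replicate (\<alpha> b) b) L))) c = (if c \<in> set L then \<alpha> c else 0)"
    if "distinct L" for \<alpha> and L
    using that by (induction L) auto
  then show "count (mset (mi_list (count_list bs))) c = count (mset bs) c"
    using assms by (auto simp: mi_list_def basis_list count_list_0_iff count_mset)
qed

lemma mi_size_count_list: "set bs \<subseteq> Basis \<Longrightarrow> mi_size (count_list bs) = length bs"
  by (metis length_mi_list mset_mi_list_count_list size_mset)

lemma finite_basis_lists: "finite {bs :: 'a::euclidean_space list. set bs \<subseteq> Basis \<and> length bs \<le> l}"
  by (rule finite_lists_length_le) simp

lemma seminorm_le:
  assumes "0 \<le> B"
    and "\<And>bs x. set bs \<subseteq> Basis \<Longrightarrow> length bs \<le> l \<Longrightarrow> x \<in> K \<Longrightarrow> norm (pd bs f x) \<le> B"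
  shows "seminorm K l f \<le> B"
  unfolding seminorm_def
  by (rule cSup_least) (use assms in \<open>auto simp: mi_deriv_eq_pd set_mi_list length_mi_list\<close>)

text \<open>Without a bound the \<open>Sup\<close> in \<open>seminorm\<close> would carry no
  information. There are infinitely many \<open>\<alpha>\<close>, their values off
  \<open>Basis\<close> being free, but they yield only finitely many lists of length at most
  \<open>l\<close>.\<close>

lemma bdd_above_seminorm:
  assumes "f \<in> smooth_fns \<Omega>" "compact K" "K \<subseteq> \<Omega>"
  shows "bdd_above (insert 0 {norm (mi_deriv \<alpha> f x) | x \<alpha>. x \<in> K \<and> mi_size \<alpha> \<le> l})"
proof -
  let ?BS = "{bs :: 'a list. set bs \<subseteq> Basis \<and> length bs \<le> l}"
  have "bdd_above ((\<lambda>x. norm (pd bs f x)) ` K)" if "bs \<in> ?BS" for bs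
  proof -
    have "continuous_on K (pd bs f)"
      using that assms by (auto intro!: continuous_on_subset[OF smooth_continuous[OF smooth_pd]])
    then show ?thesis
      by (intro bounded_imp_bdd_above compact_imp_bounded compact_continuous_image
          continuous_on_norm assms)
  qed
  then have "bdd_above (\<Union>bs\<in>?BS. (\<lambda>x. norm (pd bs f x)) ` K)"
    by (simp add: bdd_above_UN finite_basis_lists)
  moreover have "{norm (mi_deriv \<alpha> f x) | x \<alpha>. x \<in> K \<and> mi_size \<alpha> \<le> l}
      \<subseteq> (\<Union>bs\<in>?BS. (\<lambda>x. norm (pd bs f x)) ` K)"
  proof (intro subsetI)
    fix r assume "r \<in> {norm (mi_deriv \<alpha> f x) | x \<alpha>. x \<in> K \<and> mi_size \<alpha> \<le> l}"
    then obtain x \<alpha> where "r = norm (pd (mi_list \<alpha>) f x)" "x \<in> K" "mi_list \<alpha> \<in> ?BS"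
      by (auto simp: mi_deriv_eq_pd set_mi_list length_mi_list)
    then show "r \<in> (\<Union>bs\<in>?BS. (\<lambda>x. norm (pd bs f x)) ` K)" by blast
  qed
  ultimately show ?thesis
    by (simp add: bdd_above_mono)
qed

lemma seminorm_nonneg:
  assumes "f \<in> smooth_fns \<Omega>" "compact K" "K \<subseteq> \<Omega>"
  shows "0 \<le> seminorm K l f"
  unfolding seminorm_def by (rule cSup_upper[OF _ bdd_above_seminorm[OF assms]]) simp

text \<open>The seminorm mentions only derivatives taken in the order of \<open>basis_list\<close>;
  symmetry of the derivatives extends the bound to every order.\<close>

lemma pd_le_seminorm:
  assumes f: "f \<in> smooth_fns \<Omega>" and "open \<Omega>" "compact K" "K \<subseteq> \<Omega>"
    and bs: "set bs \<subseteq> Basis" "length bs \<le> l" and "x \<in> K"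
  shows "norm (pd bs f x) \<le> seminorm K l f"
proof -
  have "pd bs f x = mi_deriv (count_list bs) f x"
    unfolding mi_deriv_eq_pd using assms set_mi_list
    by (intro pd_perm[OF f]) (auto simp: mset_mi_list_count_list)
  moreover have "norm (mi_deriv (count_list bs) f x) \<in> {norm (mi_deriv \<alpha> f x) | x \<alpha>. x \<in> K \<and> mi_size \<alpha> \<le> l}"
    using bs \<open>x \<in> K\<close> mi_size_count_list[OF bs(1)] by fastforce
  ultimately show ?thesis
    unfolding seminorm_def by (intro cSup_upper[OF _ bdd_above_seminorm[OF f assms(3,4)]]) simp
qed

text \<open>The continuity estimate of a distribution freed from \<open>Sup\<close>: any pointwise
  bound \<open>B\<close> for the derivatives on \<open>K\<close> may be inserted. The compact set
  \<open>K\<close> takes over the role of the support of \<open>T\<close>.\<close>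

definition controlled ::
  "(('a::euclidean_space \<Rightarrow> complex) \<Rightarrow> complex) \<Rightarrow> 'a set \<Rightarrow> 'a set \<Rightarrow> nat \<Rightarrow> real \<Rightarrow> bool" where
  "controlled T \<Omega> K l C \<longleftrightarrow> compact K \<and> K \<subseteq> \<Omega> \<and> 0 \<le> C \<and>
     (\<forall>f\<in>smooth_fns \<Omega>. \<forall>B\<ge>0.
        (\<forall>bs. set bs \<subseteq> Basis \<longrightarrow> length bs \<le> l \<longrightarrow> (\<forall>x\<in>K. norm (pd bs f x) \<le> B)) \<longrightarrow>
        norm (T f) \<le> C * B)"

lemma controlledD:
  assumes "controlled T \<Omega> K l C" "f \<in> smooth_fns \<Omega>" "0 \<le> B"
    "\<And>bs x. set bs \<subseteq> Basis \<Longrightarrow> length bs \<le> l \<Longrightarrow> x \<in> K \<Longrightarrow> norm (pd bs f x) \<le> B"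
  shows "norm (T f) \<le> C * B"
  using assms unfolding controlled_def by blast

lemma compact_distribution_controlled:
  assumes "T \<in> compact_distributions \<Omega>"
  obtains K l C where "controlled T \<Omega> K l C"
proof -
  obtain K l C where K: "compact K" "K \<subseteq> \<Omega>" "\<And>f. f \<in> smooth_fns \<Omega> \<Longrightarrow> norm (T f) \<le> C * seminorm K l f"
    using assms unfolding compact_distributions_def by blast
  have "norm (T f) \<le> \<bar>C\<bar> * B"
    if f: "f \<in> smooth_fns \<Omega>" and "0 \<le> B"
      and "\<And>bs x. set bs \<subseteq> Basis \<Longrightarrow> length bs \<le> l \<Longrightarrow> x \<in> K \<Longrightarrow> norm (pd bs f x) \<le> B" for f B
  proof -
    have "norm (T f) \<le> C * seminorm K l f" by (rule K(3)[OF f])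
    \<comment> \<open>The constant in \<open>compact_distributions\<close> carries no sign
      condition, while \<open>controlled\<close> asks for a nonnegative one.\<close>
    also have "\<dots> \<le> \<bar>C\<bar> * seminorm K l f"
      using seminorm_nonneg[OF f K(1,2)] by (intro mult_right_mono) auto
    also have "\<dots> \<le> \<bar>C\<bar> * B"
      using seminorm_le[OF that(2,3)] by (intro mult_left_mono) auto
    finally show ?thesis .
  qed
  then have "controlled T \<Omega> K l \<bar>C\<bar>" using K(1,2) unfolding controlled_def by auto
  then show ?thesis by (rule that)
qed

context
  fixes \<Omega> :: "'a::euclidean_space set" and T
  assumes "open \<Omega>" and T: "T \<in> compact_distributions \<Omega>"
begin

lemma distr_add: "f \<in> smooth_fns \<Omega> \<Longrightarrow> g \<in> smooth_fns \<Omega> \<Longrightarrow> T (\<lambda>x. f x + g x) = T f + T g"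
  using T by (auto simp: compact_distributions_def)

lemma distr_cmult: "f \<in> smooth_fns \<Omega> \<Longrightarrow> T (\<lambda>x. c * f x) = c * T f"
  using T by (auto simp: compact_distributions_def)

lemma distr_zero: "T (\<lambda>x. 0) = 0"
  using distr_cmult[OF smooth_const, of 0 0] by simp

lemma distr_scaleR: "f \<in> smooth_fns \<Omega> \<Longrightarrow> T (\<lambda>x. r *\<^sub>R f x) = r *\<^sub>R T f"
  using distr_cmult[of f "of_real r"] by (simp add: scaleR_conv_of_real)

lemma distr_diff: 
  assumes "f \<in> smooth_fns \<Omega>" "g \<in> smooth_fns \<Omega>" 
  shows "T (\<lambda>x. f x - g x) = T f - T g"
  using distr_add[OF assms(1) smooth_minus[OF \<open>open \<Omega>\<close> assms(2)]] distr_cmult[OF assms(2), of "-1"]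
  by simp

lemma distr_sum: "(\<And>i. i \<in> I \<Longrightarrow> f i \<in> smooth_fns \<Omega>) \<Longrightarrow> T (\<lambda>x. \<Sum>i\<in>I. f i x) = (\<Sum>i\<in>I. T (f i))"
proof (induction I rule: infinite_finite_induct)
  case (insert i I)
  then show ?case
    using distr_add[of "f i" "\<lambda>x. \<Sum>i\<in>I. f i x"] smooth_sum[OF \<open>open \<Omega>\<close>, of I f] by simp
qed (simp_all add: distr_zero)

text \<open>All derivatives of the difference vanish on \<open>K\<close>, so the continuity estimate
  applies with bound \<open>0\<close>. Agreement on a neighbourhood of \<open>K\<close> is what
  makes the derivatives agree as well.\<close>

lemma distr_local:
  assumes "controlled T \<Omega> K l C" "f \<in> smooth_fns \<Omega>" "g \<in> smooth_fns \<Omega>"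
    and "open U" "K \<subseteq> U" "\<And>x. x \<in> U \<Longrightarrow> f x = g x"
  shows "T f = T g"
proof -
  have "pd bs (\<lambda>x. f x - g x) x = 0" if "x \<in> K" for bs x
    using pd_cong[OF assms(4), of "\<lambda>x. f x - g x" "\<lambda>x. 0" x bs] assms that by (auto simp: pd_zero)
  then have "norm (T (\<lambda>x. f x - g x)) \<le> C * 0"
    using assms by (intro controlledD[OF assms(1)] smooth_diff \<open>open \<Omega>\<close>) auto
  then show ?thesis using distr_diff[OF assms(2,3)] by simp
qed

end

section \<open>Parameter-dependent functions\<close>

lemma has_derivative_Pair1: "((\<lambda>x. (x, y)) has_derivative (\<lambda>v. (v, 0))) (at x)"
  and has_derivative_Pair2: "(Pair x has_derivative Pair 0) (at y)"
  by (auto intro!: derivative_eq_intros)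

lemma Pair_Basis: "b \<in> Basis \<Longrightarrow> (b, 0) \<in> Basis" "c \<in> Basis \<Longrightarrow> (0, c) \<in> Basis"
  by (auto simp: Basis_prod_def)

context
  fixes X :: "'a::euclidean_space set" and Y :: "'b::euclidean_space set"
  assumes XY: "open X" "open Y"
begin

lemma smooth_slice:
  assumes "h \<in> smooth_fns (X \<times> Y)"
  shows "x \<in> X \<Longrightarrow> (\<lambda>y. h (x, y)) \<in> smooth_fns Y"
    and "y \<in> Y \<Longrightarrow> (\<lambda>x. h (x, y)) \<in> smooth_fns X"
  by (rule smooth_affine[where \<Omega> = "X \<times> Y", OF has_derivative_Pair2] 
       smooth_affine[where \<Omega> = "X \<times> Y", OF has_derivative_Pair1]; use XY assms in auto)+

lemma pd_slice:
  assumes h: "h \<in> smooth_fns (X \<times> Y)" and "x \<in> X" "y \<in> Y"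
  shows "set cs \<subseteq> Basis \<Longrightarrow> pd cs (\<lambda>y. h (x, y)) y = pd (map (Pair 0) cs) h (x, y)"
    and "set bs \<subseteq> Basis \<Longrightarrow> pd bs (\<lambda>x. h (x, y)) x = pd (map (\<lambda>b. (b, 0)) bs) h (x, y)"
  using pd_affine[where A = "Pair x" and \<Omega> = "X \<times> Y", OF has_derivative_Pair2 XY(2) _ h, of y cs]
    pd_affine[where A = "\<lambda>x. (x, y)" and \<Omega> = "X \<times> Y", OF has_derivative_Pair1 XY(1) _ h, of x bs]
    assms Pair_Basis by (auto simp: image_subset_iff)

text \<open>A tube argument: compactness of \<open>K\<close> makes continuity in \<open>x\<close>
  uniform in \<open>y\<close>. A finite set of functions is treated at once because the order of
  \<open>T\<close> calls for several derivatives simultaneously.\<close>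

lemma uniform_slices:
  assumes "finite G" "\<And>g. g \<in> G \<Longrightarrow> continuous_on (X \<times> Y) g" "compact K" "K \<subseteq> Y" "x \<in> X" "0 < (e::real)"
  shows "\<exists>d>0. ball x d \<subseteq> X \<and> (\<forall>g\<in>G. \<forall>x'\<in>ball x d. \<forall>y\<in>K. norm (g (x', y) - g (x, y) :: complex) \<le> e)"
  using assms(1,2)
proof (induction G rule: finite_induct)
  case empty
  then show ?case using XY(1) assms(5) open_contains_ball by blast
next
  case (insert g G)
  have "\<exists>d>0. ball x d \<subseteq> X \<and> (\<forall>g\<in>G. \<forall>x'\<in>ball x d. \<forall>y\<in>K. norm (g (x', y) - g (x, y)) \<le> e)"
    by (rule insert.IH) (simp add: insert.prems)
  then obtain d1 where d1: "d1 > 0" "ball x d1 \<subseteq> X"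
    "\<And>g x' y. g \<in> G \<Longrightarrow> x' \<in> ball x d1 \<Longrightarrow> y \<in> K \<Longrightarrow> norm (g (x', y) - g (x, y)) \<le> e"
    by blast
  have cont: "continuous_on (X \<times> K) g"
    by (rule continuous_on_subset[OF insert.prems]) (use assms(4) in auto)
  obtain X0 where X0: "x \<in> X0" "open X0" "\<forall>x'\<in>X0 \<inter> X. \<forall>y\<in>K. dist (g (x', y)) (g (x, y)) \<le> e"
    by (rule continuous_on_prod_compactE[OF cont assms(3,5,6)])
  then obtain d2 where d2: "d2 > 0" "ball x d2 \<subseteq> X0" using open_contains_ball by blast
  have "min d1 d2 > 0" using d1 d2 by simp
  moreover have "ball x (min d1 d2) \<subseteq> X" using d1(2) by auto
  moreover have "norm (g' (x', y) - g' (x, y)) \<le> e"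
    if "g' \<in> insert g G" "x' \<in> ball x (min d1 d2)" "y \<in> K" for g' x' y
  proof -
    have "x' \<in> ball x d1" "x' \<in> X0 \<inter> X" using that d1(2) d2(2) by auto
    then show ?thesis using that X0(3) d1(3) by (auto simp: dist_norm)
  qed
  ultimately show ?case by blast
qed

text \<open>The mean value inequality for the slice in the first variable; its gradient varies by at
  most \<open>e\<close> in each of the \<open>DIM('a)\<close> coordinates.\<close>

lemma slice_linearization:
  fixes g :: "'a \<times> 'b \<Rightarrow> complex" and e :: real
  assumes g: "g \<in> smooth_fns (X \<times> Y)" and "ball x d \<subseteq> X" "x' \<in> ball x d" "y \<in> Y"
    and B: "\<And>b z. b \<in> Basis \<Longrightarrow> z \<in> ball x d \<Longrightarrow> norm (partial (b, 0) g (z, y) - partial (b, 0) g (x, y)) \<le> e"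
  shows "norm (g (x', y) - g (x, y) - (\<Sum>b\<in>Basis. ((x' - x) \<bullet> b) *\<^sub>R partial (b, 0) g (x, y)))
    \<le> norm (x' - x) * (DIM('a) * e)"
proof -
  let ?f' = "\<lambda>z v. \<Sum>b\<in>Basis. (v \<bullet> b) *\<^sub>R partial (b, 0) g (z, y)"
  have x: "x \<in> ball x d" using assms(3) by (metis ball_eq_empty centre_in_ball empty_iff not_le)
  show ?thesis
  proof (rule differentiable_bound_linearization[where S = "ball x d" and f' = ?f' and f = "\<lambda>z. g (z, y)"])
    show "x + t *\<^sub>R (x' - x) \<in> ball x d" if "t \<in> {0..1}" for t
      using convexD_alt[OF convex_ball x assms(3), of t] that by (simp add: algebra_simps)
    show "((\<lambda>z. g (z, y)) has_derivative ?f' z) (at z within ball x d)" if "z \<in> ball x d" for z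
    proof -
      have z: "z \<in> X" "(z, y) \<in> X \<times> Y" using that assms by auto
      have s: "(\<lambda>z. g (z, y)) \<in> smooth_fns X" by (rule smooth_slice(2)[OF g \<open>y \<in> Y\<close>])
      have "frechet_derivative (\<lambda>z. g (z, y)) (at z) v = ?f' z v" for v
        using partial_expand[OF smooth_differentiable[OF s z(1)], of v]
          pd_slice(2)[OF g z(1) \<open>y \<in> Y\<close>, of "[b]" for b] by (simp add: partial_def[of v] pd_Cons)
      then show ?thesis
        using smooth_has_derivative[OF s z(1)] has_derivative_at_withinI
        by (metis (no_types, lifting) ext)
    qed
    show "onorm (?f' z - ?f' x) \<le> DIM('a) * e" if z: "z \<in> ball x d" for z
    proof (rule onorm_le)
      fix v
      have "norm ((?f' z - ?f' x) v) = norm (\<Sum>b\<in>Basis. (v \<bullet> b) *\<^sub>R (partial (b, 0) g (z, y) - partial (b, 0) g (x, y)))"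
        by (simp add: sum_subtractf scaleR_diff_right)
      also have "\<dots> \<le> (\<Sum>b\<in>(Basis :: 'a set). norm v * e)"
      proof (rule sum_norm_le)
        fix b :: 'a assume "b \<in> Basis"
        then show "norm ((v \<bullet> b) *\<^sub>R (partial (b, 0) g (z, y) - partial (b, 0) g (x, y))) \<le> norm v * e"
          unfolding norm_scaleR real_norm_def by (intro mult_mono Basis_le_norm B z) auto
      qed
      finally show "norm ((?f' z - ?f' x) v) \<le> DIM('a) * e * norm v"
        by (simp add: mult_ac)
    qed
  qed (use x in auto)
qed

context
  fixes T :: "('b \<Rightarrow> complex) \<Rightarrow> complex"
  assumes T: "T \<in> compact_distributions Y"
begin

text \<open>\<open>T\<close> is applied to the first-order Taylor remainder of \<open>h\<close> in
  \<open>x\<close>. By continuity of \<open>T\<close> it is enough that this remainder is small of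
  first order, with its \<open>y\<close>-derivatives up to order \<open>l\<close>, uniformly on
  \<open>K\<close>.\<close>

lemma classical_op_has_derivative:
  assumes h: "h \<in> smooth_fns (X \<times> Y)" and x: "x \<in> X"
  shows "(classical_op h T has_derivative
    (\<lambda>v. \<Sum>b\<in>Basis. (v \<bullet> b) *\<^sub>R classical_op (partial (b, 0) h) T x)) (at x)"
  unfolding has_derivative_at_alt
proof (intro conjI allI impI)
  let ?D = "\<lambda>v. \<Sum>b\<in>Basis. (v \<bullet> b) *\<^sub>R classical_op (partial (b, 0) h) T x"
  show "bounded_linear ?D"
    by (intro bounded_linear_sum bounded_linear_scaleR_left[THEN bounded_linear_compose]
        bounded_linear_inner_left)
  fix e :: real assume "e > 0"
  obtain K l C where c: "controlled T Y K l C" by (rule compact_distribution_controlled[OF T])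
  then have K: "compact K" "K \<subseteq> Y" "0 \<le> C" by (auto simp: controlled_def)
  \<comment> \<open>Chosen so that \<open>C * (DIM('a) * e') \<le> e\<close>; the added
    \<open>1\<close> keeps the denominator positive when \<open>C = 0\<close>.\<close>
  define e' where "e' = e / (C * DIM('a) + 1)"
  have "0 < C * DIM('a) + 1" using K(3) by (simp add: add_nonneg_pos)
  then have "e' > 0" "C * (DIM('a) * e') \<le> e"
    using \<open>e > 0\<close> by (simp_all add: e'_def field_simps)
  \<comment> \<open>The \<open>x\<close>-gradients of all \<open>y\<close>-derivatives that the
    estimate for \<open>T\<close> can see.\<close>
  define G where "G = (\<lambda>(b, cs). partial (b, 0) (pd (map (Pair 0) cs) h)) `
    (Basis \<times> {cs :: 'b list. set cs \<subseteq> Basis \<and> length cs \<le> l})"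
  have sm: "pd (map (Pair 0) cs) h \<in> smooth_fns (X \<times> Y)" if "set cs \<subseteq> Basis" for cs
    using that Pair_Basis by (intro smooth_pd[OF h]) auto
  have "finite G" unfolding G_def by (intro finite_imageI finite_cartesian_product finite_basis_lists) simp
  moreover have "continuous_on (X \<times> Y) g" if "g \<in> G" for g
    using that Pair_Basis by (auto simp: G_def intro!: smooth_continuous smooth_partial sm)
  ultimately obtain d where d: "d > 0" "ball x d \<subseteq> X"
    "\<And>g x' y. g \<in> G \<Longrightarrow> x' \<in> ball x d \<Longrightarrow> y \<in> K \<Longrightarrow> norm (g (x', y) - g (x, y)) \<le> e'"
    using uniform_slices[of G K x e'] K x \<open>e' > 0\<close> by blast
  have "norm (classical_op h T x' - classical_op h T x - ?D (x' - x)) \<le> e * norm (x' - x)"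
    if "norm (x' - x) < d" for x'
  proof -
    have x': "x' \<in> ball x d" "x' \<in> X" using that d(2) by (auto simp: dist_norm norm_minus_commute)
    let ?S = "\<lambda>y. \<Sum>b\<in>Basis. ((x' - x) \<bullet> b) *\<^sub>R partial (b, 0) h (x, y)"
    have sb: "(\<lambda>y. partial (b, 0) h (x, y)) \<in> smooth_fns Y" if "b \<in> Basis" for b
      using that by (intro smooth_slice x smooth_partial h Pair_Basis)
    have sb': "(\<lambda>y. ((x' - x) \<bullet> b) *\<^sub>R partial (b, 0) h (x, y)) \<in> smooth_fns Y" if "b \<in> Basis" for b
      by (rule smooth_linear[OF XY(2) bounded_linear_scaleR_right sb[OF that]])
    have sS: "?S \<in> smooth_fns Y" by (rule smooth_sum[OF XY(2) sb'])
    note s1 = smooth_slice(1)[OF h x'(2)] and s2 = smooth_slice(1)[OF h x]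
    have "T (\<lambda>y. h (x', y) - h (x, y) - ?S y) = T (\<lambda>y. h (x', y)) - T (\<lambda>y. h (x, y)) - T ?S"
      using distr_diff[OF XY(2) T smooth_diff[OF XY(2) s1 s2] sS] distr_diff[OF XY(2) T s1 s2] by simp
    also have "T ?S = ?D (x' - x)"
      using distr_sum[where f = "\<lambda>b y. ((x' - x) \<bullet> b) *\<^sub>R partial (b, 0) h (x, y)" and I = Basis, OF XY(2) T sb'] distr_scaleR[OF XY(2) T sb]
      by (simp add: classical_op_def)
    finally have eq: "classical_op h T x' - classical_op h T x - ?D (x' - x)
        = T (\<lambda>y. h (x', y) - h (x, y) - ?S y)"
      by (simp add: classical_op_def)
    have "norm (T (\<lambda>y. h (x', y) - h (x, y) - ?S y)) \<le> C * (norm (x' - x) * (DIM('a) * e'))"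
    proof (rule controlledD[OF c])
      show "(\<lambda>y. h (x', y) - h (x, y) - ?S y) \<in> smooth_fns Y"
        by (intro smooth_diff XY s1 s2 sS)
      show "0 \<le> norm (x' - x) * (DIM('a) * e')" using \<open>e' > 0\<close> by simp
      fix cs :: "'b list" and y assume cs: "set cs \<subseteq> Basis" "length cs \<le> l" and "y \<in> K"
      then have y: "y \<in> Y" using K by auto
      let ?g = "pd (map (Pair 0) cs) h"
      \<comment> \<open>By symmetry of the derivatives, a \<open>y\<close>-derivative of the
        remainder is again a first-order remainder, namely that of the differentiated kernel
        \<open>?g\<close>.\<close>
      have 1: "pd cs (\<lambda>y. ((x' - x) \<bullet> b) *\<^sub>R partial (b, 0) h (x, y)) y = ((x' - x) \<bullet> b) *\<^sub>R partial (b, 0) ?g (x, y)"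
        if b: "b \<in> Basis" for b
      proof -
        have "pd cs (\<lambda>y. ((x' - x) \<bullet> b) *\<^sub>R partial (b, 0) h (x, y)) y
            = ((x' - x) \<bullet> b) *\<^sub>R pd cs (\<lambda>y. partial (b, 0) h (x, y)) y"
          by (rule pd_linear[OF XY(2) bounded_linear_scaleR_right sb[OF b] cs(1) y])
        also have "pd cs (\<lambda>y. partial (b, 0) h (x, y)) y = pd (map (Pair 0) cs @ [(b, 0)]) h (x, y)"
          using pd_slice(1)[OF smooth_partial[OF h Pair_Basis(1)[OF b]] x y cs(1)]
          by (simp add: pd_append pd_Cons)
        also have "\<dots> = pd ((b, 0) # map (Pair 0) cs) h (x, y)"
          by (rule pd_perm[OF h open_Times[OF XY]]) (use x y b cs Pair_Basis in auto)
        finally show ?thesis by (simp add: pd_Cons)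
      qed
      have "pd cs (\<lambda>y. h (x', y) - h (x, y) - ?S y) y
          = ?g (x', y) - ?g (x, y) - (\<Sum>b\<in>Basis. ((x' - x) \<bullet> b) *\<^sub>R partial (b, 0) ?g (x, y))"
        using pd_diff[OF XY(2) smooth_diff[OF XY(2) s1 s2] sS cs(1) y] pd_diff[OF XY(2) s1 s2 cs(1) y]
          pd_slice(1)[OF h x'(2) y cs(1)] pd_slice(1)[OF h x y cs(1)]
          pd_sum[where f = "\<lambda>b y. ((x' - x) \<bullet> b) *\<^sub>R partial (b, 0) h (x, y)" and I = Basis, OF XY(2) sb' cs(1) y] 1 by simp
      also have "norm \<dots> \<le> norm (x' - x) * (DIM('a) * e')"
        by (rule slice_linearization[OF sm[OF cs(1)] d(2) x'(1) y])
          (rule d(3), use cs \<open>y \<in> K\<close> in \<open>auto simp: G_def\<close>)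
      finally show "norm (pd cs (\<lambda>y. h (x', y) - h (x, y) - ?S y) y) \<le> norm (x' - x) * (DIM('a) * e')" .
    qed
    also have "\<dots> = (C * (DIM('a) * e')) * norm (x' - x)" by simp
    also have "\<dots> \<le> e * norm (x' - x)" using \<open>C * (DIM('a) * e') \<le> e\<close> by (rule mult_right_mono) simp
    finally show ?thesis unfolding eq .
  qed
  then show "\<exists>d>0. \<forall>x'. norm (x' - x) < d \<longrightarrow>
      norm (classical_op h T x' - classical_op h T x - ?D (x' - x)) \<le> e * norm (x' - x)"
    using d(1) by blast
qed

lemma partial_classical_op:
  assumes "h \<in> smooth_fns (X \<times> Y)" "x \<in> X" "b \<in> Basis"
  shows "partial b (classical_op h T) x = classical_op (partial (b, 0) h) T x"
  using partial_eqI[OF classical_op_has_derivative[OF assms(1,2)], of b] assms(3)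
  by (simp add: inner_Basis if_distrib if_distribR cong: if_cong)

text \<open>Differentiation changes only the kernel, so the induction on the order runs over all
  kernels at once.\<close>

lemma smooth_classical_op:
  assumes "h \<in> smooth_fns (X \<times> Y)"
  shows "classical_op h T \<in> smooth_fns X"
proof -
  have diff: "classical_op h T differentiable (at x)" if "h \<in> smooth_fns (X \<times> Y)" "x \<in> X" for h x
    by (rule differentiableI[OF classical_op_has_derivative[OF that]])
  have "Ck_on k X (classical_op h T)" if "h \<in> smooth_fns (X \<times> Y)" for h k
    using that
  proof (induction k arbitrary: h)
    case 0
    then show ?case
      by (auto intro!: continuous_at_imp_continuous_on differentiable_imp_continuous_within diff)
  next
    case (Suc k)
    show ?case
      by (rule Ck_on_SucI[OF XY(1) diff[OF Suc.prems] partial_classical_op[OF Suc.prems]])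
        (auto intro!: Suc smooth_partial Pair_Basis)
  qed
  then show ?thesis using assms by (simp add: smooth_fns_def[of X])
qed

lemma pd_classical_op:
  assumes h: "h \<in> smooth_fns (X \<times> Y)"
  shows "x \<in> X \<Longrightarrow> set bs \<subseteq> Basis \<Longrightarrow>
    pd bs (classical_op h T) x = classical_op (pd (map (\<lambda>b. (b, 0)) bs) h) T x"
proof (induction bs arbitrary: x)
  case (Cons b bs)
  have "partial b (pd bs (classical_op h T)) x = partial b (classical_op (pd (map (\<lambda>b. (b, 0)) bs) h) T) x"
    using Cons by (intro partial_cong[OF XY(1)]) auto
  also have "\<dots> = classical_op (partial (b, 0) (pd (map (\<lambda>b. (b, 0)) bs) h)) T x"
    using Cons Pair_Basis by (intro partial_classical_op smooth_pd h) auto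
  finally show ?case by (simp add: pd_Cons)
qed simp

lemma norm_classical_op_le:
  assumes h: "h \<in> smooth_fns (X \<times> Y)" and c: "controlled T Y K l C" and x: "x \<in> X" and "0 \<le> B"
    and B: "\<And>cs y. set cs \<subseteq> Basis \<Longrightarrow> length cs \<le> l \<Longrightarrow> y \<in> K \<Longrightarrow> norm (pd (map (Pair 0) cs) h (x, y)) \<le> B"
  shows "norm (classical_op h T x) \<le> C * B"
  unfolding classical_op_def
proof (rule controlledD[OF c smooth_slice(1)[OF h x] \<open>0 \<le> B\<close>])
  fix cs :: "'b list" and y assume cs: "set cs \<subseteq> Basis" "length cs \<le> l" and "y \<in> K"
  then have "y \<in> Y" using c by (auto simp: controlled_def)
  then show "norm (pd cs (\<lambda>y. h (x, y)) y) \<le> B"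
    using B[OF cs \<open>y \<in> K\<close>] pd_slice(1)[OF h x _ cs(1)] by simp
qed

end

end

section \<open>Integrals over compact sets as distributions\<close>

lemma set_integrable_compact:
  fixes f :: "'a::euclidean_space \<Rightarrow> 'b::{banach, second_countable_topology}"
  shows "compact K \<Longrightarrow> continuous_on K f \<Longrightarrow> set_integrable lborel K f"
  unfolding set_integrable_def by (rule borel_integrable_compact)

lemma norm_set_integral_mult_le:
  fixes f \<phi> :: "'a::euclidean_space \<Rightarrow> complex"
  assumes "compact K" "continuous_on K f" "continuous_on K \<phi>"
    "\<And>y. y \<in> K \<Longrightarrow> norm (f y) \<le> M" "\<And>y. y \<in> K \<Longrightarrow> norm (\<phi> y) \<le> B" "0 \<le> M" "0 \<le> B"
  shows "norm (LINT y:K|lborel. \<phi> y * f y) \<le> measure lborel K * M * B"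
proof -
  have 1: "set_integrable lborel K (\<lambda>y. \<phi> y * f y)"
    by (intro set_integrable_compact continuous_on_mult assms)
  have 2: "set_integrable lborel K (\<lambda>y. B * M)"
    by (intro set_integrable_compact continuous_on_const assms)
  have "norm (LINT y:K|lborel. \<phi> y * f y) \<le> (LINT y:K|lborel. B * M)"
    unfolding set_lebesgue_integral_def
    by (rule Bochner_Integration.integral_norm_bound_integral[OF 1[unfolded set_integrable_def] 2[unfolded set_integrable_def]])
      (use assms in \<open>auto simp: indicator_def norm_mult intro!: mult_mono\<close>)
  also have "\<dots> = measure lborel K * M * B"
    by (simp add: set_lebesgue_integral_def)
  finally show ?thesis .
qed

text \<open>
  Integration over a compact set is a distribution, so the lemmas on \<^const>\<open>classical_op\<close> also give
  differentiation under the integral sign.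
\<close>

lemma set_integral_controlled:
  fixes f :: "'a::euclidean_space \<Rightarrow> complex"
  assumes K: "compact K" "K \<subseteq> \<Omega>" and f: "continuous_on K f" "\<And>y. y \<in> K \<Longrightarrow> norm (f y) \<le> M" "0 \<le> M"
  shows "controlled (\<lambda>\<phi>. LINT y:K|lborel. \<phi> y * f y) \<Omega> K 0 (measure lborel K * M)"
  unfolding controlled_def
proof (intro conjI ballI allI impI K)
  fix \<phi> :: "'a \<Rightarrow> complex" and B :: real
  assume "\<phi> \<in> smooth_fns \<Omega>" "0 \<le> B"
    "\<forall>bs. set bs \<subseteq> Basis \<longrightarrow> length bs \<le> 0 \<longrightarrow> (\<forall>x\<in>K. norm (pd bs \<phi> x) \<le> B)"
  then show "norm (LINT y:K|lborel. \<phi> y * f y) \<le> measure lborel K * M * B"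
    using K f by (intro norm_set_integral_mult_le) (auto intro: continuous_on_subset[OF smooth_continuous])
qed (use assms in simp)

lemma set_integral_distribution:
  fixes f :: "'a::euclidean_space \<Rightarrow> complex"
  assumes K: "compact K" "K \<subseteq> \<Omega>" and "open \<Omega>" and f: "continuous_on K f"
  shows "(\<lambda>\<phi>. LINT y:K|lborel. \<phi> y * f y) \<in> compact_distributions \<Omega>"
proof -
  have int: "set_integrable lborel K (\<lambda>y. \<phi> y * f y)" if "\<phi> \<in> smooth_fns \<Omega>" for \<phi>
    by (intro set_integrable_compact K continuous_on_mult f continuous_on_subset[OF smooth_continuous[OF that]])
  obtain M where M: "\<And>y. y \<in> K \<Longrightarrow> norm (f y) \<le> M" "0 \<le> M"
    using compact_imp_bounded[OF compact_continuous_image[OF f K(1)]]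
    unfolding bounded_pos by (metis imageI less_imp_le)
  have "norm (LINT y:K|lborel. \<phi> y * f y) \<le> measure lborel K * M * seminorm K 0 \<phi>"
    if "\<phi> \<in> smooth_fns \<Omega>" for \<phi>
    using that pd_le_seminorm[OF that \<open>open \<Omega>\<close> K, of _ 0] seminorm_nonneg[OF that K]
    by (intro controlledD[OF set_integral_controlled[OF K f M]]) auto
  then have "\<exists>K' l C. compact K' \<and> K' \<subseteq> \<Omega> \<and>
      (\<forall>\<phi>\<in>smooth_fns \<Omega>. norm (LINT y:K|lborel. \<phi> y * f y) \<le> C * seminorm K' l \<phi>)"
    using K by blast
  then show ?thesis
    unfolding compact_distributions_def
    using int by (simp add: distrib_right set_integral_add(2) mult.assoc)
qed

section \<open>Nets of smooth functions\<close>

text \<open>An integer exponent covers growth and decay alike: moderate nets have some order for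
  each derivative and compact set, null nets have every order.\<close>

definition order_on :: "'a set \<Rightarrow> (real \<Rightarrow> 'a \<Rightarrow> 'c::real_normed_vector) \<Rightarrow> int \<Rightarrow> bool" where
  "order_on K u k \<longleftrightarrow> (\<exists>C\<ge>0. \<forall>\<^sub>F e in at_right 0. \<forall>x\<in>K. norm (u e x) \<le> C * e powi k)"

lemma eventually_at_right_01: "\<forall>\<^sub>F e in at_right (0::real). 0 < e \<and> e < 1"
  using eventually_at_right_real[of 0 "1::real"] by simp

lemma order_onI:
  assumes "\<forall>\<^sub>F e in at_right 0. \<forall>x\<in>K. norm (u e x) \<le> C * e powi k"
  shows "order_on K u k"
  unfolding order_on_def
proof (intro exI conjI)
  show "\<forall>\<^sub>F e in at_right 0. \<forall>x\<in>K. norm (u e x) \<le> \<bar>C\<bar> * e powi k"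
    using assms eventually_at_right_01
  proof eventually_elim
    case (elim e)
    have "C * e powi k \<le> \<bar>C\<bar> * e powi k" using elim by (intro mult_right_mono) auto
    then show ?case using elim by (meson order_trans)
  qed
qed simp

lemma order_on_dominated:
  assumes "order_on K v k" "\<forall>\<^sub>F e in at_right 0. \<forall>x\<in>K. norm (u e x) \<le> norm (v e x)"
  shows "order_on K u k"
proof -
  obtain C where "\<forall>\<^sub>F e in at_right 0. \<forall>x\<in>K. norm (v e x) \<le> C * e powi k"
    using assms by (auto simp: order_on_def)
  with assms(2) have "\<forall>\<^sub>F e in at_right 0. \<forall>x\<in>K. norm (u e x) \<le> C * e powi k"
    by eventually_elim (meson order_trans)
  then show ?thesis by (rule order_onI)
qed

lemma order_on_cong:
  assumes "order_on K v k" "\<And>e x. 0 < e \<Longrightarrow> e < 1 \<Longrightarrow> x \<in> K \<Longrightarrow> u e x = v e x"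
  shows "order_on K u k"
  by (rule order_on_dominated[OF assms(1)])
    (use eventually_at_right_01 in eventually_elim, simp add: assms(2))

lemma order_on_mono:
  assumes "order_on K u k" "j \<le> k"
  shows "order_on K u j"
proof -
  obtain C where C: "0 \<le> C" "\<forall>\<^sub>F e in at_right 0. \<forall>x\<in>K. norm (u e x) \<le> C * e powi k"
    using assms by (auto simp: order_on_def)
  from C(2) eventually_at_right_01
  have "\<forall>\<^sub>F e in at_right 0. \<forall>x\<in>K. norm (u e x) \<le> C * e powi j"
  proof eventually_elim
    case (elim e)
    then have "e powi k \<le> e powi j"
      using assms(2) by (intro power_int_decreasing) auto
    then have "C * e powi k \<le> C * e powi j" using C(1) by (rule mult_left_mono)
    then show ?case using elim by (meson order_trans)
  qed
  then show ?thesis by (rule order_onI)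
qed

lemma order_on_add:
  assumes "order_on K u k" "order_on K v k"
  shows "order_on K (\<lambda>e x. u e x + v e x) k"
proof -
  obtain C D where
    "\<forall>\<^sub>F e in at_right 0. \<forall>x\<in>K. norm (u e x) \<le> C * e powi k"
    "\<forall>\<^sub>F e in at_right 0. \<forall>x\<in>K. norm (v e x) \<le> D * e powi k"
    using assms by (auto simp: order_on_def)
  then have "\<forall>\<^sub>F e in at_right 0. \<forall>x\<in>K. norm (u e x + v e x) \<le> (C + D) * e powi k"
    by eventually_elim (auto simp: distrib_right intro!: norm_triangle_le add_mono)
  then show ?thesis by (rule order_onI)
qed

lemma order_on_mult:
  fixes u v :: "real \<Rightarrow> 'a \<Rightarrow> 'c::real_normed_algebra"
  assumes "order_on K u k" "order_on K v j"
  shows "order_on K (\<lambda>e x. u e x * v e x) (k + j)"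
proof -
  obtain C D where
    CD: "0 \<le> C" "\<forall>\<^sub>F e in at_right 0. \<forall>x\<in>K. norm (u e x) \<le> C * e powi k"
    "\<forall>\<^sub>F e in at_right 0. \<forall>x\<in>K. norm (v e x) \<le> D * e powi j"
    using assms by (auto simp: order_on_def)
  from CD(2,3) eventually_at_right_01
  have "\<forall>\<^sub>F e in at_right 0. \<forall>x\<in>K. norm (u e x * v e x) \<le> (C * D) * e powi (k + j)"
  proof eventually_elim
    case (elim e)
    show ?case
    proof
      fix x assume x: "x \<in> K"
      have "norm (u e x * v e x) \<le> norm (u e x) * norm (v e x)" by (rule norm_mult_ineq)
      also have "\<dots> \<le> (C * e powi k) * (D * e powi j)"
        using elim x CD(1) by (intro mult_mono) auto
      also have "\<dots> = (C * D) * e powi (k + j)"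
        using elim by (simp add: power_int_add)
      finally show "norm (u e x * v e x) \<le> (C * D) * e powi (k + j)" .
    qed
  qed
  then show ?thesis by (rule order_onI)
qed

lemma order_on_const:
  assumes "compact K" "continuous_on K f"
  shows "order_on K (\<lambda>e. f) 0"
proof -
  obtain C where "\<forall>y\<in>f ` K. norm y \<le> C"
    using compact_imp_bounded[OF compact_continuous_image[OF assms(2,1)]] unfolding bounded_iff by blast
  then show ?thesis by (intro order_onI[where C = C]) auto
qed

text \<open>Only finitely many lists enter a seminorm, so the bounds for single derivatives hold
  simultaneously for small \<open>e\<close>, and the sum of their constants serves for the
  supremum.\<close>

lemma seminorm_bigo_iff:
  assumes u: "\<And>e. e \<in> {0<..1} \<Longrightarrow> u e \<in> smooth_fns \<Omega>" and "open \<Omega>" "compact K" "K \<subseteq> \<Omega>"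
  shows "(\<lambda>e. seminorm K l (u e)) \<in> O[at_right 0](\<lambda>e. e powi k) \<longleftrightarrow>
    (\<forall>bs. set bs \<subseteq> Basis \<longrightarrow> length bs \<le> l \<longrightarrow> order_on K (\<lambda>e. pd bs (u e)) k)"
proof (intro iffI allI impI)
  assume "(\<lambda>e. seminorm K l (u e)) \<in> O[at_right 0](\<lambda>e. e powi k)"
  then obtain c where c: "\<forall>\<^sub>F e in at_right 0. norm (seminorm K l (u e)) \<le> c * norm (e powi k)"
    using landau_o.bigE by blast
  fix bs :: "'a list" assume bs: "set bs \<subseteq> Basis" "length bs \<le> l"
  from c eventually_at_right_01
  have "\<forall>\<^sub>F e in at_right 0. \<forall>x\<in>K. norm (pd bs (u e) x) \<le> c * e powi k"
  proof eventually_elim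
    case (elim e)
    show ?case
    proof
      fix x assume x: "x \<in> K"
      have e: "e \<in> {0<..1}" using elim(2) by simp
      have "norm (pd bs (u e) x) \<le> seminorm K l (u e)"
        by (rule pd_le_seminorm[OF u[OF e] assms(2-4) bs x])
      also have "\<dots> \<le> norm (seminorm K l (u e))" by (simp only: real_norm_def abs_ge_self)
      also have "\<dots> \<le> c * norm (e powi k)" by (rule elim(1))
      also have "norm (e powi k) = e powi k"
        unfolding real_norm_def by (rule abs_of_pos, rule zero_less_power_int) (use elim(2) in simp)
      finally show "norm (pd bs (u e) x) \<le> c * e powi k" .
    qed
  qed
  then show "order_on K (\<lambda>e. pd bs (u e)) k" by (rule order_onI)
next
  let ?BS = "{bs :: 'a list. set bs \<subseteq> Basis \<and> length bs \<le> l}"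
  assume "\<forall>bs. set bs \<subseteq> Basis \<longrightarrow> length bs \<le> l \<longrightarrow> order_on K (\<lambda>e. pd bs (u e)) k"
  then have "\<forall>bs\<in>?BS. \<exists>C\<ge>0. \<forall>\<^sub>F e in at_right 0. \<forall>x\<in>K. norm (pd bs (u e) x) \<le> C * e powi k"
    by (simp add: order_on_def)
  from bchoice[OF this] obtain C where C: "\<And>bs. bs \<in> ?BS \<Longrightarrow> 0 \<le> C bs"
    "\<And>bs. bs \<in> ?BS \<Longrightarrow> \<forall>\<^sub>F e in at_right 0. \<forall>x\<in>K. norm (pd bs (u e) x) \<le> C bs * e powi k"
    by blast
  have "\<forall>\<^sub>F e in at_right 0. \<forall>bs\<in>?BS. \<forall>x\<in>K. norm (pd bs (u e) x) \<le> C bs * e powi k"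
    using C(2) by (intro eventually_ball_finite finite_basis_lists) blast
  then have "\<forall>\<^sub>F e in at_right 0. norm (seminorm K l (u e)) \<le> sum C ?BS * norm (e powi k)"
    using eventually_at_right_01
  proof eventually_elim
    case (elim e)
    have "seminorm K l (u e) \<le> sum C ?BS * e powi k"
    proof (rule seminorm_le)
      show "0 \<le> sum C ?BS * e powi k"
        using elim by (intro mult_nonneg_nonneg sum_nonneg C(1)) auto
      fix bs :: "'a list" and x assume bs: "set bs \<subseteq> Basis" "length bs \<le> l" and "x \<in> K"
      then have "norm (pd bs (u e) x) \<le> C bs * e powi k" using elim by auto
      also have "C bs * e powi k \<le> sum C ?BS * e powi k"
        using elim bs by (intro mult_right_mono member_le_sum C(1) finite_basis_lists) auto
      finally show "norm (pd bs (u e) x) \<le> sum C ?BS * e powi k" .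
    qed
    moreover have "0 \<le> seminorm K l (u e)"
      using elim by (intro seminorm_nonneg[OF u assms(3,4)]) auto
    moreover have "norm (e powi k) = e powi k"
      unfolding real_norm_def by (rule abs_of_pos, rule zero_less_power_int) (use elim in simp)
    ultimately show ?case by (simp only: real_norm_def abs_of_nonneg)
  qed
  then show "(\<lambda>e. seminorm K l (u e)) \<in> O[at_right 0](\<lambda>e. e powi k)" by (rule bigoI)
qed

text \<open>Here the exponent may depend on the derivative, which is what induction over lists of
  derivatives produces.\<close>

lemma moderate_nets_iff:
  assumes "open \<Omega>"
  shows "u \<in> moderate_nets \<Omega> \<longleftrightarrow> (\<forall>e\<in>{0<..1}. u e \<in> smooth_fns \<Omega>) \<and>
    (\<forall>K bs. compact K \<and> K \<subseteq> \<Omega> \<and> set bs \<subseteq> Basis \<longrightarrow> (\<exists>k. order_on K (\<lambda>e. pd bs (u e)) k))"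
    (is "?L \<longleftrightarrow> ?S \<and> ?R")
proof -
  have pow: "(\<lambda>e::real. 1 / e ^ n) = (\<lambda>e. e powi (- int n))" for n
    by (simp add: power_int_minus fun_eq_iff inverse_eq_divide)
  have iff: "(\<lambda>e. seminorm K l (u e)) \<in> O[at_right 0](\<lambda>e. 1 / e ^ n) \<longleftrightarrow>
      (\<forall>bs. set bs \<subseteq> Basis \<longrightarrow> length bs \<le> l \<longrightarrow> order_on K (\<lambda>e. pd bs (u e)) (- int n))"
    if "?S" "compact K" "K \<subseteq> \<Omega>" for K l n
    unfolding pow using that by (intro seminorm_bigo_iff[OF _ assms]) auto
  show ?thesis
  proof (intro iffI conjI)
    assume ?L
    then show S: ?S by (simp add: moderate_nets_def)
    show ?R
    proof (intro allI impI)
      fix K and bs :: "'a list" assume K: "compact K \<and> K \<subseteq> \<Omega> \<and> set bs \<subseteq> Basis"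
      then obtain n where "(\<lambda>e. seminorm K (length bs) (u e)) \<in> O[at_right 0](\<lambda>e. 1 / e ^ n)"
        using \<open>?L\<close> unfolding moderate_nets_def by blast
      then show "\<exists>k. order_on K (\<lambda>e. pd bs (u e)) k" using iff[OF S] K by blast
    qed
  next
    assume SR: "?S \<and> ?R"
    have "\<exists>n. (\<lambda>e. seminorm K l (u e)) \<in> O[at_right 0](\<lambda>e. 1 / e ^ n)"
      if K: "compact K" "K \<subseteq> \<Omega>" for K l
    proof -
      let ?BS = "{bs :: 'a list. set bs \<subseteq> Basis \<and> length bs \<le> l}"
      have "\<forall>bs\<in>?BS. \<exists>k. order_on K (\<lambda>e. pd bs (u e)) k" using SR K by blast
      from bchoice[OF this] obtain k where k: "\<And>bs. bs \<in> ?BS \<Longrightarrow> order_on K (\<lambda>e. pd bs (u e)) (k bs)"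
        by blast
      \<comment> \<open>A single exponent for all lists of length at most \<open>l\<close>: the sum
        of the absolute values dominates each of them.\<close>
      define n where "n = (\<Sum>bs\<in>?BS. nat \<bar>k bs\<bar>)"
      have "order_on K (\<lambda>e. pd bs (u e)) (- int n)" if "bs \<in> ?BS" for bs
      proof (rule order_on_mono[OF k[OF that]])
        have "nat \<bar>k bs\<bar> \<le> n" unfolding n_def using that by (intro member_le_sum finite_basis_lists) auto
        then show "- int n \<le> k bs" by linarith
      qed
      then show ?thesis using iff[of K l n] SR K by blast
    qed
    then show ?L using SR by (simp add: moderate_nets_def)
  qed
qed

lemma null_nets_iff:
  assumes "open \<Omega>"
  shows "u \<in> null_nets \<Omega> \<longleftrightarrow> (\<forall>e\<in>{0<..1}. u e \<in> smooth_fns \<Omega>) \<and>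
    (\<forall>K bs k. compact K \<and> K \<subseteq> \<Omega> \<and> set bs \<subseteq> Basis \<longrightarrow> order_on K (\<lambda>e. pd bs (u e)) k)"
    (is "?L \<longleftrightarrow> ?S \<and> ?R")
proof -
  have iff: "(\<lambda>e. seminorm K l (u e)) \<in> O[at_right 0](\<lambda>e. e ^ n) \<longleftrightarrow>
      (\<forall>bs. set bs \<subseteq> Basis \<longrightarrow> length bs \<le> l \<longrightarrow> order_on K (\<lambda>e. pd bs (u e)) (int n))"
    if "?S" "compact K" "K \<subseteq> \<Omega>" for K l n
    using seminorm_bigo_iff[OF _ assms that(2,3), of u l "int n"] that(1) by simp
  show ?thesis
  proof (intro iffI conjI)
    assume ?L
    then show S: ?S by (simp add: null_nets_def)
    show ?R
    proof (intro allI impI)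
      fix K and bs :: "'a list" and k :: int assume K: "compact K \<and> K \<subseteq> \<Omega> \<and> set bs \<subseteq> Basis"
      \<comment> \<open>\<open>nat\<close> sends a negative \<open>k\<close> to \<open>0\<close>,
        which only asks for a stronger bound.\<close>
      then have "(\<lambda>e. seminorm K (length bs) (u e)) \<in> O[at_right 0](\<lambda>e. e ^ nat k)"
        using \<open>?L\<close> unfolding null_nets_def by blast
      then have "order_on K (\<lambda>e. pd bs (u e)) (int (nat k))" using iff[OF S] K by blast
      then show "order_on K (\<lambda>e. pd bs (u e)) k" by (rule order_on_mono) simp
    qed
  next
    assume SR: "?S \<and> ?R"
    have "(\<lambda>e. seminorm K l (u e)) \<in> O[at_right 0](\<lambda>e. e ^ n)" if "compact K" "K \<subseteq> \<Omega>" for K l n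
      unfolding iff[OF conjunct1[OF SR] that] using SR that by simp
    then show ?L using SR by (simp add: null_nets_def)
  qed
qed

context
  fixes \<Omega> :: "'a::euclidean_space set"
  assumes op: "open \<Omega>"
begin

lemma moderate_smooth: "u \<in> moderate_nets \<Omega> \<Longrightarrow> 0 < e \<Longrightarrow> e \<le> 1 \<Longrightarrow> u e \<in> smooth_fns \<Omega>"
  and null_smooth: "u \<in> null_nets \<Omega> \<Longrightarrow> 0 < e \<Longrightarrow> e \<le> 1 \<Longrightarrow> u e \<in> smooth_fns \<Omega>"
  by (auto simp: moderate_nets_def null_nets_def)

lemma moderate_order:
  assumes "u \<in> moderate_nets \<Omega>" "compact K" "K \<subseteq> \<Omega>" "set bs \<subseteq> Basis"
  obtains k where "order_on K (\<lambda>e. pd bs (u e)) k"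
  using assms moderate_nets_iff[OF op] by blast

lemma null_order:
  "u \<in> null_nets \<Omega> \<Longrightarrow> compact K \<Longrightarrow> K \<subseteq> \<Omega> \<Longrightarrow> set bs \<subseteq> Basis \<Longrightarrow> order_on K (\<lambda>e. pd bs (u e)) k"
  using null_nets_iff[OF op] by blast

lemma moderate_netsI:
  assumes "\<And>e. 0 < e \<Longrightarrow> e \<le> 1 \<Longrightarrow> u e \<in> smooth_fns \<Omega>"
    and "\<And>K bs. compact K \<Longrightarrow> K \<subseteq> \<Omega> \<Longrightarrow> set bs \<subseteq> Basis \<Longrightarrow> \<exists>k. order_on K (\<lambda>e. pd bs (u e)) k"
  shows "u \<in> moderate_nets \<Omega>"
  using assms moderate_nets_iff[OF op] by auto

lemma null_netsI:
  assumes "\<And>e. 0 < e \<Longrightarrow> e \<le> 1 \<Longrightarrow> u e \<in> smooth_fns \<Omega>"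
    and "\<And>K bs k. compact K \<Longrightarrow> K \<subseteq> \<Omega> \<Longrightarrow> set bs \<subseteq> Basis \<Longrightarrow> order_on K (\<lambda>e. pd bs (u e)) k"
  shows "u \<in> null_nets \<Omega>"
  using assms null_nets_iff[OF op] by auto

lemma null_imp_moderate: "u \<in> null_nets \<Omega> \<Longrightarrow> u \<in> moderate_nets \<Omega>"
  by (blast intro: moderate_netsI null_smooth null_order)

lemma null_cong:
  assumes u: "u \<in> null_nets \<Omega>" and eq: "\<And>e x. 0 < e \<Longrightarrow> e \<le> 1 \<Longrightarrow> x \<in> \<Omega> \<Longrightarrow> v e x = u e x"
  shows "v \<in> null_nets \<Omega>"
proof (rule null_netsI)
  show "v e \<in> smooth_fns \<Omega>" if "0 < e" "e \<le> 1" for e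
    by (rule smooth_cong[OF null_smooth[OF u that] op]) (simp add: eq that)
  fix K and bs :: "'a list" and k
  assume K: "compact K" "K \<subseteq> \<Omega>" "set bs \<subseteq> Basis"
  show "order_on K (\<lambda>e. pd bs (v e)) k"
    by (rule order_on_cong[OF null_order[OF u K]], rule pd_cong[OF op]) (use eq K in auto)
qed

lemma moderate_add:
  assumes u: "u \<in> moderate_nets \<Omega>" and v: "v \<in> moderate_nets \<Omega>"
  shows "(\<lambda>e x. u e x + v e x) \<in> moderate_nets \<Omega>"
proof (rule moderate_netsI)
  show "(\<lambda>x. u e x + v e x) \<in> smooth_fns \<Omega>" if "0 < e" "e \<le> 1" for e
    by (intro smooth_add op moderate_smooth u v that)
  fix K and bs :: "'a list"
  assume K: "compact K" "K \<subseteq> \<Omega>" "set bs \<subseteq> Basis"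
  obtain k where k: "order_on K (\<lambda>e. pd bs (u e)) k" by (rule moderate_order[OF u K])
  obtain j where j: "order_on K (\<lambda>e. pd bs (v e)) j" by (rule moderate_order[OF v K])
  have "order_on K (\<lambda>e. pd bs (\<lambda>x. u e x + v e x)) (min k j)"
    by (rule order_on_cong[OF order_on_add[OF order_on_mono[OF k] order_on_mono[OF j]]], 
        simp, simp, rule pd_add[OF op moderate_smooth[OF u] moderate_smooth[OF v]])
      (use K in auto)
  then show "\<exists>k. order_on K (\<lambda>e. pd bs (\<lambda>x. u e x + v e x)) k" ..
qed

lemma null_add:
  assumes u: "u \<in> null_nets \<Omega>" and v: "v \<in> null_nets \<Omega>"
  shows "(\<lambda>e x. u e x + v e x) \<in> null_nets \<Omega>"
proof (rule null_netsI)
  show "(\<lambda>x. u e x + v e x) \<in> smooth_fns \<Omega>" if "0 < e" "e \<le> 1" for e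
    by (intro smooth_add op null_smooth u v that)
  fix K and bs :: "'a list" and k
  assume K: "compact K" "K \<subseteq> \<Omega>" "set bs \<subseteq> Basis"
  show "order_on K (\<lambda>e. pd bs (\<lambda>x. u e x + v e x)) k"
    by (rule order_on_cong[OF order_on_add[OF null_order[OF u K] null_order[OF v K]]],
        rule pd_add[OF op null_smooth[OF u] null_smooth[OF v]]) (use K in auto)
qed

lemma null_minus:
  assumes u: "u \<in> null_nets \<Omega>"
  shows "(\<lambda>e x. - u e x) \<in> null_nets \<Omega>"
proof (rule null_netsI)
  show "(\<lambda>x. - u e x) \<in> smooth_fns \<Omega>" if "0 < e" "e \<le> 1" for e
    by (intro smooth_minus op null_smooth u that)
  fix K and bs :: "'a list" and k
  assume K: "compact K" "K \<subseteq> \<Omega>" "set bs \<subseteq> Basis"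
  show "order_on K (\<lambda>e. pd bs (\<lambda>x. - u e x)) k"
  proof (rule order_on_dominated[OF null_order[OF u K]])
    show "\<forall>\<^sub>F e in at_right 0. \<forall>x\<in>K. norm (pd bs (\<lambda>x. - u e x) x) \<le> norm (pd bs (u e) x)"
      using eventually_at_right_01
    proof eventually_elim
      case (elim e)
      then have "pd bs (\<lambda>x. - u e x) x = - pd bs (u e) x" if "x \<in> K" for x
        using that K by (intro pd_minus[OF op null_smooth[OF u]]) auto
      then show ?case by simp
    qed
  qed
qed

lemma equiv_net_rel: "equiv (moderate_nets \<Omega>) (net_rel \<Omega>)"
proof (rule equivI)
  show "net_rel \<Omega> \<subseteq> moderate_nets \<Omega> \<times> moderate_nets \<Omega>" by (auto simp: net_rel_def)
  have "(\<lambda>e x. 0) \<in> null_nets \<Omega>"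
    by (rule null_netsI) (auto simp: smooth_const pd_zero intro!: order_onI[where C = 0])
  then show "refl_on (moderate_nets \<Omega>) (net_rel \<Omega>)" by (auto simp: refl_on_def net_rel_def)
  show "sym (net_rel \<Omega>)"
    unfolding sym_def net_rel_def by (auto dest: null_minus)
  show "trans (net_rel \<Omega>)"
    unfolding trans_def net_rel_def
  proof clarsimp
    fix u v w :: "'a net"
    assume "(\<lambda>e x. u e x - v e x) \<in> null_nets \<Omega>" "(\<lambda>e x. v e x - w e x) \<in> null_nets \<Omega>"
    from null_add[OF this] show "(\<lambda>e x. u e x - w e x) \<in> null_nets \<Omega>" by simp
  qed
qed

lemma moderate_const:
  assumes f: "f \<in> smooth_fns \<Omega>"
  shows "(\<lambda>e. f) \<in> moderate_nets \<Omega>"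
proof (rule moderate_netsI[OF f])
  fix K and bs :: "'a list"
  assume "compact K" "K \<subseteq> \<Omega>" "set bs \<subseteq> Basis"
  then have "order_on K (\<lambda>e::real. pd bs f) 0"
    by (intro order_on_const continuous_on_subset[OF smooth_continuous[OF smooth_pd[OF f]]])
  then show "\<exists>k. order_on K (\<lambda>e::real. pd bs f) k" ..
qed

text \<open>Moderateness of \<open>g\<close> comes for free: \<open>g\<close> is a null net plus a
  constant net.\<close>

lemma Cl_eq_const:
  assumes f: "f \<in> smooth_fns \<Omega>" and g: "(\<lambda>e x. g e x - f x) \<in> null_nets \<Omega>"
  shows "Cl \<Omega> g = sigma_emb \<Omega> f"
proof -
  have "g \<in> moderate_nets \<Omega>"
    using moderate_add[OF null_imp_moderate[OF g] moderate_const[OF f]] by simp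
  then have "(g, \<lambda>e. f) \<in> net_rel \<Omega>"
    using g moderate_const[OF f] by (simp add: net_rel_def)
  then show ?thesis
    unfolding Cl_def sigma_emb_def by (rule equiv_class_eq[OF equiv_net_rel])
qed

lemma moderate_partial:
  assumes u: "u \<in> moderate_nets \<Omega>" and b: "b \<in> Basis"
  shows "(\<lambda>e. partial b (u e)) \<in> moderate_nets \<Omega>"
proof (rule moderate_netsI)
  show "partial b (u e) \<in> smooth_fns \<Omega>" if "0 < e" "e \<le> 1" for e
    by (rule smooth_partial[OF moderate_smooth[OF u that] b])
  fix K and bs :: "'a list"
  assume K: "compact K" "K \<subseteq> \<Omega>" "set bs \<subseteq> Basis"
  obtain k where "order_on K (\<lambda>e. pd (bs @ [b]) (u e)) k"
    by (rule moderate_order[OF u K(1,2), of "bs @ [b]"]) (use K b in auto)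
  then show "\<exists>k. order_on K (\<lambda>e. pd bs (partial b (u e))) k" by (auto simp: pd_append pd_Cons)
qed

text \<open>The innermost derivative is split off by the Leibniz rule. This leaves two products of
  moderate nets with one derivative fewer, so the induction runs from the end of the list and over
  all factors.\<close>

lemma moderate_mult:
  assumes "u \<in> moderate_nets \<Omega>" "v \<in> moderate_nets \<Omega>"
  shows "(\<lambda>e x. u e x * v e x) \<in> moderate_nets \<Omega>"
proof (rule moderate_netsI)
  show "(\<lambda>x. u e x * v e x) \<in> smooth_fns \<Omega>" if "0 < e" "e \<le> 1" for e
    by (intro smooth_mult op moderate_smooth assms that)
  fix K and bs :: "'a list"
  assume K: "compact K" "K \<subseteq> \<Omega>" and "set bs \<subseteq> Basis"
  then show "\<exists>k. order_on K (\<lambda>e. pd bs (\<lambda>x. u e x * v e x)) k"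
    using assms
  proof (induction bs arbitrary: u v rule: rev_induct)
    case Nil
    obtain k where k: "order_on K (\<lambda>e. pd [] (u e)) k" by (rule moderate_order[OF Nil(4) K, of "[]"]) simp
    obtain j where j: "order_on K (\<lambda>e. pd [] (v e)) j" by (rule moderate_order[OF Nil(5) K, of "[]"]) simp
    show ?case using order_on_mult[OF k j] by auto
  next
    case (snoc b bs)
    have b: "b \<in> Basis" "set bs \<subseteq> Basis" using snoc.prems by auto
    note u = snoc.prems(4) and v = snoc.prems(5)
    note u' = moderate_partial[OF u b(1)] and v' = moderate_partial[OF v b(1)]
    obtain k where k: "order_on K (\<lambda>e. pd bs (\<lambda>x. u e x * partial b (v e) x)) k"
      using snoc.IH[OF K b(2) u v'] by blast
    obtain j where j: "order_on K (\<lambda>e. pd bs (\<lambda>x. partial b (u e) x * v e x)) j"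
      using snoc.IH[OF K b(2) u' v] by blast
    have "order_on K (\<lambda>e. pd (bs @ [b]) (\<lambda>x. u e x * v e x)) (min k j)"
    proof (rule order_on_cong[OF order_on_add[OF order_on_mono[OF k] order_on_mono[OF j]]])
      fix e :: real and x assume e: "0 < e" "e < 1" and "x \<in> K"
      then have x: "x \<in> \<Omega>" and e': "e \<le> 1" using K by auto
      note s = moderate_smooth[OF u e(1) e'] moderate_smooth[OF v e(1) e']
        moderate_smooth[OF u' e(1) e'] moderate_smooth[OF v' e(1) e']
      have "pd (bs @ [b]) (\<lambda>x. u e x * v e x) x = pd bs (partial b (\<lambda>x. u e x * v e x)) x"
        by (simp add: pd_append pd_Cons)
      also have "\<dots> = pd bs (\<lambda>x. u e x * partial b (v e) x + partial b (u e) x * v e x) x"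
        by (rule pd_cong[OF op _ x]) (intro partial_mult smooth_differentiable[OF s(1)] smooth_differentiable[OF s(2)])
      also have "\<dots> = pd bs (\<lambda>x. u e x * partial b (v e) x) x + pd bs (\<lambda>x. partial b (u e) x * v e x) x"
        by (intro pd_add[OF op _ _ b(2) x] smooth_mult op s)
      finally show "pd (bs @ [b]) (\<lambda>x. u e x * v e x) x = \<dots>" .
    qed simp_all
    then show ?case ..
  qed
qed

end

text \<open>Serves the replacement of the kernel and that of the argument: one net is null, the
  other moderate, and the orders add. The \<open>x\<close>-derivatives pass to the kernel because
  integration against \<open>v e\<close> over \<open>K\<close> is a distribution.\<close>

lemma null_integral_op:
  fixes X :: "'a::euclidean_space set" and Y :: "'b::euclidean_space set"
  assumes XY: "open X" "open Y" and K: "compact K" "K \<subseteq> Y"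
    and u: "u \<in> moderate_nets (X \<times> Y)" and v: "v \<in> moderate_nets Y"
    and null: "u \<in> null_nets (X \<times> Y) \<or> v \<in> null_nets Y"
  shows "(\<lambda>e x. LINT y:K|lborel. u e (x, y) * v e y) \<in> null_nets X"
proof -
  define T where "T = (\<lambda>e \<phi>. LINT y:K|lborel. \<phi> y * v e y)"
  have eq: "(\<lambda>e x. LINT y:K|lborel. u e (x, y) * v e y) = (\<lambda>e. classical_op (u e) (T e))"
    by (simp add: T_def classical_op_def fun_eq_iff)
  note opXY = open_Times[OF XY]
  have contv: "continuous_on K (v e)" if "0 < e" "e \<le> 1" for e
    by (rule continuous_on_subset[OF smooth_continuous[OF moderate_smooth[OF XY(2) v that]] K(2)])
  have T: "T e \<in> compact_distributions Y" if "0 < e" "e \<le> 1" for e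
    unfolding T_def by (rule set_integral_distribution[OF K XY(2) contv[OF that]])
  show ?thesis
    unfolding eq
  proof (rule null_netsI[OF XY(1)])
    show "classical_op (u e) (T e) \<in> smooth_fns X" if "0 < e" "e \<le> 1" for e
      by (rule smooth_classical_op[OF XY T[OF that] moderate_smooth[OF opXY u that]])
    fix A and bs :: "'a list" and n
    assume A: "compact A" "A \<subseteq> X" "set bs \<subseteq> Basis"
    let ?bs = "map (\<lambda>b. (b, 0)) bs :: ('a \<times> 'b) list"
    have AK: "compact (A \<times> K)" "A \<times> K \<subseteq> X \<times> Y" "set ?bs \<subseteq> Basis"
      using A K Pair_Basis by (auto intro: compact_Times)
    \<comment> \<open>The null net is free to have any order, so it makes up for whatever order the
      moderate one has.\<close>
    obtain k j where k: "order_on (A \<times> K) (\<lambda>e. pd ?bs (u e)) k" and j: "order_on K (\<lambda>e. pd [] (v e)) j"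
      and kj: "k + j = n"
    proof (cases "u \<in> null_nets (X \<times> Y)")
      case True
      obtain j where "order_on K (\<lambda>e. pd [] (v e)) j" by (rule moderate_order[OF XY(2) v K, of "[]"]) simp
      then show ?thesis using null_order[OF opXY True AK, of "n - j"] that by simp
    next
      case False
      obtain k where "order_on (A \<times> K) (\<lambda>e. pd ?bs (u e)) k" by (rule moderate_order[OF opXY u AK])
      moreover have "order_on K (\<lambda>e. pd [] (v e)) (n - k)"
        by (rule null_order[OF XY(2) _ K]) (use False null in auto)
      ultimately show ?thesis using that by simp
    qed
    obtain C D where CD: "0 \<le> C" "\<forall>\<^sub>F e in at_right 0. \<forall>p\<in>A \<times> K. norm (pd ?bs (u e) p) \<le> C * e powi k"
      "0 \<le> D" "\<forall>\<^sub>F e in at_right 0. \<forall>y\<in>K. norm (v e y) \<le> D * e powi j"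
      using k j by (auto simp: order_on_def)
    from CD(2,4) eventually_at_right_01
    have "\<forall>\<^sub>F e in at_right 0. \<forall>x\<in>A. norm (pd bs (classical_op (u e) (T e)) x)
        \<le> (measure lborel K * D * C) * e powi n"
    proof eventually_elim
      case (elim e)
      then have e: "0 < e" "e \<le> 1" by auto
      note su = moderate_smooth[OF opXY u e]
      show ?case
      proof
        fix x assume "x \<in> A"
        then have x: "x \<in> X" using A by auto
        have "pd bs (classical_op (u e) (T e)) x = (LINT y:K|lborel. pd ?bs (u e) (x, y) * v e y)"
          using pd_classical_op[OF XY T[OF e] su x A(3)] by (simp add: classical_op_def T_def)
        also have "norm \<dots> \<le> measure lborel K * (D * e powi j) * (C * e powi k)"
          using elim \<open>x \<in> A\<close> CD(1,3) K(2) smooth_slice(1)[OF XY smooth_pd[OF su AK(3)] x]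
          by (intro norm_set_integral_mult_le K contv[OF e])
            (auto intro: continuous_on_subset[OF smooth_continuous])
        also have "\<dots> = (measure lborel K * D * C) * e powi n"
          using e kj by (simp add: power_int_add flip: kj)
        finally show "norm (pd bs (classical_op (u e) (T e)) x) \<le> (measure lborel K * D * C) * e powi n" .
      qed
    qed
    then show "order_on A (\<lambda>e. pd bs (classical_op (u e) (T e))) n" by (rule order_onI)
  qed
qed

section \<open>Moments of the mollifier\<close>

lemma nn_integral_inverse_1_plus_square: "(\<integral>\<^sup>+x. ennreal (inverse (1 + x\<^sup>2)) \<partial>lborel) < \<infinity>"
proof -
  have "integrable lborel (\<lambda>x::real. inverse (1 + x\<^sup>2))"
    using integrable_inverse_1_plus_square by (simp add: set_integrable_def)
  then show ?thesis by (simp add: integrable_iff_bounded)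
qed

text \<open>The integrable majorant for Schwartz functions. As a product of functions of single
  coordinates it is reduced to the one-dimensional integral of
  \<open>inverse (1 + x\<^sup>2)\<close>.\<close>

lemma integrable_prod_inverse:
  "integrable lborel (\<lambda>x::'a::euclidean_space. \<Prod>b\<in>Basis. inverse (1 + (x \<bullet> b)\<^sup>2))"
proof (rule integrableI_nonneg)
  show "AE x::'a in lborel. 0 \<le> (\<Prod>b\<in>Basis. inverse (1 + (x \<bullet> b)\<^sup>2))"
    by (intro always_eventually allI prod_nonneg) simp
  have "(\<integral>\<^sup>+x. ennreal (\<Prod>b\<in>Basis. inverse (1 + (x \<bullet> b)\<^sup>2)) \<partial>(lborel :: 'a measure))
      = (\<integral>\<^sup>+x. (\<Prod>b\<in>Basis. ennreal (inverse (1 + (x \<bullet> b)\<^sup>2))) \<partial>(lborel :: 'a measure))"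
    by (intro nn_integral_cong) (simp add: prod_ennreal)
  also have "\<dots> = (\<Prod>b\<in>(Basis :: 'a set). \<integral>\<^sup>+x. ennreal (inverse (1 + x\<^sup>2)) \<partial>lborel)"
    by (rule nn_integral_lborel_prod) auto
  also have "\<dots> < \<infinity>"
    using nn_integral_inverse_1_plus_square by (auto simp: top.not_eq_extremum[symmetric] power_eq_top_ennreal)
  finally show "(\<integral>\<^sup>+x. ennreal (\<Prod>b\<in>Basis. inverse (1 + (x \<bullet> b)\<^sup>2)) \<partial>(lborel :: 'a measure)) < \<infinity>" .
qed simp

text \<open>The weight \<open>q\<close> is compensated by \<open>\<rho>\<close> even after
  multiplication by any monomial. Quantifying over all monomials makes such weights stable under
  coordinate factors, and they are also stable under sums; for Schwartz \<open>\<rho>\<close>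
  polynomial weights can be built up this way.\<close>

definition damped :: "('a::euclidean_space \<Rightarrow> complex) \<Rightarrow> ('a \<Rightarrow> real) \<Rightarrow> bool" where
  "damped \<rho> q \<longleftrightarrow> (\<forall>\<alpha>. \<exists>B. \<forall>x. \<bar>q x * mi_monom \<alpha> x\<bar> * norm (\<rho> x) \<le> B)"

lemma damped_one: "\<rho> \<in> schwartz_fns \<Longrightarrow> damped \<rho> (\<lambda>x. 1)"
  unfolding damped_def
proof
  fix \<alpha> :: "'a \<Rightarrow> nat" assume "\<rho> \<in> schwartz_fns"
  moreover have "mi_deriv (\<lambda>b. 0) \<rho> = \<rho>"
  proof -
    have "mi_list (\<lambda>b::'a. 0) = []" using length_mi_list[of "\<lambda>b::'a. 0"] by (simp add: mi_size_def)
    then show ?thesis by (simp add: mi_deriv_eq_pd)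
  qed
  moreover have "bounded (range (\<lambda>x. mi_monom \<alpha> x *\<^sub>R mi_deriv (\<lambda>b. 0) \<rho> x))"
    using \<open>\<rho> \<in> schwartz_fns\<close> unfolding schwartz_fns_def by blast
  ultimately have "bounded (range (\<lambda>x. mi_monom \<alpha> x *\<^sub>R \<rho> x))" by simp
  then show "\<exists>B. \<forall>x. \<bar>1 * mi_monom \<alpha> x\<bar> * norm (\<rho> x) \<le> B"
    by (auto simp: bounded_iff)
qed

lemma damped_add:
  assumes "damped \<rho> q" "damped \<rho> r"
  shows "damped \<rho> (\<lambda>x. q x + r x)"
  unfolding damped_def
proof
  fix \<alpha>
  obtain B C where B: "\<And>x. \<bar>q x * mi_monom \<alpha> x\<bar> * norm (\<rho> x) \<le> B"
    and C: "\<And>x. \<bar>r x * mi_monom \<alpha> x\<bar> * norm (\<rho> x) \<le> C"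
    using assms unfolding damped_def by blast
  have "\<bar>(q x + r x) * mi_monom \<alpha> x\<bar> * norm (\<rho> x) \<le> B + C" for x
  proof -
    have "\<bar>(q x + r x) * mi_monom \<alpha> x\<bar> * norm (\<rho> x)
        \<le> (\<bar>q x * mi_monom \<alpha> x\<bar> + \<bar>r x * mi_monom \<alpha> x\<bar>) * norm (\<rho> x)"
      by (rule mult_right_mono) (simp_all add: distrib_right abs_triangle_ineq)
    also have "\<dots> \<le> B + C" using B[of x] C[of x] by (simp add: distrib_right)
    finally show ?thesis .
  qed
  then show "\<exists>B. \<forall>x. \<bar>(q x + r x) * mi_monom \<alpha> x\<bar> * norm (\<rho> x) \<le> B" by blast
qed

lemma mi_monom_upd:
  assumes "b \<in> Basis"
  shows "mi_monom (\<alpha>(b := Suc (\<alpha> b))) x = (x \<bullet> b) * mi_monom \<alpha> x"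
proof -
  have "(\<Prod>c\<in>Basis - {b}. (x \<bullet> c) ^ (\<alpha>(b := Suc (\<alpha> b))) c) = (\<Prod>c\<in>Basis - {b}. (x \<bullet> c) ^ \<alpha> c)"
    by (rule prod.cong) auto
  then show ?thesis
    unfolding mi_monom_def using assms by (simp add: prod.remove[of Basis b])
qed

lemma damped_coord:
  assumes "damped \<rho> q" "b \<in> Basis"
  shows "damped \<rho> (\<lambda>x. q x * (x \<bullet> b))"
  unfolding damped_def
proof
  fix \<alpha> :: "'a \<Rightarrow> nat"
  obtain B where "\<And>x. \<bar>q x * mi_monom (\<alpha>(b := Suc (\<alpha> b))) x\<bar> * norm (\<rho> x) \<le> B"
    using assms(1) unfolding damped_def by blast
  then show "\<exists>B. \<forall>x. \<bar>q x * (x \<bullet> b) * mi_monom \<alpha> x\<bar> * norm (\<rho> x) \<le> B"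
    unfolding mi_monom_upd[OF assms(2)] mult.assoc by blast
qed

lemma damped_sum:
  assumes "finite I" "I \<noteq> {}" "\<And>i. i \<in> I \<Longrightarrow> damped \<rho> (q i)"
  shows "damped \<rho> (\<lambda>x. \<Sum>i\<in>I. q i x)"
  using assms by (induction I rule: finite_ne_induct) (auto intro: damped_add)

text \<open>Even powers of the norm are polynomials in the coordinates. The product is the
  reciprocal of the majorant in \<open>integrable_prod_inverse\<close>, so boundedness against this
  weight yields integrable domination.\<close>

lemma damped_weight:
  fixes \<rho> :: "'a::euclidean_space \<Rightarrow> complex"
  assumes "\<rho> \<in> schwartz_fns"
  shows "damped \<rho> (\<lambda>x. norm x ^ (2 * k) * (\<Prod>b\<in>Basis. 1 + (x \<bullet> b)\<^sup>2))"
proof -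
  have sq: "damped \<rho> (\<lambda>x. q x * (x \<bullet> b)\<^sup>2)" if "damped \<rho> q" "b \<in> Basis" for q b
    using damped_coord[OF damped_coord[OF that] that(2)] by (simp add: power2_eq_square mult.assoc)
  have norm2: "norm x ^ 2 = (\<Sum>b\<in>Basis. (x \<bullet> b)\<^sup>2)" for x :: 'a
    unfolding power2_norm_eq_inner by (subst euclidean_inner) (simp add: power2_eq_square)
  have n: "damped \<rho> (\<lambda>x. norm x ^ (2 * k))"
  proof (induction k)
    case (Suc k)
    have "damped \<rho> (\<lambda>x. \<Sum>b\<in>Basis. norm x ^ (2 * k) * (x \<bullet> b)\<^sup>2)"
      by (intro damped_sum sq Suc) auto
    also have "(\<lambda>x::'a. \<Sum>b\<in>Basis. norm x ^ (2 * k) * (x \<bullet> b)\<^sup>2) = (\<lambda>x. norm x ^ (2 * Suc k))"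
      by (simp add: sum_distrib_left[symmetric] norm2[symmetric] fun_eq_iff power_add[symmetric])
    finally show ?case .
  qed (simp add: damped_one assms)
  have "damped \<rho> (\<lambda>x. norm x ^ (2 * k) * (\<Prod>b\<in>I. 1 + (x \<bullet> b)\<^sup>2))" if "finite I" "I \<subseteq> Basis" for I
    using that
  proof (induction I rule: finite_induct)
    case (insert b I)
    then have "damped \<rho> (\<lambda>x. norm x ^ (2 * k) * (\<Prod>b\<in>I. 1 + (x \<bullet> b)\<^sup>2))" "b \<in> Basis" by auto
    from damped_add[OF this(1) sq[OF this]] show ?case
      using insert by (simp add: algebra_simps)
  qed (use n in simp)
  then show ?thesis by simp
qed

lemma schwartz_continuous: "\<rho> \<in> schwartz_fns \<Longrightarrow> continuous_on UNIV \<rho>"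
  by (auto simp: schwartz_fns_def intro: smooth_continuous)

lemma schwartz_moment_integrable:
  fixes \<rho> :: "'a::euclidean_space \<Rightarrow> complex"
  assumes "\<rho> \<in> schwartz_fns"
  shows "integrable lborel (\<lambda>x. norm x ^ k * norm (\<rho> x))"
proof -
  have [measurable]: "\<rho> \<in> borel_measurable borel"
    by (rule borel_measurable_continuous_onI[OF schwartz_continuous[OF assms]])
  have even: "integrable lborel (\<lambda>x. norm x ^ (2 * k) * norm (\<rho> x))" for k
  proof -
    have one: "mi_monom (\<lambda>b. 0) x = 1" for x :: 'a by (simp add: mi_monom_def)
    obtain B where B: "\<And>x. \<bar>norm x ^ (2 * k) * (\<Prod>b\<in>Basis. 1 + (x \<bullet> b)\<^sup>2) * mi_monom (\<lambda>b. 0) x\<bar> * norm (\<rho> x) \<le> B"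
      using damped_weight[OF assms, of k] unfolding damped_def by blast
    have W: "(\<Prod>b\<in>Basis. 1 + (x \<bullet> b)\<^sup>2) > 0" for x :: 'a
      by (intro prod_pos) (auto intro: add_pos_nonneg)
    have "norm x ^ (2 * k) * norm (\<rho> x) \<le> B * (\<Prod>b\<in>Basis. inverse (1 + (x \<bullet> b)\<^sup>2))" for x
    proof -
      have "norm x ^ (2 * k) * (\<Prod>b\<in>Basis. 1 + (x \<bullet> b)\<^sup>2) * norm (\<rho> x) \<le> B"
        using B[of x] W[of x] by (simp add: one abs_mult)
      then have "norm x ^ (2 * k) * norm (\<rho> x) \<le> B / (\<Prod>b\<in>Basis. 1 + (x \<bullet> b)\<^sup>2)"
        using W[of x] by (simp add: pos_le_divide_eq mult_ac)
      then show ?thesis by (simp add: prod_inversef[symmetric] divide_inverse)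
    qed
    then have "norm (norm x ^ (2 * k) * norm (\<rho> x)) \<le> norm (B * (\<Prod>b\<in>Basis. inverse (1 + (x \<bullet> b)\<^sup>2)))" for x
      unfolding real_norm_def by (subst abs_of_nonneg) (auto intro: order_trans[OF _ abs_ge_self])
    then show ?thesis
      by (intro Bochner_Integration.integrable_bound[OF integrable_mult_right[OF integrable_prod_inverse, of B]]) auto
  qed
  \<comment> \<open>Odd powers of the norm are not polynomials and are dominated by even
    ones.\<close>
  have "norm x ^ k \<le> 1 + norm x ^ (2 * k)" for x :: 'a
  proof (cases "norm x \<le> 1")
    case True
    then have "norm x ^ k \<le> 1" by (simp add: power_le_one)
    then show ?thesis by (simp add: add_increasing2)
  next
    case False
    then have "norm x ^ k \<le> norm x ^ (2 * k)" by (intro power_increasing) auto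
    then show ?thesis by simp
  qed
  then have "norm x ^ k * norm (\<rho> x) \<le> norm x ^ (2 * 0) * norm (\<rho> x) + norm x ^ (2 * k) * norm (\<rho> x)" for x
    by (metis distrib_right mult.left_neutral mult_0_right mult_right_mono norm_ge_zero power_0)
  then show ?thesis
    by (intro Bochner_Integration.integrable_bound[OF Bochner_Integration.integrable_add[OF even[of 0] even[of k]]]) auto
qed

lemma
  fixes f :: "'a::euclidean_space \<Rightarrow> 'b::{banach, second_countable_topology}"
  assumes "0 < c" and [measurable]: "f \<in> borel_measurable borel"
  shows integrable_lborel_scaleR: "integrable lborel f \<Longrightarrow> integrable lborel (\<lambda>x. f (x /\<^sub>R c))"
    and integral_lborel_scaleR: "(LINT x|lborel. f (x /\<^sub>R c)) = c ^ DIM('a) *\<^sub>R (LINT x|lborel. f x)"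
proof -
  have eq: "(lborel :: 'a measure) = density (distr lborel borel (\<lambda>x. c *\<^sub>R x)) (\<lambda>_. ennreal (c ^ DIM('a)))"
    using lborel_affine[of c "0 :: 'a"] assms(1) by (simp add: ennreal_power)
  show "integrable lborel (\<lambda>x. f (x /\<^sub>R c))" if "integrable lborel f"
    using that assms(1) by (subst eq) (simp add: integrable_density integrable_distr_eq)
  show "(LINT x|lborel. f (x /\<^sub>R c)) = c ^ DIM('a) *\<^sub>R (LINT x|lborel. f x)"
    using assms(1) by (subst eq) (simp add: integral_density integral_distr)
qed

text \<open>The inequality \<open>ln t \<le> t\<close> at \<open>t = 1 / sqrt e\<close>. One factor
  \<open>e\<close> thus absorbs two factors \<open>ln e\<close> up to the constant
  \<open>4\<close>.\<close>

lemma ln_square_bound: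
  assumes "0 < e" "e < (1::real)"
  shows "ln e ^ 2 * e \<le> 4"
proof -
  have s: "0 < sqrt e" "sqrt e < 1" using assms by auto
  have "ln (1 / sqrt e) \<le> 1 / sqrt e" using s by (intro less_imp_le ln_less_self) auto
  moreover have "ln (1 / sqrt e) = - ln e / 2" using assms by (simp add: ln_div ln_sqrt)
  ultimately have 1: "- ln e \<le> 2 / sqrt e" by simp
  have "0 \<le> - ln e" using assms by simp
  then have "(- ln e) ^ 2 \<le> (2 / sqrt e) ^ 2" using 1 by (intro power_mono)
  then have "ln e ^ 2 \<le> 4 / e" using assms by (simp add: power_divide)
  then show ?thesis using assms by (simp add: pos_le_divide_eq)
qed

section \<open>Taylor expansion indexed by lists of basis vectors\<close>

definition list_monom :: "'a::euclidean_space list \<Rightarrow> 'a \<Rightarrow> real" where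
  "list_monom bs x = prod_list (map (\<lambda>b. x \<bullet> b) bs)"

lemma list_monom_Cons: "list_monom (b # bs) x = (x \<bullet> b) * list_monom bs x"
  by (simp add: list_monom_def)

lemma list_monom_eq: "set bs \<subseteq> Basis \<Longrightarrow> list_monom bs x = mi_monom (count_list bs) x"
proof (induction bs)
  case (Cons b bs)
  have "count_list (b # bs) = (count_list bs)(b := Suc (count_list bs b))" by (simp add: fun_eq_iff)
  then have "mi_monom (count_list (b # bs)) x = (x \<bullet> b) * mi_monom (count_list bs) x"
    using Cons.prems mi_monom_upd[of b "count_list bs" x] by (simp only: list.set insert_subset)
  moreover have "list_monom bs x = mi_monom (count_list bs) x" using Cons by simp
  ultimately show ?case by (simp only: list_monom_Cons)
qed (simp add: list_monom_def mi_monom_def)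

lemma abs_list_monom_le: "set bs \<subseteq> Basis \<Longrightarrow> \<bar>list_monom bs x\<bar> \<le> norm x ^ length bs"
  by (induction bs) (auto simp: list_monom_def abs_mult intro!: mult_mono Basis_le_norm)

lemma list_monom_scaleR: "list_monom bs (c *\<^sub>R x) = c ^ length bs * list_monom bs x"
  by (induction bs) (auto simp: list_monom_def)

lemma continuous_on_list_monom: "continuous_on S (list_monom bs)"
  by (induction bs) (auto simp: list_monom_def fun_eq_iff intro!: continuous_intros)

text \<open>Summing over lists counts each multi-index with its multinomial multiplicity; the Taylor
  coefficients are therefore \<open>1 / fact k\<close> for every list of length \<open>k\<close>,
  without factorials of multi-indices.\<close>

definition basis_lists :: "nat \<Rightarrow> 'a::euclidean_space list set" where
  "basis_lists k = {bs. set bs \<subseteq> Basis \<and> length bs = k}"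

lemma sum_basis_lists_Suc:
  fixes g :: "'a::euclidean_space list \<Rightarrow> 'c::comm_monoid_add"
  shows
  "(\<Sum>bs\<in>basis_lists (Suc k). g bs) = (\<Sum>bs\<in>basis_lists k. \<Sum>b\<in>Basis. g (b # bs))"
proof -
  have eq: "basis_lists (Suc k) = (\<lambda>(bs, b). b # bs :: 'a list) ` (basis_lists k \<times> Basis)"
  proof (intro equalityI subsetI)
    fix cs :: "'a list" assume "cs \<in> basis_lists (Suc k)"
    then show "cs \<in> (\<lambda>(bs, b). b # bs) ` (basis_lists k \<times> Basis)"
      by (cases cs) (auto simp: basis_lists_def image_iff)
  qed (auto simp: basis_lists_def)
  have "inj_on (\<lambda>(bs, b). b # bs :: 'a list) (basis_lists k \<times> Basis)" by (auto simp: inj_on_def)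
  then show ?thesis
    unfolding eq by (simp add: sum.reindex sum.cartesian_product case_prod_unfold)
qed

text \<open>The one-dimensional Taylor formula with integral remainder along the segment from
  \<open>z\<close> to \<open>z + y\<close>; \<open>D k\<close> is the \<open>k\<close>-th derivative
  in the segment parameter.\<close>

lemma smooth_Taylor:
  fixes f :: "'a::euclidean_space \<Rightarrow> complex" and B :: real
  assumes f: "f \<in> smooth_fns UNIV" and "0 < N"
    and B: "\<And>bs t. bs \<in> basis_lists N \<Longrightarrow> t \<in> {0..1} \<Longrightarrow> norm (pd bs f (z + t *\<^sub>R y)) \<le> B"
  shows "norm (f (z + y) - (\<Sum>k<N. \<Sum>bs\<in>basis_lists k. (list_monom bs y / fact k) *\<^sub>R pd bs f z))
    \<le> card (basis_lists N :: 'a list set) * B * norm y ^ N"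
proof -
  define D where "D = (\<lambda>k t. \<Sum>bs\<in>basis_lists k. list_monom bs y *\<^sub>R pd bs f (z + t *\<^sub>R y))"
  have D0: "D 0 = (\<lambda>t. f (z + t *\<^sub>R y))"
  proof -
    have "basis_lists 0 = {[] :: 'a list}" by (auto simp: basis_lists_def)
    then show ?thesis by (simp add: D_def list_monom_def)
  qed
  have step: "(D k has_vector_derivative D (Suc k) t) (at t within {0..1})" for k t
  proof -
    have "D (Suc k) t = (\<Sum>bs\<in>basis_lists k. list_monom bs y *\<^sub>R partial y (pd bs f) (z + t *\<^sub>R y))"
      unfolding D_def sum_basis_lists_Suc
    proof (rule sum.cong[OF refl])
      fix bs :: "'a list" assume "bs \<in> basis_lists k"
      then have "pd bs f differentiable (at (z + t *\<^sub>R y))"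
        by (intro smooth_differentiable[OF smooth_pd[OF f]]) (auto simp: basis_lists_def)
      then show "(\<Sum>b\<in>Basis. list_monom (b # bs) y *\<^sub>R pd (b # bs) f (z + t *\<^sub>R y))
          = list_monom bs y *\<^sub>R partial y (pd bs f) (z + t *\<^sub>R y)"
        by (subst partial_expand[where v = y])
          (auto simp: list_monom_Cons pd_Cons scaleR_sum_right mult.commute)
    qed
    moreover have "(D k has_vector_derivative
        (\<Sum>bs\<in>basis_lists k. list_monom bs y *\<^sub>R partial y (pd bs f) (z + t *\<^sub>R y))) (at t within {0..1})"
      unfolding D_def
    proof (rule has_vector_derivative_sum)
      fix bs :: "'a list" assume "bs \<in> basis_lists k"
      then have "pd bs f \<in> smooth_fns UNIV" by (intro smooth_pd[OF f]) (auto simp: basis_lists_def)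
      from bounded_linear.has_vector_derivative[OF bounded_linear_scaleR_right
          smooth_has_vector_derivative_line[OF this UNIV_I]]
      show "((\<lambda>t. list_monom bs y *\<^sub>R pd bs f (z + t *\<^sub>R y)) has_vector_derivative
          list_monom bs y *\<^sub>R partial y (pd bs f) (z + t *\<^sub>R y)) (at t within {0..1})" .
    qed
    ultimately show ?thesis by simp
  qed
  have "((\<lambda>t. ((1 - t) ^ (N - 1) / fact (N - 1)) *\<^sub>R D N t) has_integral
      D 0 1 - (\<Sum>k<N. ((1 - 0) ^ k / fact k) *\<^sub>R D k 0)) {0..1}"
    by (rule Taylor_has_integral[where Df = D and f = "D 0" and a = 0 and b = 1]) (use step \<open>0 < N\<close> in auto)
  moreover have "norm (((1 - t) ^ (N - 1) / fact (N - 1)) *\<^sub>R D N t)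
      \<le> card (basis_lists N :: 'a list set) * B * norm y ^ N" if t: "t \<in> {0..1}" for t
  proof -
    have "norm (D N t) \<le> (\<Sum>bs\<in>(basis_lists N :: 'a list set). norm y ^ N * B)"
      unfolding D_def
    proof (rule sum_norm_le)
      fix bs :: "'a list" assume bs: "bs \<in> basis_lists N"
      then have "\<bar>list_monom bs y\<bar> \<le> norm y ^ N"
        using abs_list_monom_le[of bs y] by (simp add: basis_lists_def)
      then show "norm (list_monom bs y *\<^sub>R pd bs f (z + t *\<^sub>R y)) \<le> norm y ^ N * B"
        unfolding norm_scaleR by (intro mult_mono B[OF bs t]) auto
    qed
    also have "\<dots> = card (basis_lists N :: 'a list set) * B * norm y ^ N" by simp
    finally have 1: "norm (D N t) \<le> card (basis_lists N :: 'a list set) * B * norm y ^ N" .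
    \<comment> \<open>The weight in the remainder is estimated crudely by \<open>1\<close>, since
      only the power of \<open>norm y\<close> matters later.\<close>
    have "(1 - t) ^ (N - 1) / fact (N - 1) \<le> 1 / 1"
      using t by (intro frac_le power_le_one fact_ge_1) auto
    then have "\<bar>(1 - t) ^ (N - 1) / fact (N - 1)\<bar> \<le> 1" using t by simp
    then have "\<bar>(1 - t) ^ (N - 1) / fact (N - 1)\<bar> * norm (D N t) \<le> 1 * norm (D N t)"
      by (rule mult_right_mono) simp
    then show ?thesis using 1 by simp
  qed
  \<comment> \<open>No sign of \<open>B\<close> is assumed: it follows from the bound as soon as
    there is a list, and otherwise the cardinality is \<open>0\<close>.\<close>
  moreover have "0 \<le> card (basis_lists N :: 'a list set) * B * norm y ^ N"
  proof (cases "basis_lists N = ({} :: 'a list set)")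
    case False
    then have "0 \<le> B" using order_trans[OF norm_ge_zero B[of _ 0]] by auto
    then show ?thesis by simp
  qed simp
  ultimately have "norm (D 0 1 - (\<Sum>k<N. ((1 - 0) ^ k / fact k) *\<^sub>R D k 0))
      \<le> (card (basis_lists N :: 'a list set) * B * norm y ^ N) * measure lborel (cbox 0 (1::real))"
    by (intro has_integral_bound) auto
  then show ?thesis
    by (simp add: D0) (simp add: D_def scaleR_sum_right)
qed

section \<open>Moments of the truncated mollifier and the rate of approximation\<close>

context
  fixes \<rho> :: "'a::euclidean_space \<Rightarrow> complex" and \<kappa> :: "'a \<Rightarrow> real"
  assumes \<rho>: "mollifier \<rho>" and \<kappa>: "cutoff \<kappa>"
begin

definition moment :: "nat \<Rightarrow> real" where
  "moment k = (LINT x|lborel. norm x ^ k * norm (\<rho> x))"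

text \<open>The first summand comes from the Taylor remainder of order \<open>N\<close>, the second
  from the moments disturbed by truncation; \<open>4 ^ N\<close> is the \<open>N\<close>-th power of
  the constant in \<open>ln_square_bound\<close>.\<close>

definition approx_const :: "nat \<Rightarrow> real" where
  "approx_const N = card (basis_lists N :: 'a list set) * moment N +
    (\<Sum>k<N. card (basis_lists k :: 'a list set) * (4 ^ N * moment (k + 2 * N)))"

lemma moment_nonneg: "0 \<le> moment k"
  unfolding moment_def by (intro integral_nonneg_AE) simp

lemma mollifier_schwartz: "\<rho> \<in> schwartz_fns" using \<rho> by (simp add: mollifier_def)

lemma measurable_mollifier [measurable]: "\<rho> \<in> borel_measurable borel"
  by (rule borel_measurable_continuous_onI[OF schwartz_continuous[OF mollifier_schwartz]])

lemma cutoff_continuous: "continuous_on UNIV \<kappa>"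
  using \<kappa> by (auto simp: cutoff_def test_fns_def intro: smooth_continuous)

lemma measurable_cutoff [measurable]: "\<kappa> \<in> borel_measurable borel"
  by (rule borel_measurable_continuous_onI[OF cutoff_continuous])

lemma measurable_list_monom [measurable]: "list_monom bs \<in> borel_measurable borel"
  by (rule borel_measurable_continuous_onI[OF continuous_on_list_monom])

lemma measurable_rho_eps [measurable]: "rho_eps \<rho> e \<in> borel_measurable borel"
  unfolding rho_eps_def[abs_def] by measurable

lemma measurable_Theta [measurable]: "Theta \<rho> \<kappa> e \<in> borel_measurable borel"
  unfolding Theta_def[abs_def] by measurable

text \<open>Rescaling turns each factor \<open>norm y\<close> into a factor \<open>e\<close>; this
  is the source of all the decay below.\<close>

lemma
  assumes e: "0 < e"
  shows rho_eps_moment_integrable: "integrable lborel (\<lambda>y. norm y ^ k * norm (rho_eps \<rho> e y))"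
    and rho_eps_moment: "(LINT y|lborel. norm y ^ k * norm (rho_eps \<rho> e y)) = e ^ k * moment k"
proof -
  have eq: "norm y ^ k * norm (rho_eps \<rho> e y) = (e ^ k / e ^ DIM('a)) * (norm (y /\<^sub>R e) ^ k * norm (\<rho> (y /\<^sub>R e)))" for y
    using e by (simp add: rho_eps_def power_mult_distrib divide_simps)
  note int = schwartz_moment_integrable[OF mollifier_schwartz, of k]
  show "integrable lborel (\<lambda>y. norm y ^ k * norm (rho_eps \<rho> e y))"
    unfolding eq by (rule integrable_mult_right[OF integrable_lborel_scaleR[OF e _ int]]) measurable
  have "(LINT y|lborel. norm (y /\<^sub>R e) ^ k * norm (\<rho> (y /\<^sub>R e))) = e ^ DIM('a) *\<^sub>R moment k"
    unfolding moment_def by (rule integral_lborel_scaleR[OF e]) measurable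
  then show "(LINT y|lborel. norm y ^ k * norm (rho_eps \<rho> e y)) = e ^ k * moment k"
    unfolding eq using e by simp
qed

lemma rho_eps_list_moment:
  assumes e: "0 < e" and bs: "set bs \<subseteq> Basis"
  shows "(LINT y|lborel. list_monom bs y *\<^sub>R rho_eps \<rho> e y) = (if bs = [] then 1 else 0)"
proof -
  have eq: "list_monom bs y *\<^sub>R rho_eps \<rho> e y
      = (e ^ length bs / e ^ DIM('a)) *\<^sub>R (list_monom bs (y /\<^sub>R e) *\<^sub>R \<rho> (y /\<^sub>R e))" for y
    using e by (simp add: rho_eps_def list_monom_scaleR divide_simps power_inverse)
  have "(LINT y|lborel. list_monom bs (y /\<^sub>R e) *\<^sub>R \<rho> (y /\<^sub>R e))
      = e ^ DIM('a) *\<^sub>R (LINT y|lborel. list_monom bs y *\<^sub>R \<rho> y)"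
    by (rule integral_lborel_scaleR[OF e]) measurable
  also have "(LINT y|lborel. list_monom bs y *\<^sub>R \<rho> y) = (if bs = [] then 1 else 0)"
  proof (cases "bs = []")
    case True
    then show ?thesis using \<rho> by (simp add: mollifier_def list_monom_def)
  next
    case False
    then have "mi_size (count_list bs) \<noteq> 0" using bs by (simp add: mi_size_count_list)
    then show ?thesis using \<rho> False bs by (simp add: mollifier_def list_monom_eq)
  qed
  finally have "(LINT y|lborel. list_monom bs (y /\<^sub>R e) *\<^sub>R \<rho> (y /\<^sub>R e))
      = e ^ DIM('a) *\<^sub>R (if bs = [] then 1 else 0)" .
  then show ?thesis
    unfolding eq integral_scaleR_right using e by simp
qed

lemma norm_Theta_le: "norm (Theta \<rho> \<kappa> e y) \<le> norm (rho_eps \<rho> e y)"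
proof -
  have "\<bar>\<kappa> (\<bar>ln e\<bar> *\<^sub>R y)\<bar> \<le> 1" using \<kappa> by (simp add: cutoff_def)
  then show ?thesis by (simp add: Theta_def norm_mult mult_left_le)
qed

lemma Theta_eq_0:
  assumes "2 \<le> \<bar>ln e\<bar> * norm y"
  shows "Theta \<rho> \<kappa> e y = 0"
  using assms \<kappa> by (simp add: Theta_def cutoff_def)

lemma norm_Theta_diff_le:
  "norm (Theta \<rho> \<kappa> e y - rho_eps \<rho> e y) \<le> (\<bar>ln e\<bar> * norm y) ^ n * norm (rho_eps \<rho> e y)"
proof -
  let ?t = "\<bar>ln e\<bar> *\<^sub>R y"
  have "\<bar>\<kappa> ?t - 1\<bar> \<le> norm ?t ^ n"
  proof (cases "norm ?t \<le> 1")
    case True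
    then have "\<kappa> ?t = 1" using \<kappa> by (simp add: cutoff_def)
    then show ?thesis by simp
  next
    case False
    have "0 \<le> \<kappa> ?t" "\<kappa> ?t \<le> 1" using \<kappa> by (auto simp: cutoff_def)
    then have "\<bar>\<kappa> ?t - 1\<bar> \<le> 1" by simp
    also have "1 \<le> norm ?t ^ n" using False by (intro one_le_power) simp
    finally show ?thesis .
  qed
  then have "norm (rho_eps \<rho> e y) * \<bar>\<kappa> ?t - 1\<bar> \<le> norm (rho_eps \<rho> e y) * norm ?t ^ n"
    by (intro mult_left_mono) auto
  moreover have "Theta \<rho> \<kappa> e y - rho_eps \<rho> e y = rho_eps \<rho> e y * complex_of_real (\<kappa> ?t - 1)"
    by (simp add: Theta_def algebra_simps)
  ultimately show ?thesis by (simp only: norm_mult norm_of_real) (simp add: mult_ac)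
qed

text \<open>
  Since \<open>\<kappa> = 1\<close> on the unit ball, \<open>\<bar>\<kappa> t - 1\<bar> \<le> norm t ^ n\<close> for every \<open>n\<close>: truncating the mollifier changes
  its moments only by a negligible amount.
\<close>

lemma Theta_moment:
  assumes e: "0 < e" and bs: "set bs \<subseteq> Basis"
  shows "integrable lborel (\<lambda>y. list_monom bs y *\<^sub>R Theta \<rho> \<kappa> e y)"
    and "norm ((LINT y|lborel. list_monom bs y *\<^sub>R Theta \<rho> \<kappa> e y) - (if bs = [] then 1 else 0))
      \<le> \<bar>ln e\<bar> ^ n * (e ^ (length bs + n) * moment (length bs + n))"
proof -
  have int: "integrable lborel (\<lambda>y. list_monom bs y *\<^sub>R w y)"
    if [measurable]: "w \<in> borel_measurable borel" and w: "\<And>y. norm (w y) \<le> norm (rho_eps \<rho> e y)" for w :: "'a \<Rightarrow> complex"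
    by (rule Bochner_Integration.integrable_bound[OF rho_eps_moment_integrable[OF e, of "length bs"]])
      (auto intro!: mult_mono abs_list_monom_le bs w)
  note intT = int[OF measurable_Theta norm_Theta_le]
  note intr = int[OF measurable_rho_eps order_refl]
  show "integrable lborel (\<lambda>y. list_monom bs y *\<^sub>R Theta \<rho> \<kappa> e y)" by (rule intT)
  have "(LINT y|lborel. list_monom bs y *\<^sub>R Theta \<rho> \<kappa> e y) - (if bs = [] then 1 else 0)
      = (LINT y|lborel. list_monom bs y *\<^sub>R Theta \<rho> \<kappa> e y - list_monom bs y *\<^sub>R rho_eps \<rho> e y)"
    unfolding rho_eps_list_moment[OF e bs, symmetric]
    by (rule Bochner_Integration.integral_diff[OF intT intr, symmetric])
  also have "norm \<dots> \<le> (LINT y|lborel. \<bar>ln e\<bar> ^ n * (norm y ^ (length bs + n) * norm (rho_eps \<rho> e y)))"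
  proof (rule Bochner_Integration.integral_norm_bound_integral)
    show "norm (list_monom bs y *\<^sub>R Theta \<rho> \<kappa> e y - list_monom bs y *\<^sub>R rho_eps \<rho> e y)
        \<le> \<bar>ln e\<bar> ^ n * (norm y ^ (length bs + n) * norm (rho_eps \<rho> e y))" for y
    proof -
      have "norm (list_monom bs y *\<^sub>R Theta \<rho> \<kappa> e y - list_monom bs y *\<^sub>R rho_eps \<rho> e y)
          = \<bar>list_monom bs y\<bar> * norm (Theta \<rho> \<kappa> e y - rho_eps \<rho> e y)"
        by (simp add: scaleR_diff_right[symmetric])
      also have "\<dots> \<le> norm y ^ length bs * ((\<bar>ln e\<bar> * norm y) ^ n * norm (rho_eps \<rho> e y))"
        by (intro mult_mono abs_list_monom_le bs norm_Theta_diff_le) auto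
      finally show ?thesis by (simp add: power_mult_distrib power_add mult_ac)
    qed
  qed (intro Bochner_Integration.integrable_diff intT intr integrable_mult_right rho_eps_moment_integrable e)+
  also have "\<dots> = \<bar>ln e\<bar> ^ n * (e ^ (length bs + n) * moment (length bs + n))"
    by (simp add: rho_eps_moment[OF e])
  finally show "norm ((LINT y|lborel. list_monom bs y *\<^sub>R Theta \<rho> \<kappa> e y) - (if bs = [] then 1 else 0))
      \<le> \<bar>ln e\<bar> ^ n * (e ^ (length bs + n) * moment (length bs + n))" .
qed

text \<open>\<open>f (z + y)\<close> is split into its Taylor polynomial \<open>?P\<close> and the
  remainder \<open>?R\<close>. The polynomial meets the almost ideal moments of
  \<open>\<Theta>\<close>; the remainder contributes the factor \<open>norm y ^ N\<close>, whose
  moment is of size \<open>e ^ N\<close>. The condition on \<open>ln e\<close> puts the support of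
  \<open>\<Theta>\<close> into the unit ball.\<close>

lemma Theta_approx:
  fixes f :: "'a \<Rightarrow> complex" and B :: real
  assumes e: "0 < e" "e < 1" "2 \<le> \<bar>ln e\<bar>" and f: "f \<in> smooth_fns UNIV" and "0 < N"
    and B: "\<And>bs y. set bs \<subseteq> Basis \<Longrightarrow> length bs \<le> N \<Longrightarrow> y \<in> cball z 1 \<Longrightarrow> norm (pd bs f y) \<le> B"
  shows "norm ((LINT y:cball 0 1|lborel. f (z + y) * Theta \<rho> \<kappa> e y) - f z) \<le> B * approx_const N * e ^ N"
proof -
  let ?\<Theta> = "Theta \<rho> \<kappa> e"
  let ?P = "\<lambda>y. \<Sum>k<N. \<Sum>bs\<in>basis_lists k. (list_monom bs y / fact k) *\<^sub>R pd bs f z"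
  let ?R = "\<lambda>y. f (z + y) - ?P y"
  have "0 \<le> B" using B[of "[]" z] by (simp add: order_trans[OF norm_ge_zero])
  have cont\<Theta>: "continuous_on S ?\<Theta>" for S
    unfolding Theta_def[abs_def] rho_eps_def
    by (intro continuous_intros continuous_on_compose2[OF schwartz_continuous[OF mollifier_schwartz]]
        continuous_on_compose2[OF cutoff_continuous]) (use e in auto)
  have contf: "continuous_on S (\<lambda>y. f (z + y))" for S
    by (intro continuous_on_compose2[OF smooth_continuous[OF f]] continuous_intros) auto
  have contP: "continuous_on S ?P" for S
    by (intro continuous_intros continuous_on_list_monom) auto
  have zero: "?\<Theta> y = 0" if "y \<notin> cball 0 1" for y
  proof (rule Theta_eq_0)
    have "2 * 1 \<le> \<bar>ln e\<bar> * norm y" using that e(3) by (intro mult_mono) auto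
    then show "2 \<le> \<bar>ln e\<bar> * norm y" by simp
  qed
  \<comment> \<open>Both domains are needed: the compact one gives integrability of the continuous
    integrands, the whole space is where the moments are known.\<close>
  have full: "(LINT y:cball 0 1|lborel. g y * ?\<Theta> y) = (LINT y|lborel. g y * ?\<Theta> y)" for g
    unfolding set_lebesgue_integral_def
    by (rule Bochner_Integration.integral_cong) (use zero in \<open>auto simp: indicator_def\<close>)
  have intR: "set_integrable lborel (cball 0 1) (\<lambda>y. ?R y * ?\<Theta> y)"
    and intP: "set_integrable lborel (cball 0 1) (\<lambda>y. ?P y * ?\<Theta> y)"
    by (intro set_integrable_compact compact_cball continuous_on_mult continuous_on_diff contf contP cont\<Theta>)+
  have "(LINT y:cball 0 1|lborel. f (z + y) * ?\<Theta> y)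
      = (LINT y:cball 0 1|lborel. ?R y * ?\<Theta> y + ?P y * ?\<Theta> y)"
    by (simp add: algebra_simps)
  also have "\<dots> = (LINT y:cball 0 1|lborel. ?R y * ?\<Theta> y) + (LINT y:cball 0 1|lborel. ?P y * ?\<Theta> y)"
    by (rule set_integral_add(2)[OF intR intP])
  finally have split: "(LINT y:cball 0 1|lborel. f (z + y) * ?\<Theta> y)
      = (LINT y:cball 0 1|lborel. ?R y * ?\<Theta> y) + (LINT y:cball 0 1|lborel. ?P y * ?\<Theta> y)" .
  let ?m = "\<lambda>bs. LINT y|lborel. list_monom bs y *\<^sub>R ?\<Theta> y"
  have "(LINT y:cball 0 1|lborel. ?P y * ?\<Theta> y) = (LINT y|lborel. ?P y * ?\<Theta> y)"
    by (rule full)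
  also have "\<dots> = (LINT y|lborel. (\<Sum>k<N. \<Sum>bs\<in>basis_lists k. (pd bs f z / fact k) * (list_monom bs y *\<^sub>R ?\<Theta> y)))"
    by (rule Bochner_Integration.integral_cong)
      (simp_all add: sum_distrib_right sum_distrib_left scaleR_conv_of_real mult_ac)
  also have "\<dots> = (\<Sum>k<N. \<Sum>bs\<in>basis_lists k. (LINT y|lborel. (pd bs f z / fact k) * (list_monom bs y *\<^sub>R ?\<Theta> y)))"
    by (subst Bochner_Integration.integral_sum;
        (subst Bochner_Integration.integral_sum)?;
        intro Bochner_Integration.integrable_sum integrable_mult_right Theta_moment(1)[OF e(1)] refl)
       (auto simp: basis_lists_def)
  also have "\<dots> = (\<Sum>k<N. \<Sum>bs\<in>basis_lists k. (pd bs f z / fact k) * ?m bs)"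
    by (simp only: integral_mult_right_zero)
  finally have P1: "(LINT y:cball 0 1|lborel. ?P y * ?\<Theta> y)
      = (\<Sum>k<N. \<Sum>bs\<in>basis_lists k. (pd bs f z / fact k) * ?m bs)" .
  \<comment> \<open>The value \<open>f z\<close> is what the polynomial would give with the ideal
    moments \<open>1\<close> for the empty list and \<open>0\<close> for all others, so the
    deviations can be compared term by term.\<close>
  have "f z = (\<Sum>k<N. \<Sum>bs\<in>basis_lists k. (pd bs f z / fact k) * (if bs = [] then 1 else 0))"
  proof -
    have "(\<Sum>bs\<in>basis_lists k. (pd bs f z / fact k) * (if bs = [] then 1 else 0)) = (if k = 0 then f z else 0)" for k
    proof (cases k)
      case 0
      then have "basis_lists k = {[] :: 'a list}" by (auto simp: basis_lists_def)
      then show ?thesis using 0 by simp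
    next
      case (Suc j)
      then show ?thesis by (auto intro!: sum.neutral simp: basis_lists_def)
    qed
    then show ?thesis using \<open>0 < N\<close> by simp
  qed
  then have P2: "(LINT y:cball 0 1|lborel. ?P y * ?\<Theta> y) - f z
      = (\<Sum>k<N. \<Sum>bs\<in>basis_lists k. (pd bs f z / fact k) * (?m bs - (if bs = [] then 1 else 0)))"
    unfolding P1 by (simp only: right_diff_distrib sum_subtractf)
  have P3: "norm ((pd bs f z / fact k) * (?m bs - (if bs = [] then 1 else 0)))
      \<le> B * (4 ^ N * moment (k + 2 * N)) * e ^ N" if "bs \<in> basis_lists k" "k < N" for k bs
  proof -
    have bs: "set bs \<subseteq> Basis" "length bs = k" using that by (auto simp: basis_lists_def)
    have "norm (pd bs f z / fact k) \<le> norm (pd bs f z)"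
      using fact_ge_1[of k, where 'a = real] by (simp add: norm_divide divide_le_eq mult_le_cancel_left1)
    also have "\<dots> \<le> B" using bs that by (intro B) auto
    finally have 1: "norm (pd bs f z / fact k) \<le> B" .
    \<comment> \<open>The choice \<open>n = 2 * N\<close> yields \<open>2 * N\<close> extra factors
      \<open>e\<close>: \<open>N\<close> of them absorb the powers of \<open>ln e\<close>, the other
      \<open>N\<close> remain as the rate.\<close>
    have "norm (?m bs - (if bs = [] then 1 else 0)) \<le> \<bar>ln e\<bar> ^ (2 * N) * (e ^ (k + 2 * N) * moment (k + 2 * N))"
      using Theta_moment(2)[OF e(1) bs(1), of "2 * N"] bs(2) by simp
    also have "\<dots> = (ln e ^ 2 * e) ^ N * moment (k + 2 * N) * (e ^ k * e ^ N)"
    proof -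
      have "\<bar>ln e\<bar> ^ (2 * N) = (ln e ^ 2) ^ N" by (simp add: power_mult)
      moreover have "e ^ (k + 2 * N) = e ^ k * (e ^ N * e ^ N)" by (simp add: power_add mult_2)
      ultimately show ?thesis by (simp only: power_mult_distrib mult_ac)
    qed
    also have "\<dots> \<le> 4 ^ N * moment (k + 2 * N) * (1 * e ^ N)"
      using e moment_nonneg ln_square_bound[OF e(1,2)]
      by (intro mult_mono power_mono) (auto intro: power_le_one)
    finally have 2: "norm (?m bs - (if bs = [] then 1 else 0)) \<le> 4 ^ N * moment (k + 2 * N) * (1 * e ^ N)" .
    show ?thesis
      using mult_mono[OF 1 2 \<open>0 \<le> B\<close> norm_ge_zero] unfolding norm_mult
      by (simp only: mult_1 mult_ac)
  qed
  have P: "norm ((LINT y:cball 0 1|lborel. ?P y * ?\<Theta> y) - f z)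
      \<le> (\<Sum>k<N. \<Sum>bs\<in>(basis_lists k :: 'a list set). B * (4 ^ N * moment (k + 2 * N)) * e ^ N)"
    unfolding P2 by (intro order_trans[OF norm_sum] sum_mono P3) auto
  have R1: "norm (?R y) \<le> card (basis_lists N :: 'a list set) * B * norm y ^ N" if "y \<in> cball 0 1" for y
  proof (rule smooth_Taylor[OF f \<open>0 < N\<close>])
    fix bs :: "'a list" and t :: real assume "bs \<in> basis_lists N" "t \<in> {0..1}"
    moreover have "\<bar>t\<bar> * norm y \<le> 1 * 1" using that \<open>t \<in> {0..1}\<close> by (intro mult_mono) auto
    ultimately show "norm (pd bs f (z + t *\<^sub>R y)) \<le> B"
      by (intro B) (auto simp: basis_lists_def dist_norm)
  qed
  have R: "norm (LINT y:cball 0 1|lborel. ?R y * ?\<Theta> y) \<le> card (basis_lists N :: 'a list set) * B * (e ^ N * moment N)"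
  proof -
    have "norm (LINT y:cball 0 1|lborel. ?R y * ?\<Theta> y)
        \<le> (LINT y|lborel. card (basis_lists N :: 'a list set) * B * (norm y ^ N * norm (rho_eps \<rho> e y)))"
      unfolding set_lebesgue_integral_def
    proof (rule Bochner_Integration.integral_norm_bound_integral)
      fix y
      show "norm (indicator (cball 0 1) y *\<^sub>R (?R y * ?\<Theta> y))
          \<le> card (basis_lists N :: 'a list set) * B * (norm y ^ N * norm (rho_eps \<rho> e y))"
      proof (cases "y \<in> cball 0 1")
        case True
        have "norm (?R y) * norm (?\<Theta> y) \<le> (card (basis_lists N :: 'a list set) * B * norm y ^ N) * norm (rho_eps \<rho> e y)"
          using \<open>0 \<le> B\<close> by (intro mult_mono R1[OF True] norm_Theta_le) auto
        then show ?thesis using True by (simp add: norm_mult mult_ac)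
      next
        case False
        then show ?thesis using \<open>0 \<le> B\<close> by simp
      qed
    qed (use intR in \<open>auto simp: set_integrable_def intro!: integrable_mult_right rho_eps_moment_integrable e\<close>)
    then show ?thesis by (simp add: rho_eps_moment[OF e(1)])
  qed
  have "norm ((LINT y:cball 0 1|lborel. f (z + y) * ?\<Theta> y) - f z)
      \<le> norm (LINT y:cball 0 1|lborel. ?R y * ?\<Theta> y) + norm ((LINT y:cball 0 1|lborel. ?P y * ?\<Theta> y) - f z)"
    unfolding split
    using norm_triangle_ineq[of "LINT y:cball 0 1|lborel. ?R y * ?\<Theta> y" "(LINT y:cball 0 1|lborel. ?P y * ?\<Theta> y) - f z"]
    by (simp only: add_diff_eq)
  also have "\<dots> \<le> card (basis_lists N :: 'a list set) * B * (e ^ N * moment N) +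
      (\<Sum>k<N. \<Sum>bs\<in>(basis_lists k :: 'a list set). B * (4 ^ N * moment (k + 2 * N)) * e ^ N)"
    by (rule add_mono[OF R P])
  also have "\<dots> = B * approx_const N * e ^ N"
    unfolding approx_const_def sum_constant distrib_left distrib_right sum_distrib_left sum_distrib_right
    by (simp only: mult_ac)
  finally show ?thesis .
qed

end

section \<open>Exchanging distributions and integrals\<close>

text \<open>The integral is compared with the sum cell by cell, against the constant
  \<open>f t\<close> on the cell tagged by \<open>t\<close>.\<close>

lemma set_integral_Riemann_bound:
  fixes f :: "'a::euclidean_space \<Rightarrow> complex"
  assumes p: "p tagged_division_of cbox a b" and cont: "continuous_on (cbox a b) f"
    and near: "\<And>t k y. (t, k) \<in> p \<Longrightarrow> y \<in> k \<Longrightarrow> norm (f y - f t) \<le> e" and "0 \<le> e"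
  shows "norm ((LINT y:cbox a b|lborel. f y) - (\<Sum>(t, k)\<in>p. measure lborel k *\<^sub>R f t)) \<le> e * measure lborel (cbox a b)"
proof -
  have int: "f integrable_on cbox a b" by (rule integrable_continuous[OF cont])
  have "(LINT y:cbox a b|lborel. f y) = integral (cbox a b) f"
    by (rule set_borel_integral_eq_integral(2)[OF set_integrable_compact[OF compact_cbox cont]])
  also have "\<dots> = (\<Sum>(t, k)\<in>p. integral k f)"
    by (rule integral_combine_tagged_division_topdown[OF int p])
  finally have "(LINT y:cbox a b|lborel. f y) - (\<Sum>(t, k)\<in>p. measure lborel k *\<^sub>R f t)
      = (\<Sum>(t, k)\<in>p. integral k f - measure lborel k *\<^sub>R f t)"
    by (simp add: sum_subtractf case_prod_unfold)
  also have "norm \<dots> \<le> (\<Sum>(t, k)\<in>p. e * measure lborel k)"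
  proof (rule sum_norm_le, clarify)
    fix t k assume tk: "(t, k) \<in> p"
    obtain c d where k: "k = cbox c d" using tagged_division_ofD(4)[OF p tk] by blast
    have sub: "k \<subseteq> cbox a b" using tagged_division_ofD(3)[OF p tk] .
    have ck: "continuous_on k f" by (rule continuous_on_subset[OF cont sub])
    then have "(f has_integral integral k f) (cbox c d)"
      unfolding k by (intro integrable_integral integrable_continuous)
    moreover have "((\<lambda>y. f t) has_integral measure lborel (cbox c d) *\<^sub>R f t) (cbox c d)"
      by (rule has_integral_const)
    ultimately have "((\<lambda>y. f y - f t) has_integral (integral k f - measure lborel (cbox c d) *\<^sub>R f t)) (cbox c d)"
      by (rule has_integral_diff)
    then have "norm (integral k f - measure lborel (cbox c d) *\<^sub>R f t) \<le> e * measure lborel (cbox c d)"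
      by (rule has_integral_bound[OF \<open>0 \<le> e\<close>]) (use near[OF tk] k in auto)
    then show "norm (integral k f - measure lborel k *\<^sub>R f t) \<le> e * measure lborel k" by (simp only: k)
  qed
  also have "\<dots> = e * measure lborel (cbox a b)"
    unfolding additive_content_tagged_division[OF p, symmetric] by (simp add: sum_distrib_left case_prod_unfold)
  finally show ?thesis .
qed

text \<open>
  The Riemann sums of \<open>\<integral> F (y, z) dy\<close> converge together with all their derivatives in \<open>z\<close>,
  uniformly on the compact set that controls \<open>T\<close>.
\<close>

lemma distribution_integral_swap:
  fixes Y :: "'b::euclidean_space set" and F :: "'a::euclidean_space \<times> 'b \<Rightarrow> complex"
  assumes "open Y" and T: "T \<in> compact_distributions Y" and F: "F \<in> smooth_fns (UNIV \<times> Y)"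
  shows "T (\<lambda>z. LINT y:cbox a b|lborel. F (y, z)) = (LINT y:cbox a b|lborel. T (\<lambda>z. F (y, z)))"
proof -
  note ops = open_UNIV \<open>open Y\<close>
  let ?Q = "cbox a b"
  define \<mu> where "\<mu> = measure lborel ?Q"
  obtain K l C where c: "controlled T Y K l C" by (rule compact_distribution_controlled[OF T])
  then have K: "compact K" "K \<subseteq> Y" "0 \<le> C" by (auto simp: controlled_def)
  define I where "I = (\<lambda>z. LINT y:?Q|lborel. F (y, z))"
  define W where "W = (\<lambda>\<phi>. LINT y:?Q|lborel. \<phi> y * (1::complex))"
  have W: "W \<in> compact_distributions UNIV"
    unfolding W_def by (rule set_integral_distribution) (auto intro: continuous_on_const)
  \<comment> \<open>In \<open>classical_op\<close> the parameter comes first. Exchanging the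
    arguments of \<open>F\<close> turns \<open>z\<close> into the parameter of an integral, which
    gives smoothness of \<open>I\<close> and its derivatives.\<close>
  have Fs: "(\<lambda>p. F (snd p, fst p)) \<in> smooth_fns (Y \<times> UNIV)"
    by (rule smooth_affine[where \<Omega> = "UNIV \<times> Y" and L = "\<lambda>p. (snd p, fst p)"])
      (use ops F in \<open>auto intro!: derivative_eq_intros open_Times\<close>)
  have I: "I = classical_op (\<lambda>p. F (snd p, fst p)) W"
    by (simp add: I_def classical_op_def W_def fun_eq_iff)
  have sI: "I \<in> smooth_fns Y"
    unfolding I by (rule smooth_classical_op[OF ops(2,1) W Fs])
  have sF: "(\<lambda>z. F (y, z)) \<in> smooth_fns Y" for y by (rule smooth_slice(1)[OF ops F UNIV_I])
  have pdI: "pd cs I z = (LINT y:?Q|lborel. pd (map (Pair 0) cs) F (y, z))"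
    if "set cs \<subseteq> Basis" "z \<in> Y" for cs z
  proof -
    have "pd cs I z = classical_op (pd (map (\<lambda>b. (b, 0)) cs) (\<lambda>p. F (snd p, fst p))) W z"
      unfolding I by (rule pd_classical_op[OF ops(2,1) W Fs that(2,1)])
    also have "\<dots> = (LINT y:?Q|lborel. pd (map (\<lambda>b. (b, 0)) cs) (\<lambda>p. F (snd p, fst p)) (z, y))"
      by (simp add: classical_op_def W_def)
    also have "\<dots> = (LINT y:?Q|lborel. pd (map (Pair 0) cs) F (y, z))"
    proof -
      have "pd (map (\<lambda>b. (b, 0)) cs) (\<lambda>p. F (snd p, fst p)) (z, y)
          = pd (map (\<lambda>p. (snd p, fst p)) (map (\<lambda>b. (b, 0)) cs)) F (snd (z, y), fst (z, y))" for y
        by (rule pd_affine[where \<Omega> = "UNIV \<times> Y" and \<Omega>' = "Y \<times> UNIV" and A = "\<lambda>p. (snd p, fst p)"])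
          (use that ops F in \<open>auto intro!: derivative_eq_intros open_Times Pair_Basis(2)\<close>)
      then show ?thesis by (simp add: comp_def)
    qed
    finally show ?thesis .
  qed
  define S where "S = (\<lambda>y. T (\<lambda>z. F (y, z)))"
  have S: "S = classical_op F T" by (simp add: S_def classical_op_def fun_eq_iff)
  have contS: "continuous_on ?Q S"
    unfolding S by (rule continuous_on_subset[OF smooth_continuous[OF smooth_classical_op[OF ops T F]]]) simp
  have bound: "norm (T I - (LINT y:?Q|lborel. S y)) \<le> e * (C * \<mu> + \<mu>)" if "e > 0" for e
  proof -
    define G where "G = (\<lambda>cs. pd (map (Pair 0) cs) F) ` {cs :: 'b list. set cs \<subseteq> Basis \<and> length cs \<le> l}"
    have G: "finite G" "\<And>g. g \<in> G \<Longrightarrow> continuous_on (UNIV \<times> Y) g"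
      unfolding G_def
      by (auto intro!: finite_imageI finite_basis_lists smooth_continuous smooth_pd[OF F] Pair_Basis(2))
    \<comment> \<open>One radius serves two Riemann sums with the same division: that of the
      functions of \<open>z\<close>, with derivatives, on which \<open>T\<close> acts, and that of
      the scalar function \<open>S\<close>.\<close>
    have "\<exists>d. 0 < d \<and> (\<forall>g\<in>G. \<forall>y'\<in>ball y d. \<forall>z\<in>K. norm (g (y', z) - g (y, z)) \<le> e) \<and>
        (y \<in> ?Q \<longrightarrow> (\<forall>y'\<in>?Q \<inter> ball y d. norm (S y' - S y) \<le> e))" for y
    proof -
      obtain d1 where d1: "d1 > 0" "\<forall>g\<in>G. \<forall>y'\<in>ball y d1. \<forall>z\<in>K. norm (g (y', z) - g (y, z)) \<le> e"
        using uniform_slices[OF ops G K(1,2) UNIV_I \<open>e > 0\<close>, of y] by blast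
      obtain d2 where d2: "d2 > 0" "y \<in> ?Q \<longrightarrow> (\<forall>y'\<in>?Q. dist y' y < d2 \<longrightarrow> dist (S y') (S y) < e)"
      proof (cases "y \<in> ?Q")
        case True
        then show ?thesis using contS \<open>e > 0\<close> that unfolding continuous_on_iff by blast
      next
        case False
        then show ?thesis using that[of 1] by simp
      qed
      have "norm (S y' - S y) \<le> e" if "y \<in> ?Q" "y' \<in> ?Q" "dist y y' < d2" for y'
        using d2(2) that by (auto simp: dist_norm[symmetric] dist_commute[of y'] intro: less_imp_le)
      then show ?thesis using d1 d2(1) by (intro exI[of _ "min d1 d2"]) auto
    qed
    then have "\<forall>y. \<exists>d. 0 < d \<and> (\<forall>g\<in>G. \<forall>y'\<in>ball y d. \<forall>z\<in>K. norm (g (y', z) - g (y, z)) \<le> e) \<and>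
        (y \<in> ?Q \<longrightarrow> (\<forall>y'\<in>?Q \<inter> ball y d. norm (S y' - S y) \<le> e))" by (rule allI)
    from choice[OF this] obtain d where d0: "\<forall>y. 0 < d y \<and>
        (\<forall>g\<in>G. \<forall>y'\<in>ball y (d y). \<forall>z\<in>K. norm (g (y', z) - g (y, z)) \<le> e) \<and>
        (y \<in> ?Q \<longrightarrow> (\<forall>y'\<in>?Q \<inter> ball y (d y). norm (S y' - S y) \<le> e))" by (rule exE)
    have d: "d y > 0" "g \<in> G \<Longrightarrow> y' \<in> ball y (d y) \<Longrightarrow> z \<in> K \<Longrightarrow> norm (g (y', z) - g (y, z)) \<le> e"
      "y \<in> ?Q \<Longrightarrow> y' \<in> ?Q \<Longrightarrow> y' \<in> ball y (d y) \<Longrightarrow> norm (S y' - S y) \<le> e" for y g y' z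
      using spec[OF d0, of y] by blast+
    \<comment> \<open>The radii vary with the point; the existence of a fine tagged division
      replaces a uniform choice.\<close>
    have "gauge (\<lambda>y. ball y (d y))" using d(1) by (simp add: gauge_ball_dependent)
    then obtain p where p: "p tagged_division_of ?Q" "(\<lambda>y. ball y (d y)) fine p"
      by (rule fine_division_exists)
    have tk: "t \<in> ?Q" "y \<in> ?Q" "y \<in> ball t (d t)" if "(t, k) \<in> p" "y \<in> k" for t k y
    proof -
      have "k \<subseteq> ball t (d t)" using p(2) that(1) unfolding fine_def by blast
      then show "t \<in> ?Q" "y \<in> ?Q" "y \<in> ball t (d t)"
        using that(2) tagged_division_ofD(2,3)[OF p(1) that(1)] by blast+
    qed
    define R where "R = (\<lambda>z. \<Sum>(t, k)\<in>p. measure lborel k *\<^sub>R F (t, z))"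
    have sR': "(\<lambda>z. measure lborel (snd q) *\<^sub>R F (fst q, z)) \<in> smooth_fns Y" for q :: "'a \<times> 'a set"
      by (rule smooth_linear[OF ops(2) bounded_linear_scaleR_right sF])
    have sR: "R \<in> smooth_fns Y"
      unfolding R_def case_prod_unfold by (rule smooth_sum[OF ops(2) sR'])
    have TR: "T R = (\<Sum>(t, k)\<in>p. measure lborel k *\<^sub>R S t)"
      unfolding R_def case_prod_unfold S_def
      using distr_sum[where f = "\<lambda>q z. measure lborel (snd q) *\<^sub>R F (fst q, z)" and I = p, OF ops(2) T sR']
      by (simp add: distr_scaleR[OF ops(2) T sF])
    have "norm (T (\<lambda>z. I z - R z)) \<le> C * (e * \<mu>)"
    proof (rule controlledD[OF c smooth_diff[OF ops(2) sI sR]])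
      show "0 \<le> e * \<mu>" using \<open>e > 0\<close> by (simp add: \<mu>_def)
      fix cs :: "'b list" and z assume cs: "set cs \<subseteq> Basis" "length cs \<le> l" and z: "z \<in> K"
      then have zY: "z \<in> Y" using K by auto
      let ?g = "pd (map (Pair 0) cs) F"
      have g: "?g \<in> G" using cs by (auto simp: G_def)
      have "pd cs R z = (\<Sum>(t, k)\<in>p. measure lborel k *\<^sub>R ?g (t, z))"
        unfolding R_def case_prod_unfold
        using pd_sum[where f = "\<lambda>q z. measure lborel (snd q) *\<^sub>R F (fst q, z)" and I = p, OF ops(2) sR' cs(1) zY]
        by (simp add: pd_linear[OF ops(2) bounded_linear_scaleR_right sF cs(1) zY]
            pd_slice(1)[OF ops F UNIV_I zY cs(1)])
      then have "pd cs (\<lambda>z. I z - R z) z = (LINT y:?Q|lborel. ?g (y, z)) - (\<Sum>(t, k)\<in>p. measure lborel k *\<^sub>R ?g (t, z))"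
        using pd_diff[OF ops(2) sI sR cs(1) zY] pdI[OF cs(1) zY] by simp
      also have "norm \<dots> \<le> e * \<mu>"
        unfolding \<mu>_def
      proof (rule set_integral_Riemann_bound[OF p(1)])
        have "(\<lambda>y. ?g (y, z)) \<in> smooth_fns UNIV"
          using cs Pair_Basis by (intro smooth_slice(2)[OF ops _ zY] smooth_pd[OF F]) auto
        then show "continuous_on ?Q (\<lambda>y. ?g (y, z))"
          by (rule continuous_on_subset[OF smooth_continuous]) simp
        show "norm (?g (y, z) - ?g (t, z)) \<le> e" if "(t, k) \<in> p" "y \<in> k" for t k y
          by (rule d(2)[OF g tk(3)[OF that] z])
      qed (use \<open>e > 0\<close> in simp)
      finally show "norm (pd cs (\<lambda>z. I z - R z) z) \<le> e * \<mu>" .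
    qed
    then have 1: "norm (T I - T R) \<le> C * (e * \<mu>)" using distr_diff[OF ops(2) T sI sR] by simp
    have 2: "norm ((LINT y:?Q|lborel. S y) - T R) \<le> e * \<mu>"
      unfolding TR \<mu>_def
      by (rule set_integral_Riemann_bound[OF p(1) contS]) (use \<open>e > 0\<close> d(3) tk in auto)
    have "norm (T I - (LINT y:?Q|lborel. S y)) = norm ((T I - T R) - ((LINT y:?Q|lborel. S y) - T R))" by simp
    also have "\<dots> \<le> C * (e * \<mu>) + e * \<mu>"
      using 1 2 norm_triangle_ineq4 by (meson add_mono order_trans)
    finally show ?thesis by (simp add: algebra_simps)
  qed
  have "norm (T I - (LINT y:?Q|lborel. S y)) \<le> 0 + e" if "e > 0" for e
  proof -
    \<comment> \<open>The added \<open>1\<close> keeps the divisor positive when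
      \<open>\<mu> = 0\<close>.\<close>
    have pos: "0 < C * \<mu> + \<mu> + 1" using K(3) by (simp add: \<mu>_def add_nonneg_pos)
    have "e / (C * \<mu> + \<mu> + 1) * (C * \<mu> + \<mu>) \<le> e"
      using pos that by (simp add: field_simps)
    then show ?thesis using bound[of "e / (C * \<mu> + \<mu> + 1)"] pos that by simp
  qed
  then have "norm (T I - (LINT y:?Q|lborel. S y)) \<le> 0" by (rule field_le_epsilon)
  then show ?thesis by (simp add: I_def S_def)
qed

section \<open>The embedded net\<close>

lemma finite_common_order:
  assumes "finite I" "\<And>i. i \<in> I \<Longrightarrow> \<exists>k. order_on K (u i) k"
  shows "\<exists>k. \<forall>i\<in>I. order_on K (u i) k"
  using assms
proof (induction I rule: finite_induct)
  case (insert i I)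
  obtain k where k: "\<And>i. i \<in> I \<Longrightarrow> order_on K (u i) k" using insert by auto
  obtain j where j: "order_on K (u i) j" using insert by auto
  have "order_on K (u i') (min k j)" if "i' \<in> insert i I" for i'
    using that order_on_mono[OF j, of "min k j"] order_on_mono[OF k, of i' "min k j"] by auto
  then show ?case by blast
qed simp

lemma order_on_zero: "order_on K (\<lambda>e x. 0) k"
  by (rule order_onI[where C = 0]) simp

lemma order_on_scaleR:
  assumes "order_on K u k"
  shows "order_on K (\<lambda>e x. r *\<^sub>R u e x) k"
proof -
  obtain C where C: "\<forall>\<^sub>F e in at_right 0. \<forall>x\<in>K. norm (u e x) \<le> C * e powi k"
    using assms by (auto simp: order_on_def)
  then have "\<forall>\<^sub>F e in at_right 0. \<forall>x\<in>K. norm (r *\<^sub>R u e x) \<le> (\<bar>r\<bar> * C) * e powi k"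
    by eventually_elim (simp add: mult.assoc mult_left_mono)
  then show ?thesis by (rule order_onI)
qed

lemma order_on_sum:
  assumes "finite I" "\<And>i. i \<in> I \<Longrightarrow> order_on K (u i) k"
  shows "order_on K (\<lambda>e x. \<Sum>i\<in>I. u i e x) k"
  using assms by (induction I rule: finite_induct) (simp_all add: order_on_zero order_on_add)

text \<open>In contrast to \<open>pd_affine\<close>, \<open>L\<close> need not map basis vectors to
  basis vectors. The intended map is \<open>fst p - snd p\<close>, where derivatives in the second
  variable bring a sign; each derivative is expanded in the basis, and a common order is chosen for
  the finitely many terms.\<close>

lemma moderate_affine:
  fixes A :: "'a::euclidean_space \<Rightarrow> 'b::euclidean_space"
  assumes A: "\<And>x. (A has_derivative L) (at x)" and "u \<in> moderate_nets UNIV"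
  shows "(\<lambda>e x. u e (A x)) \<in> moderate_nets UNIV"
proof (rule moderate_netsI[OF open_UNIV])
  have sm: "(\<lambda>x. u e (A x)) \<in> smooth_fns UNIV"
    if "u \<in> moderate_nets UNIV" "0 < e" "e \<le> 1" for u and e :: real
    by (rule smooth_affine[OF A open_UNIV UNIV_I moderate_smooth[OF open_UNIV that]])
  show "(\<lambda>x. u e (A x)) \<in> smooth_fns UNIV" if "0 < e" "e \<le> 1" for e
    by (rule sm[OF assms(2) that])
  have contA: "continuous_on S A" for S
    by (intro continuous_at_imp_continuous_on ballI has_derivative_continuous[OF A])
  fix K :: "'a set" and bs :: "'a list"
  assume K: "compact K" and "set bs \<subseteq> Basis"
  then show "\<exists>k. order_on K (\<lambda>e. pd bs (\<lambda>x. u e (A x))) k"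
    using assms(2)
  proof (induction bs arbitrary: u rule: rev_induct)
    case Nil
    obtain k where "order_on (A ` K) (\<lambda>e. pd [] (u e)) k"
      by (rule moderate_order[OF open_UNIV Nil(3) compact_continuous_image[OF contA K], of "[]"]) auto
    then show ?case by (auto simp: order_on_def)
  next
    case (snoc b bs)
    have bs: "set bs \<subseteq> Basis" using snoc.prems by auto
    note u = snoc.prems(3)
    have u': "(\<lambda>e. partial c (u e)) \<in> moderate_nets UNIV" if "c \<in> Basis" for c
      by (rule moderate_partial[OF open_UNIV u that])
    have "\<exists>k. \<forall>c\<in>Basis. order_on K (\<lambda>e. pd bs (\<lambda>x. partial c (u e) (A x))) k"
      by (rule finite_common_order[OF finite_Basis]) (rule snoc.IH[OF K bs u'])
    then obtain k where k: "\<And>c. c \<in> Basis \<Longrightarrow> order_on K (\<lambda>e. pd bs (\<lambda>x. partial c (u e) (A x))) k"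
      by blast
    have "order_on K (\<lambda>e. pd (bs @ [b]) (\<lambda>x. u e (A x))) k"
    proof (rule order_on_cong)
      show "order_on K (\<lambda>e x. \<Sum>c\<in>Basis. (L b \<bullet> c) *\<^sub>R pd bs (\<lambda>x. partial c (u e) (A x)) x) k"
        by (rule order_on_sum[OF finite_Basis]) (rule order_on_scaleR[OF k])
      fix e :: real and x assume "0 < e" "e < 1" "x \<in> K"
      then have e: "0 < e" "e \<le> 1" by auto
      note d = smooth_differentiable[OF moderate_smooth[OF open_UNIV u e] UNIV_I]
      have "partial b (\<lambda>x. u e (A x)) = (\<lambda>x. \<Sum>c\<in>Basis. (L b \<bullet> c) *\<^sub>R partial c (u e) (A x))"
        by (rule ext) (rule trans[OF partial_affine[OF A d] partial_expand[OF d]])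
      then have "pd (bs @ [b]) (\<lambda>x. u e (A x)) x
          = pd bs (\<lambda>x. \<Sum>c\<in>Basis. (L b \<bullet> c) *\<^sub>R partial c (u e) (A x)) x"
        by (simp add: pd_append pd_Cons)
      also have "\<dots> = (\<Sum>c\<in>Basis. pd bs (\<lambda>x. (L b \<bullet> c) *\<^sub>R partial c (u e) (A x)) x)"
        by (rule pd_sum[OF open_UNIV _ bs UNIV_I])
          (rule smooth_linear[OF open_UNIV bounded_linear_scaleR_right sm[OF u' e]])
      also have "\<dots> = (\<Sum>c\<in>Basis. (L b \<bullet> c) *\<^sub>R pd bs (\<lambda>x. partial c (u e) (A x)) x)"
        by (rule sum.cong[OF refl])
          (rule pd_linear[OF open_UNIV bounded_linear_scaleR_right sm[OF u' e] bs UNIV_I])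
      finally show "pd (bs @ [b]) (\<lambda>x. u e (A x)) x
          = (\<Sum>c\<in>Basis. (L b \<bullet> c) *\<^sub>R pd bs (\<lambda>x. partial c (u e) (A x)) x)" .
    qed
    then show ?case ..
  qed
qed

lemma pd_scale:
  assumes f: "f \<in> smooth_fns UNIV"
  shows "set bs \<subseteq> Basis \<Longrightarrow> pd bs (\<lambda>x. f (c *\<^sub>R x)) x = c ^ length bs *\<^sub>R pd bs f (c *\<^sub>R x)"
proof (induction bs arbitrary: x)
  case (Cons b bs)
  have A: "((\<lambda>x. c *\<^sub>R x) has_derivative (\<lambda>x. c *\<^sub>R x)) (at x)" for x :: 'a
    by (auto intro!: derivative_eq_intros)
  have s: "pd bs f \<in> smooth_fns UNIV" using Cons by (intro smooth_pd[OF f]) auto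
  note d = smooth_differentiable[OF s UNIV_I]
  have d': "(\<lambda>x. pd bs f (c *\<^sub>R x)) differentiable (at x)" for x
    by (rule smooth_differentiable[OF smooth_affine[OF A open_UNIV UNIV_I s] UNIV_I])
  have "pd bs (\<lambda>x. f (c *\<^sub>R x)) = (\<lambda>x. c ^ length bs *\<^sub>R pd bs f (c *\<^sub>R x))"
    using Cons by auto
  then have "pd (b # bs) (\<lambda>x. f (c *\<^sub>R x)) x = partial b (\<lambda>x. c ^ length bs *\<^sub>R pd bs f (c *\<^sub>R x)) x"
    by (simp add: pd_Cons)
  also have "\<dots> = c ^ length bs *\<^sub>R partial b (\<lambda>x. pd bs f (c *\<^sub>R x)) x"
    by (rule partial_linear[OF bounded_linear_scaleR_right d'])
  also have "partial b (\<lambda>x. pd bs f (c *\<^sub>R x)) x = c *\<^sub>R partial b (pd bs f) (c *\<^sub>R x)"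
    by (rule trans[OF partial_affine[OF A d] partial_scaleR[OF d]])
  finally show ?case by (simp add: pd_Cons)
qed simp

text \<open>Each derivative costs at most one factor \<open>1 / e\<close>. Bounds on the whole space
  are needed because the dilated argument leaves every compact set. This covers the dilations of
  \<open>\<rho>\<close> and of \<open>\<kappa>\<close>.\<close>

lemma moderate_scale:
  fixes \<phi> :: "'a::euclidean_space \<Rightarrow> complex"
  assumes \<phi>: "\<phi> \<in> smooth_fns UNIV" and B: "\<And>bs. set bs \<subseteq> Basis \<Longrightarrow> \<exists>B. \<forall>x. norm (pd bs \<phi> x) \<le> B"
    and c: "\<And>e. 0 < e \<Longrightarrow> e < 1 \<Longrightarrow> \<bar>c e\<bar> \<le> 1 / e"
  shows "(\<lambda>e x. \<phi> (c e *\<^sub>R x)) \<in> moderate_nets UNIV"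
proof (rule moderate_netsI[OF open_UNIV])
  show "(\<lambda>x. \<phi> (c e *\<^sub>R x)) \<in> smooth_fns UNIV" for e
    by (rule smooth_affine[where A = "\<lambda>x. c e *\<^sub>R x" and L = "\<lambda>x. c e *\<^sub>R x", OF _ open_UNIV UNIV_I \<phi>])
      (auto intro!: derivative_eq_intros)
  fix K and bs :: "'a list" assume bs: "set bs \<subseteq> Basis"
  obtain M where M: "\<And>x. norm (pd bs \<phi> x) \<le> M" using B[OF bs] by blast
  have "\<forall>\<^sub>F e in at_right 0. \<forall>x\<in>K. norm (pd bs (\<lambda>x. \<phi> (c e *\<^sub>R x)) x) \<le> M * e powi (- int (length bs))"
    using eventually_at_right_01
  proof eventually_elim
    case (elim e)
    have "norm (pd bs (\<lambda>x. \<phi> (c e *\<^sub>R x)) x) \<le> M * e powi (- int (length bs))" for x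
    proof -
      have "norm (pd bs (\<lambda>x. \<phi> (c e *\<^sub>R x)) x) = \<bar>c e\<bar> ^ length bs * norm (pd bs \<phi> (c e *\<^sub>R x))"
        by (simp add: pd_scale[OF \<phi> bs] power_abs)
      also have "\<dots> \<le> (1 / e) ^ length bs * M"
        using elim c[of e] by (intro mult_mono power_mono M) auto
      finally show ?thesis
        by (simp add: power_int_minus power_inverse divide_inverse mult.commute)
    qed
    then show ?case by blast
  qed
  from order_onI[OF this] show "\<exists>k. order_on K (\<lambda>e. pd bs (\<lambda>x. \<phi> (c e *\<^sub>R x))) k" ..
qed

context
  fixes \<rho> :: "'a::euclidean_space \<Rightarrow> complex" and \<kappa> :: "'a \<Rightarrow> real"
  assumes \<rho>: "mollifier \<rho>" and \<kappa>: "cutoff \<kappa>"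
begin

text \<open>A product of three moderate nets: the scalar \<open>1 / e ^ DIM('a)\<close>, the dilated
  \<open>\<rho>\<close> and the dilated \<open>\<kappa>\<close>. Derivatives are bounded globally by
  Schwartz decay for \<open>\<rho>\<close> and by compact support for
  \<open>\<kappa>\<close>.\<close>

lemma Theta_moderate: "Theta \<rho> \<kappa> \<in> moderate_nets UNIV"
proof -
  have \<rho>s: "\<rho> \<in> smooth_fns UNIV" and \<rho>d: "\<And>\<beta>. bounded (range (\<lambda>x. mi_monom (\<lambda>b. 0) x *\<^sub>R mi_deriv \<beta> \<rho> x))"
    using \<rho> by (auto simp: mollifier_def schwartz_fns_def)
  have 1: "(\<lambda>e x. \<rho> (inverse e *\<^sub>R x)) \<in> moderate_nets UNIV"
  proof (rule moderate_scale[OF \<rho>s])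
    fix bs :: "'a list" assume bs: "set bs \<subseteq> Basis"
    have "pd bs \<rho> x = mi_deriv (count_list bs) \<rho> x" for x
      unfolding mi_deriv_eq_pd
      by (rule pd_perm[OF \<rho>s open_UNIV mset_mi_list_count_list[OF bs, symmetric] bs UNIV_I])
    moreover have "mi_monom (\<lambda>b. 0) x = 1" for x :: 'a by (simp add: mi_monom_def)
    ultimately show "\<exists>B. \<forall>x. norm (pd bs \<rho> x) \<le> B"
      using \<rho>d[of "count_list bs"] by (auto simp: bounded_iff)
  qed (simp add: divide_inverse)
  have 2: "(\<lambda>e x. complex_of_real (1 / e ^ DIM('a))) \<in> moderate_nets (UNIV :: 'a set)"
  proof (rule moderate_netsI[OF open_UNIV])
    fix K :: "'a set" and bs :: "'a list"
    show "\<exists>k. order_on K (\<lambda>e. pd bs (\<lambda>x. complex_of_real (1 / e ^ DIM('a)))) k"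
    proof (cases bs rule: rev_cases)
      case Nil
      have "\<forall>\<^sub>F e in at_right 0. \<forall>x\<in>K. norm (complex_of_real (1 / e ^ DIM('a))) \<le> 1 * e powi (- int DIM('a))"
        using eventually_at_right_01
        by eventually_elim (simp add: power_int_minus norm_divide norm_power divide_inverse norm_inverse)
      from order_onI[OF this] show ?thesis unfolding Nil by auto
    next
      case (snoc cs c)
      have "pd bs (\<lambda>x. complex_of_real (1 / e ^ DIM('a))) = (\<lambda>x. 0)" for e
      proof -
        have "partial c (\<lambda>x. complex_of_real (1 / e ^ DIM('a))) = (\<lambda>x. 0)" by (rule ext) (simp add: partial_def)
        then have "pd bs (\<lambda>x. complex_of_real (1 / e ^ DIM('a))) = pd cs (\<lambda>x. 0)"
          by (simp only: snoc pd_append pd_Cons pd_Nil)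
        then show ?thesis by (rule trans) (rule ext, rule pd_zero)
      qed
      then show ?thesis using order_on_zero[of K] by auto
    qed
  qed (rule smooth_const)
  have \<kappa>s: "\<kappa> \<in> smooth_fns UNIV" using \<kappa> by (simp add: cutoff_def test_fns_def)
  have \<kappa>c: "(\<lambda>x. complex_of_real (\<kappa> x)) \<in> smooth_fns UNIV"
    by (rule smooth_linear[OF open_UNIV bounded_linear_of_real \<kappa>s])
  have 3: "(\<lambda>e x. complex_of_real (\<kappa> (\<bar>ln e\<bar> *\<^sub>R x))) \<in> moderate_nets UNIV"
  proof (rule moderate_scale[OF \<kappa>c])
    fix bs :: "'a list" assume bs: "set bs \<subseteq> Basis"
    let ?g = "pd bs (\<lambda>x. complex_of_real (\<kappa> x))"
    have "continuous_on (cball 0 2) ?g"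
      by (rule continuous_on_subset[OF smooth_continuous[OF smooth_pd[OF \<kappa>c bs]]]) simp
    then have "bounded (?g ` cball 0 2)" by (intro compact_imp_bounded compact_continuous_image compact_cball)
    then obtain M where M: "\<forall>x\<in>cball 0 2. norm (?g x) \<le> M" unfolding bounded_iff by blast
    then have "0 \<le> M" using order_trans[OF norm_ge_zero, of "?g 0" M] by simp
    have "?g x = 0" if "x \<notin> cball 0 2" for x
    proof -
      have "?g x = pd bs (\<lambda>x. 0) x"
        by (rule pd_cong[of "- cball 0 2"]) (use that \<kappa> in \<open>auto simp: cutoff_def\<close>)
      then show ?thesis by (simp add: pd_zero)
    qed
    then have "norm (?g x) \<le> M" for x using M \<open>0 \<le> M\<close> by (cases "x \<in> cball 0 2") auto
    then show "\<exists>B. \<forall>x. norm (?g x) \<le> B" by blast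
  next
    fix e :: real assume e: "0 < e" "e < 1"
    have "- ln e = ln (1 / e)" using e by (simp add: ln_div)
    also have "\<dots> \<le> 1 / e" using e by (intro less_imp_le ln_less_self) auto
    finally show "\<bar>\<bar>ln e\<bar>\<bar> \<le> 1 / e" using e by simp
  qed
  have "Theta \<rho> \<kappa> = (\<lambda>e x. complex_of_real (1 / e ^ DIM('a)) * \<rho> (inverse e *\<^sub>R x) * complex_of_real (\<kappa> (\<bar>ln e\<bar> *\<^sub>R x)))"
    by (simp add: Theta_def rho_eps_def fun_eq_iff scaleR_conv_of_real divide_inverse)
  then show ?thesis
    using moderate_mult[OF open_UNIV moderate_mult[OF open_UNIV 2 1] 3] by simp
qed

lemma smooth_Theta: "0 < e \<Longrightarrow> e \<le> 1 \<Longrightarrow> Theta \<rho> \<kappa> e \<in> smooth_fns UNIV"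
  by (rule moderate_smooth[OF open_UNIV Theta_moderate])

end

lemma order_on_classical_op:
  assumes XY: "open X" "open Y" and T: "T \<in> compact_distributions Y" and c: "controlled T Y K l C"
    and M: "\<And>e. 0 < e \<Longrightarrow> e < 1 \<Longrightarrow> M e \<in> smooth_fns (X \<times> Y)" and "A \<subseteq> X"
    and ord: "\<And>cs. set cs \<subseteq> Basis \<Longrightarrow> length cs \<le> l \<Longrightarrow> order_on (A \<times> K) (\<lambda>e. pd (map (Pair 0) cs) (M e)) k"
  shows "order_on A (\<lambda>e. classical_op (M e) T) k"
proof -
  let ?BS = "{cs :: 'b list. set cs \<subseteq> Basis \<and> length cs \<le> l}"
  have "\<forall>cs\<in>?BS. \<exists>D\<ge>0. \<forall>\<^sub>F e in at_right 0. \<forall>p\<in>A \<times> K. norm (pd (map (Pair 0) cs) (M e) p) \<le> D * e powi k"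
    using ord by (simp add: order_on_def)
  from bchoice[OF this] obtain D where D: "\<And>cs. cs \<in> ?BS \<Longrightarrow> 0 \<le> D cs"
    "\<And>cs. cs \<in> ?BS \<Longrightarrow> \<forall>\<^sub>F e in at_right 0. \<forall>p\<in>A \<times> K. norm (pd (map (Pair 0) cs) (M e) p) \<le> D cs * e powi k"
    by blast
  have "\<forall>\<^sub>F e in at_right 0. \<forall>cs\<in>?BS. \<forall>p\<in>A \<times> K. norm (pd (map (Pair 0) cs) (M e) p) \<le> D cs * e powi k"
    using D(2) by (intro eventually_ball_finite finite_basis_lists) blast
  then have "\<forall>\<^sub>F e in at_right 0. \<forall>x\<in>A. norm (classical_op (M e) T x) \<le> (C * sum D ?BS) * e powi k"
    using eventually_at_right_01
  proof eventually_elim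
    case (elim e)
    have p: "0 \<le> e powi k" using elim(2) by simp
    show ?case
    proof
      fix x assume x: "x \<in> A"
      have "norm (classical_op (M e) T x) \<le> C * (sum D ?BS * e powi k)"
      proof (rule norm_classical_op_le[OF XY T M c])
        show "x \<in> X" using x assms(6) by blast
        show "0 \<le> sum D ?BS * e powi k"
          by (rule mult_nonneg_nonneg[OF sum_nonneg p]) (rule D(1))
        fix cs :: "'b list" and y assume cs: "set cs \<subseteq> Basis" "length cs \<le> l" and "y \<in> K"
        then have "norm (pd (map (Pair 0) cs) (M e) (x, y)) \<le> D cs * e powi k" using elim(1) x by blast
        also have "\<dots> \<le> sum D ?BS * e powi k"
          using cs by (intro mult_right_mono[OF member_le_sum p] D(1) finite_basis_lists) auto
        finally show "norm (pd (map (Pair 0) cs) (M e) (x, y)) \<le> sum D ?BS * e powi k" .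
      qed (use elim(2) in auto)
      then show "norm (classical_op (M e) T x) \<le> (C * sum D ?BS) * e powi k" by (simp only: mult.assoc)
    qed
  qed
  then show ?thesis by (rule order_onI)
qed

section \<open>Truncation near the support and extension by zero\<close>

lemma eventually_abs_ln_ge: "\<forall>\<^sub>F e in at_right (0::real). c \<le> \<bar>ln e\<bar>"
proof -
  have "\<forall>\<^sub>F e in at_right (0::real). ln e \<le> - c"
    using ln_at_0 unfolding filterlim_at_bot by blast
  then show ?thesis by eventually_elim linarith
qed

text \<open>\<open>K\<close> keeps a distance \<open>\<delta>\<close> from the complement of
  \<open>Y\<close>. Points with more than half of that distance form a neighbourhood on which one
  threshold \<open>e0\<close> works for all smaller parameters at once.\<close>

lemma truncation_net_eq_1:
  assumes \<gamma>: "truncation_net Y \<gamma>" and "open Y" "compact K" "K \<subseteq> Y"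
  obtains e0 U where "0 < e0" "e0 \<le> 1" "open U" "K \<subseteq> U" "U \<subseteq> Y"
    "\<And>e x. 0 < e \<Longrightarrow> e \<le> e0 \<Longrightarrow> x \<in> U \<Longrightarrow> \<gamma> e x = 1"
proof -
  obtain R where R: "0 < R" "\<And>x. x \<in> K \<Longrightarrow> norm x < R"
    using compact_imp_bounded[OF assms(3)] unfolding bounded_pos_less by blast
  obtain \<delta> where \<delta>: "0 < \<delta>" "\<And>x y. x \<in> K \<Longrightarrow> y \<in> - Y \<Longrightarrow> \<delta> \<le> dist x y"
    using separate_compact_closed[OF assms(3), of "- Y"] assms by (metis closed_Compl disjoint_eq_subset_Compl double_complement)
  \<comment> \<open>For \<open>- Y = {}\<close> the condition on \<open>infdist\<close> would be
    false everywhere, since the distance to the empty set is \<open>0\<close> by convention.\<close>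
  define U where "U = (if - Y = {} then ball 0 R else Y \<inter> {x. \<delta> / 2 < infdist x (- Y)} \<inter> ball 0 R)"
  define e0 where "e0 = Min {1, \<delta> / 2, 1 / R}"
  have e0: "0 < e0" "e0 \<le> 1" "e0 \<le> \<delta> / 2" "e0 \<le> 1 / R" using \<delta> R by (auto simp: e0_def)
  have "open {x. \<delta> / 2 < infdist x (- Y)}"
    by (intro open_Collect_less continuous_intros)
  then have "open U" using assms(2) by (auto simp: U_def)
  moreover have "K \<subseteq> U"
  proof
    fix x assume x: "x \<in> K"
    have "\<delta> \<le> infdist x (- Y)" if "- Y \<noteq> {}"
      unfolding infdist_notempty[OF that] using that \<delta>(2)[OF x] by (intro cINF_greatest) auto
    then have "\<delta> / 2 < infdist x (- Y)" if "- Y \<noteq> {}" using that \<delta>(1) by fastforce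
    moreover have "x \<in> ball 0 R" "x \<in> Y" using x R(2)[OF x] assms(4) by auto
    ultimately show "x \<in> U" unfolding U_def by simp
  qed
  moreover have "U \<subseteq> Y" by (auto simp: U_def)
  moreover have "\<gamma> e x = 1" if "0 < e" "e \<le> e0" "x \<in> U" for e x
  proof -
    have "x \<in> Y" using \<open>U \<subseteq> Y\<close> that by auto
    moreover have "norm x \<le> 1 / e"
    proof -
      have "norm x \<le> R" using that(3) by (auto simp: U_def split: if_splits)
      also have "R \<le> 1 / e" using that(1,2) e0(4) R(1) by (simp add: field_simps) (metis mult.commute mult_left_mono order_trans less_imp_le)
      finally show ?thesis .
    qed
    moreover have "- Y = {} \<or> e \<le> infdist x (- Y)" using that e0 by (auto simp: U_def split: if_splits)
    ultimately show ?thesis using \<gamma> that e0 unfolding truncation_net_def by auto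
  qed
  ultimately show ?thesis using e0 that by blast
qed

lemma null_nets_mono: "u \<in> null_nets \<Omega> \<Longrightarrow> V \<subseteq> \<Omega> \<Longrightarrow> u \<in> null_nets V"
  unfolding null_nets_def by (blast intro: smooth_mono)

text \<open>\<open>h\<close> is arbitrary off \<open>X \<times> Y\<close>, but there the product
  vanishes. It is smooth on \<open>X \<times> Y\<close> and zero off the support of
  \<open>\<eta>\<close>, and these two open sets cover \<open>X \<times> UNIV\<close>.\<close>

lemma smooth_mult_cutoff:
  fixes X :: "'a::euclidean_space set" and Y :: "'b::euclidean_space set" and \<eta> :: "'b \<Rightarrow> real"
  assumes XY: "open X" "open Y" and h: "h \<in> smooth_fns (X \<times> Y)" and \<eta>: "\<eta> \<in> test_fns Y"
  shows "(\<lambda>p. h p * complex_of_real (\<eta> (snd p))) \<in> smooth_fns (X \<times> UNIV)" (is "?H \<in> _")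
proof -
  let ?S = "closure {x. \<eta> x \<noteq> 0}"
  have \<eta>s: "\<eta> \<in> smooth_fns UNIV" and sub: "?S \<subseteq> Y" using \<eta> by (auto simp: test_fns_def)
  have "(\<lambda>p. complex_of_real (\<eta> (snd p))) \<in> smooth_fns (X \<times> Y)"
    by (rule smooth_affine[where A = "snd :: 'a \<times> 'b \<Rightarrow> 'b" and L = snd, OF _ open_Times[OF XY] UNIV_I
          smooth_linear[OF open_UNIV bounded_linear_of_real \<eta>s]])
      (auto intro!: derivative_eq_intros)
  then have 1: "?H \<in> smooth_fns (X \<times> Y)" by (rule smooth_mult[OF open_Times[OF XY] h])
  have op: "open (X \<times> - ?S)" by (intro open_Times XY) auto
  have 2: "?H \<in> smooth_fns (X \<times> - ?S)"
  proof (rule smooth_cong[OF smooth_const[of 0] op])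
    fix p assume "p \<in> X \<times> - ?S"
    then have "\<eta> (snd p) = 0" using closure_subset[of "{x. \<eta> x \<noteq> 0}"] by auto
    then show "0 = h p * complex_of_real (\<eta> (snd p))" by simp
  qed
  have "X \<times> Y \<union> X \<times> - ?S = X \<times> UNIV" using sub by auto
  then show ?thesis using smooth_Un[OF open_Times[OF XY] op 1 2] by simp
qed

text \<open>Collects one distribution with the data of its continuity estimate and a neighbourhood
  \<open>U\<close> of \<open>K\<close> on which the truncation is inactive below
  \<open>e0\<close>.\<close>

locale embedding =
  fixes Y :: "'b::euclidean_space set" and \<rho> :: "'b \<Rightarrow> complex" and \<kappa> :: "'b \<Rightarrow> real"
    and \<gamma> :: "real \<Rightarrow> 'b \<Rightarrow> real" and T K l C e0 U
  assumes Y: "open Y" and \<rho>: "mollifier \<rho>" and \<kappa>: "cutoff \<kappa>" and \<gamma>: "truncation_net Y \<gamma>"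
    and T: "T \<in> compact_distributions Y" and c: "controlled T Y K l C"
    and e0: "0 < e0" "e0 \<le> 1" and U: "open U" "K \<subseteq> U" "U \<subseteq> Y"
    and \<gamma>1: "\<And>e x. 0 < e \<Longrightarrow> e \<le> e0 \<Longrightarrow> x \<in> U \<Longrightarrow> \<gamma> e x = 1"
begin

abbreviation "\<Theta> \<equiv> Theta \<rho> \<kappa>"

definition w :: "'b net" where
  "w e = conv_distr (mult_distr (\<gamma> e) T) (\<Theta> e)"

lemma w_eq: "w e y = T (\<lambda>z. complex_of_real (\<gamma> e z) * \<Theta> e (y - z))"
  by (simp add: w_def conv_distr_def mult_distr_def)

lemma K: "compact K" "K \<subseteq> Y" "0 \<le> C" using c by (auto simp: controlled_def)

lemma smooth_Theta_diff: 
  assumes "0 < e" "e \<le> 1"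
  shows "(\<lambda>p. \<Theta> e (fst p - snd p)) \<in> smooth_fns UNIV"
  by (rule smooth_affine[where A = "\<lambda>p. fst p - snd p" and L = "\<lambda>p. fst p - snd p",
        OF _ open_UNIV UNIV_I smooth_Theta[OF \<rho> \<kappa> assms]])
    (auto intro!: derivative_eq_intros)

lemma smooth_gamma: "0 < e \<Longrightarrow> e \<le> 1 \<Longrightarrow> (\<lambda>z. complex_of_real (\<gamma> e z)) \<in> smooth_fns UNIV"
  using \<gamma> by (intro smooth_linear[OF open_UNIV bounded_linear_of_real]) (auto simp: truncation_net_def test_fns_def)

lemma smooth_kernel:
  assumes "0 < e" "e \<le> 1"
  shows "(\<lambda>p. complex_of_real (\<gamma> e (snd p)) * \<Theta> e (fst p - snd p)) \<in> smooth_fns (UNIV \<times> Y)"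
proof -
  have "(\<lambda>p :: 'b \<times> 'b. complex_of_real (\<gamma> e (snd p))) \<in> smooth_fns UNIV"
    by (rule smooth_affine[where A = snd and L = snd, OF _ open_UNIV UNIV_I smooth_gamma[OF assms]])
      (auto intro!: derivative_eq_intros)
  from smooth_mult[OF open_UNIV this smooth_Theta_diff[OF assms]] show ?thesis
    by (rule smooth_mono) simp
qed

lemma w_classical_op: "w e = classical_op (\<lambda>p. complex_of_real (\<gamma> e (snd p)) * \<Theta> e (fst p - snd p)) T"
  by (simp add: fun_eq_iff w_eq classical_op_def)

lemma smooth_w: "0 < e \<Longrightarrow> e \<le> 1 \<Longrightarrow> w e \<in> smooth_fns UNIV"
  unfolding w_classical_op by (rule smooth_classical_op[OF open_UNIV Y T smooth_kernel])

text \<open>\<open>truncation_net\<close> says nothing about the growth of the derivatives of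
  \<open>\<gamma> e\<close> as \<open>e\<close> tends to \<open>0\<close>. Since
  \<open>\<gamma> e = 1\<close> on a neighbourhood of \<open>K\<close>, the factor can be removed by
  locality of \<open>T\<close> before any estimate is made.\<close>

lemma w_eq_small:
  assumes "0 < e" "e \<le> e0"
  shows "w e y = T (\<lambda>z. \<Theta> e (y - z))"
proof -
  have e: "0 < e" "e \<le> 1" using assms e0 by auto
  have *: "(\<lambda>p. \<Theta> e (fst p - snd p)) \<in> smooth_fns (UNIV \<times> Y)"
    by (rule smooth_mono[OF smooth_Theta_diff[OF e]]) simp
  show ?thesis
    unfolding w_eq
    by (rule distr_local[OF Y T c _ _ U(1,2)])
      (use smooth_slice(1)[OF open_UNIV Y smooth_kernel[OF e] UNIV_I, of y]
          smooth_slice(1)[OF open_UNIV Y * UNIV_I, of y] \<gamma>1[OF assms] in auto)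
qed

lemma w_moderate: "w \<in> moderate_nets Y"
proof (rule moderate_netsI[OF Y])
  show "w e \<in> smooth_fns Y" if "0 < e" "e \<le> 1" for e by (rule smooth_mono[OF smooth_w[OF that]]) simp
  fix A :: "'b set" and bs :: "'b list" assume A: "compact A" "A \<subseteq> Y" and bs: "set bs \<subseteq> Basis"
  define M where "M e p = \<Theta> e (fst p - snd p)" for e and p :: "'b \<times> 'b"
  have M: "M \<in> moderate_nets UNIV"
    unfolding M_def[abs_def]
    by (rule moderate_affine[where A = "\<lambda>p. fst p - snd p" and L = "\<lambda>p. fst p - snd p", OF _ Theta_moderate[OF \<rho> \<kappa>]])
      (auto intro!: derivative_eq_intros)
  have Ms: "M e \<in> smooth_fns (UNIV \<times> Y)" if "0 < e" "e \<le> 1" for e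
    by (rule smooth_mono[OF moderate_smooth[OF open_UNIV M that]]) simp
  let ?bs = "map (\<lambda>b. (b, 0)) bs :: ('b \<times> 'b) list"
  have bs': "set ?bs \<subseteq> Basis" using bs by (auto intro: Pair_Basis)
  let ?BS = "{cs :: 'b list. set cs \<subseteq> Basis \<and> length cs \<le> l}"
  have "\<exists>k. order_on (A \<times> K) (\<lambda>e. pd (map (Pair 0) cs) (pd ?bs (M e))) k" if cs: "cs \<in> ?BS" for cs
  proof -
    obtain k where "order_on (A \<times> K) (\<lambda>e. pd (map (Pair 0) cs @ ?bs) (M e)) k"
      by (rule moderate_order[OF open_UNIV M compact_Times[OF A(1) K(1)], of "map (Pair 0) cs @ ?bs"])
        (use bs cs in \<open>auto intro: Pair_Basis\<close>)
    then show ?thesis unfolding pd_append by blast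
  qed
  from finite_common_order[where u = "\<lambda>cs e. pd (map (Pair 0) cs) (pd ?bs (M e))", OF finite_basis_lists this]
  obtain k where k: "\<And>cs. cs \<in> ?BS \<Longrightarrow> order_on (A \<times> K) (\<lambda>e. pd (map (Pair 0) cs) (pd ?bs (M e))) k"
    by blast
  have ord: "order_on A (\<lambda>e. classical_op (pd ?bs (M e)) T) k"
    by (rule order_on_classical_op[OF open_UNIV Y T c smooth_pd[OF Ms bs'] subset_UNIV]) (use k in auto)
  have "\<forall>\<^sub>F e in at_right 0. \<forall>x\<in>A. norm (pd bs (w e) x) \<le> norm (classical_op (pd ?bs (M e)) T x)"
    using eventually_at_right_real[OF e0(1)]
  proof eventually_elim
    case (elim e)
    then have e: "0 < e" "e \<le> e0" "e \<le> 1" using e0 by auto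
    have "w e = classical_op (M e) T"
      by (simp add: fun_eq_iff w_eq_small[OF e(1,2)] classical_op_def M_def)
    then show ?case
      using pd_classical_op[OF open_UNIV Y T Ms[OF e(1,3)] UNIV_I bs] by simp
  qed
  from order_on_dominated[OF ord this] show "\<exists>k. order_on A (\<lambda>e. pd bs (w e)) k" ..
qed

text \<open>\<open>\<Theta> e\<close> vanishes beyond radius \<open>2 / \<bar>ln e\<bar>\<close>,
  which is at most \<open>\<delta> / 2\<close> once
  \<open>\<bar>ln e\<bar> \<ge> 4 / \<delta>\<close>. The other half of \<open>\<delta>\<close>
  leaves room for a neighbourhood of \<open>K\<close> on which the kernel is zero, as
  \<open>distr_local\<close> demands. The threshold does not depend on \<open>y\<close>.\<close>

lemma w_eventually_zero:
  assumes "0 < \<delta>"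
  shows "\<forall>\<^sub>F e in at_right 0. \<forall>y. (\<forall>z\<in>K. \<delta> \<le> dist y z) \<longrightarrow> w e y = 0"
  using eventually_at_right_01 eventually_abs_ln_ge[of "4 / \<delta>"]
proof eventually_elim
  case (elim e)
  then have e: "0 < e" "e \<le> 1" by auto
  show ?case
  proof (intro allI impI)
    fix y assume y: "\<forall>z\<in>K. \<delta> \<le> dist y z"
    have "T (\<lambda>z. complex_of_real (\<gamma> e z) * \<Theta> e (y - z)) = T (\<lambda>z. 0)"
    proof (rule distr_local[OF Y T c])
      show "(\<lambda>z. complex_of_real (\<gamma> e z) * \<Theta> e (y - z)) \<in> smooth_fns Y"
        using smooth_slice(1)[OF open_UNIV Y smooth_kernel[OF e] UNIV_I, of y] by simp
      show "open (\<Union>z\<in>K. ball z (\<delta> / 2))" by auto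
      show "K \<subseteq> (\<Union>z\<in>K. ball z (\<delta> / 2))" using assms by auto
      fix z assume "z \<in> (\<Union>z\<in>K. ball z (\<delta> / 2))"
      then obtain z' where z': "z' \<in> K" "dist z' z < \<delta> / 2" by auto
      have "\<delta> \<le> dist y z + dist z z'" using y z'(1) dist_triangle[of y z' z] by fastforce
      then have n: "\<delta> / 2 \<le> norm (y - z)" using z'(2) by (simp add: dist_commute dist_norm)
      have "4 / \<delta> * (\<delta> / 2) \<le> \<bar>ln e\<bar> * norm (y - z)" using elim(2) n assms by (intro mult_mono) auto
      then have "2 \<le> \<bar>ln e\<bar> * norm (y - z)" using assms by simp
      then show "complex_of_real (\<gamma> e z) * \<Theta> e (y - z) = 0" by (simp add: Theta_eq_0[OF \<rho> \<kappa>])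
    qed (rule smooth_const)
    then show "w e y = 0" by (simp add: w_eq distr_zero[OF Y T])
  qed
qed

lemma w_null_off_support: "w \<in> null_nets (Y - K)"
proof -
  have V: "open (Y - K)" using Y K by (simp add: open_Diff compact_imp_closed)
  show ?thesis
  proof (rule null_netsI[OF V])
    show "w e \<in> smooth_fns (Y - K)" if "0 < e" "e \<le> 1" for e by (rule smooth_mono[OF smooth_w[OF that]]) simp
    fix A :: "'b set" and bs :: "'b list" and k
    assume A: "compact A" "A \<subseteq> Y - K"
    obtain \<delta> where \<delta>: "0 < \<delta>" "\<And>x z. x \<in> A \<Longrightarrow> z \<in> K \<Longrightarrow> \<delta> \<le> dist x z"
      using separate_compact_closed[OF A(1) compact_imp_closed[OF K(1)]] A(2) by blast
    \<comment> \<open>Vanishing is needed on an open neighbourhood of \<open>A\<close> in order to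
      kill the derivatives; half of the distance to \<open>K\<close> is left there.\<close>
    let ?O = "\<Union>x\<in>A. ball x (\<delta> / 2)"
    have O: "open ?O" by auto
    have far: "\<delta> / 2 \<le> dist y z" if y: "y \<in> ?O" and z: "z \<in> K" for y z
    proof -
      obtain x where x: "x \<in> A" "dist x y < \<delta> / 2" using y by auto
      then show ?thesis using \<delta>(2)[OF x(1) z] dist_triangle[of x z y] by linarith
    qed
    have "\<forall>\<^sub>F e in at_right 0. \<forall>x\<in>A. norm (pd bs (w e) x) \<le> 0 * e powi k"
      using w_eventually_zero[OF half_gt_zero[OF \<delta>(1)]]
    proof eventually_elim
      case (elim e)
      have "pd bs (w e) x = 0" if "x \<in> A" for x
      proof -
        have "x \<in> ?O" using that \<delta>(1) by (intro UN_I[of x]) auto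
        from pd_cong[OF O _ this, of "w e" "\<lambda>y. 0" bs] show ?thesis using elim far by (simp add: pd_zero)
      qed
      then show ?case by simp
    qed
    then show "order_on A (\<lambda>e. pd bs (w e)) k" by (rule order_onI)
  qed
qed

lemma i_S_eq: "i_S Y \<rho> \<kappa> \<gamma> T = Cl Y w"
  unfolding i_S_def w_def[abs_def] ..

lemma i_S_in_gen_fns_C: "i_S Y \<rho> \<kappa> \<gamma> T \<in> gen_fns_C Y"
proof -
  have V: "open (Y - K)" using Y K by (simp add: open_Diff compact_imp_closed)
  have "Cl Y w \<in> gen_fns Y" unfolding Cl_def gen_fns_def by (rule quotientI[OF w_moderate])
  moreover have "Cl Y w \<subseteq> null_nets (Y - K)"
  proof
    fix v assume "v \<in> Cl Y w"
    then have "(\<lambda>e x. w e x - v e x) \<in> null_nets Y" by (auto simp: Cl_def net_rel_def)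
    then have "(\<lambda>e x. w e x - v e x) \<in> null_nets (Y - K)" by (rule null_nets_mono) auto
    from null_add[OF V w_null_off_support null_minus[OF V this]] show "v \<in> null_nets (Y - K)" by simp
  qed
  then have "gen_support Y (Cl Y w) \<subseteq> K" using V by (auto simp: gen_support_def)
  \<comment> \<open>The definition shows only relative closedness in \<open>Y\<close>; cutting with
    the compact \<open>K\<close> instead of \<open>Y\<close> gives a compact set.\<close>
  then have "gen_support Y (Cl Y w) = K \<inter> - \<Union>{V. open V \<and> V \<subseteq> Y \<and> Cl Y w \<subseteq> null_nets V}"
    using K(2) unfolding gen_support_def by blast
  moreover have "closed (- \<Union>{V. open V \<and> V \<subseteq> Y \<and> Cl Y w \<subseteq> null_nets V})"
    by (intro closed_Compl open_Union) auto
  ultimately show ?thesis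
    using K(1) by (simp add: i_S_eq gen_fns_C_def compact_Int_closed)
qed

text \<open>A member of the truncation net serves as the bump function that is \<open>1\<close> near the support of \<open>T\<close>.\<close>

definition "\<eta> = \<gamma> e0"

definition f0 :: "'b net" where "f0 e y = complex_of_real (\<eta> y) * w e y"

definition "L = closure {x. \<eta> x \<noteq> 0}"

lemma eta: "\<eta> \<in> test_fns Y" "\<And>x. x \<in> U \<Longrightarrow> \<eta> x = 1"
  using \<gamma> e0 \<gamma>1 by (auto simp: \<eta>_def truncation_net_def)

lemma L: "compact L" "L \<subseteq> Y" "\<And>x. x \<notin> L \<Longrightarrow> \<eta> x = 0"
  using eta(1) closure_subset[of "{x. \<eta> x \<noteq> 0}"] by (auto simp: test_fns_def L_def)

lemma f0_diff_null: "(\<lambda>e y. w e y - f0 e y) \<in> null_nets Y"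
proof (rule null_netsI[OF Y])
  have "(\<lambda>y. complex_of_real (\<eta> y)) \<in> smooth_fns UNIV" unfolding \<eta>_def by (rule smooth_gamma[OF e0])
  then show "(\<lambda>y. w e y - f0 e y) \<in> smooth_fns Y" if "0 < e" "e \<le> 1" for e
    unfolding f0_def
    by (intro smooth_mono[OF smooth_diff[OF open_UNIV smooth_w[OF that] smooth_mult[OF open_UNIV _ smooth_w[OF that]]]]) auto
  fix A :: "'b set" and bs :: "'b list" and k
  obtain \<delta> where \<delta>: "0 < \<delta>" "\<And>z y. z \<in> K \<Longrightarrow> y \<in> - U \<Longrightarrow> \<delta> \<le> dist z y"
    using separate_compact_closed[OF K(1), of "- U"] U(1,2) by (metis closed_Compl disjoint_eq_subset_Compl double_complement)
  have "\<forall>\<^sub>F e in at_right 0. \<forall>x\<in>A. norm (pd bs (\<lambda>y. w e y - f0 e y) x) \<le> 0 * e powi k"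
    using w_eventually_zero[OF \<delta>(1)]
  proof eventually_elim
    case (elim e)
    have "w e y - f0 e y = 0" for y
    proof (cases "y \<in> U")
      case True
      then show ?thesis by (simp add: f0_def eta(2))
    next
      case False
      then have "w e y = 0" using elim \<delta>(2) by (simp add: dist_commute)
      then show ?thesis by (simp add: f0_def)
    qed
    then have "(\<lambda>y. w e y - f0 e y) = (\<lambda>y. 0)" by (rule ext)
    then show ?case by (simp add: pd_zero)
  qed
  then show "order_on A (\<lambda>e. pd bs (\<lambda>y. w e y - f0 e y)) k" by (rule order_onI)
qed

lemma f0_moderate: "f0 \<in> moderate_nets Y"
  using moderate_add[OF Y w_moderate null_imp_moderate[OF Y null_minus[OF Y f0_diff_null]]] by simp

lemma f0_in_i_S: "f0 \<in> i_S Y \<rho> \<kappa> \<gamma> T"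
  using w_moderate f0_moderate f0_diff_null by (simp add: i_S_eq Cl_def net_rel_def)

end

section \<open>Regularised kernels\<close>

context embedding
begin

context
  fixes X :: "'a::euclidean_space set" and H :: "'a \<times> 'b \<Rightarrow> complex"
  assumes X: "open X" and H: "H \<in> smooth_fns (X \<times> UNIV)"
begin

text \<open>The kernel regularized in its second variable. A fixed ball makes this an integral over
  a compact set for every \<open>e\<close>; once \<open>2 \<le> \<bar>ln e\<bar>\<close> it contains
  the support of \<open>\<Theta> e\<close>.\<close>

definition J :: "('a \<times> 'b) net" where
  "J e p = (LINT y:cball 0 1|lborel. H (fst p, snd p + y) * \<Theta> e y)"

lemma opX: "open (X \<times> (UNIV :: 'b set))" by (rule open_Times[OF X open_UNIV])

text \<open>Integration against \<open>\<Theta> e\<close> over the ball is a distribution in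
  \<open>y\<close> with parameter \<open>p\<close>, so this is an instance of the lemmas on
  \<open>classical_op\<close>.\<close>

lemma
  assumes e: "0 < e" "e \<le> 1"
  shows smooth_J: "J e \<in> smooth_fns (X \<times> UNIV)"
    and pd_J: "p \<in> X \<times> UNIV \<Longrightarrow> set ds \<subseteq> Basis \<Longrightarrow>
      pd ds (J e) p = (LINT y:cball 0 1|lborel. pd ds H (fst p, snd p + y) * \<Theta> e y)"
proof -
  define W where "W = (\<lambda>\<phi>. LINT y:cball 0 1|lborel. \<phi> y * \<Theta> e y)"
  let ?A = "\<lambda>q :: ('a \<times> 'b) \<times> 'b. (fst (fst q), snd (fst q) + snd q)"
  let ?H = "\<lambda>q. H (?A q)"
  have A: "(?A has_derivative ?A) (at q)" for q by (auto intro!: derivative_eq_intros)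
  have W: "W \<in> compact_distributions UNIV"
    unfolding W_def
    by (rule set_integral_distribution[OF compact_cball subset_UNIV open_UNIV
          continuous_on_subset[OF smooth_continuous[OF smooth_Theta[OF \<rho> \<kappa> e]] subset_UNIV]])
  have op: "open ((X \<times> (UNIV :: 'b set)) \<times> (UNIV :: 'b set))" by (intro open_Times X open_UNIV)
  have Hs: "?H \<in> smooth_fns ((X \<times> UNIV) \<times> UNIV)"
    by (rule smooth_affine[OF A op _ H]) auto
  have J: "J e = classical_op ?H W"
    by (simp add: fun_eq_iff J_def classical_op_def W_def)
  show "J e \<in> smooth_fns (X \<times> UNIV)"
    unfolding J by (rule smooth_classical_op[OF opX open_UNIV W Hs])
  assume p: "p \<in> X \<times> UNIV" and ds: "set ds \<subseteq> Basis"
  have "pd ds (J e) p = (LINT y:cball 0 1|lborel. pd (map (\<lambda>b. (b, 0)) ds) ?H (p, y) * \<Theta> e y)"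
    unfolding J pd_classical_op[OF opX open_UNIV W Hs p ds] by (simp add: classical_op_def W_def)
  also have "\<dots> = (LINT y:cball 0 1|lborel. pd ds H (fst p, snd p + y) * \<Theta> e y)"
  proof -
    have "pd (map (\<lambda>b. (b, 0)) ds) ?H (p, y) = pd (map ?A (map (\<lambda>b. (b, 0)) ds)) H (?A (p, y))" for y
      by (rule pd_affine[OF A op _ H]) (use p ds in auto)
    then show ?thesis by (simp add: comp_def)
  qed
  finally show "pd ds (J e) p = (LINT y:cball 0 1|lborel. pd ds H (fst p, snd p + y) * \<Theta> e y)" .
qed

text \<open>By \<open>pd_J\<close> the differentiated difference is the approximation error of
  \<open>\<Theta>\<close> for slices of \<open>pd ds H\<close>, so \<open>Theta_approx\<close>
  applies with a bound that is uniform in \<open>p\<close>.\<close>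

lemma J_order:
  assumes A: "compact A" "A \<subseteq> X" and ds: "set ds \<subseteq> Basis"
  shows "order_on (A \<times> K) (\<lambda>e. pd ds (\<lambda>p. J e p - H p)) k"
proof -
  \<comment> \<open>\<open>Theta_approx\<close> needs a positive order, and \<open>nat\<close> sends
    a negative \<open>k\<close> to \<open>0\<close>.\<close>
  define N where "N = max 1 (nat k)"
  \<comment> \<open>Regularizing at a point of \<open>K\<close> involves \<open>H\<close> up to
    distance \<open>1\<close> from it. This set may leave \<open>Y\<close>, which is why
    \<open>H\<close> has to be smooth on \<open>X \<times> UNIV\<close>.\<close>
  let ?S = "{z + y | z y. z \<in> K \<and> y \<in> cball (0::'b) 1}"
  have AS: "compact (A \<times> ?S)" "A \<times> ?S \<subseteq> X \<times> UNIV"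
    by (rule compact_Times[OF A(1) compact_sums[OF K(1) compact_cball]]) (use A(2) in auto)
  let ?g = "pd ds H"
  have g: "?g \<in> smooth_fns (X \<times> UNIV)" by (rule smooth_pd[OF H ds])
  define B where "B = seminorm (A \<times> ?S) N ?g"
  have "\<forall>\<^sub>F e in at_right 0. \<forall>p\<in>A \<times> K. norm (pd ds (\<lambda>p. J e p - H p) p) \<le> (B * approx_const \<rho> N) * e powi (int N)"
    using eventually_at_right_01 eventually_abs_ln_ge[of 2]
  proof eventually_elim
    case (elim e)
    then have e: "0 < e" "e < 1" "e \<le> 1" by auto
    show ?case
    proof
      fix p assume p: "p \<in> A \<times> K"
      then have pX: "p \<in> X \<times> UNIV" "fst p \<in> X" "fst p \<in> A" "snd p \<in> K" using A by auto
      let ?f = "\<lambda>z. ?g (fst p, z)"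
      have f: "?f \<in> smooth_fns UNIV" by (rule smooth_slice(1)[OF X open_UNIV g pX(2)])
      have "norm ((LINT y:cball 0 1|lborel. ?f (snd p + y) * \<Theta> e y) - ?f (snd p)) \<le> B * approx_const \<rho> N * e ^ N"
      proof (rule Theta_approx[OF \<rho> \<kappa> e(1,2) elim(2) f])
        show "0 < N" by (simp add: N_def)
        fix cs :: "'b list" and y assume cs: "set cs \<subseteq> Basis" "length cs \<le> N" and y: "y \<in> cball (snd p) 1"
        have "pd cs ?f y = pd (map (Pair 0) cs) ?g (fst p, y)"
          by (rule pd_slice(1)[OF X open_UNIV g pX(2) UNIV_I cs(1)])
        also have "norm \<dots> \<le> B"
          unfolding B_def
        proof (rule pd_le_seminorm[OF g opX AS])
          have "y = snd p + (y - snd p)" "y - snd p \<in> cball 0 1"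
            using y by (auto simp: dist_norm norm_minus_commute)
          then show "(fst p, y) \<in> A \<times> ?S" using pX by blast
        qed (use cs in \<open>auto intro: Pair_Basis\<close>)
        finally show "norm (pd cs ?f y) \<le> B" .
      qed
      moreover have "pd ds (\<lambda>p. J e p - H p) p = (LINT y:cball 0 1|lborel. ?f (snd p + y) * \<Theta> e y) - ?f (snd p)"
        using pd_diff[OF opX smooth_J[OF e(1,3)] H ds pX(1)] pd_J[OF e(1,3) pX(1) ds] by simp
      ultimately show "norm (pd ds (\<lambda>p. J e p - H p) p) \<le> (B * approx_const \<rho> N) * e powi (int N)"
        by (simp only: power_int_of_nat)
    qed
  qed
  then have "order_on (A \<times> K) (\<lambda>e. pd ds (\<lambda>p. J e p - H p)) (int N)" by (rule order_onI)
  then show ?thesis by (rule order_on_mono) (simp add: N_def)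
qed

text \<open>After the exchange of \<open>T\<close> with the integral, the support condition allows
  integration over the whole space; the translation \<open>y \<mapsto> z + y\<close> then moves the
  shift from \<open>\<Theta>\<close> to \<open>H\<close>.\<close>

lemma integral_w_eq:
  assumes e: "0 < e" "e \<le> e0" "2 \<le> \<bar>ln e\<bar>" and x: "x \<in> X"
    and supp: "\<And>y. y \<notin> cbox a b \<Longrightarrow> H (x, y) = 0"
  shows "(LINT y:cbox a b|lborel. H (x, y) * w e y) = T (\<lambda>z. J e (x, z))"
proof -
  have e1: "e \<le> 1" using e e0 by simp
  let ?F = "\<lambda>p. H (x, fst p) * \<Theta> e (fst p - snd p)"
  have Hx: "(\<lambda>y. H (x, y)) \<in> smooth_fns UNIV" by (rule smooth_slice(1)[OF X open_UNIV H x])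
  have "(\<lambda>p :: 'b \<times> 'b. H (x, fst p)) \<in> smooth_fns UNIV"
    by (rule smooth_affine[where A = fst and L = fst, OF _ open_UNIV UNIV_I Hx])
      (auto intro!: derivative_eq_intros)
  from smooth_mult[OF open_UNIV this smooth_Theta_diff[OF e(1) e1]]
  have F: "?F \<in> smooth_fns (UNIV \<times> Y)" by (rule smooth_mono) simp
  have D: "(\<lambda>p. \<Theta> e (fst p - snd p)) \<in> smooth_fns (UNIV \<times> Y)"
    by (rule smooth_mono[OF smooth_Theta_diff[OF e(1) e1]]) simp
  have "T (\<lambda>z. H (x, y) * \<Theta> e (y - z)) = H (x, y) * w e y" for y
    using distr_cmult[OF Y T smooth_slice(1)[OF open_UNIV Y D UNIV_I, of y]] by (simp add: w_eq_small[OF e(1,2)])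
  then have "(LINT y:cbox a b|lborel. H (x, y) * w e y) = (LINT y:cbox a b|lborel. T (\<lambda>z. ?F (y, z)))" by simp
  also have "\<dots> = T (\<lambda>z. LINT y:cbox a b|lborel. ?F (y, z))"
    by (rule distribution_integral_swap[OF Y T F, symmetric])
  also have "(\<lambda>z. LINT y:cbox a b|lborel. ?F (y, z)) = (\<lambda>z. J e (x, z))"
  proof
    fix z
    let ?g = "\<lambda>y. H (x, y) * \<Theta> e (y - z)"
    have "continuous_on UNIV ?g"
      by (intro continuous_on_mult smooth_continuous[OF Hx]
          continuous_on_compose2[OF smooth_continuous[OF smooth_Theta[OF \<rho> \<kappa> e(1) e1]]]
          continuous_intros) auto
    then have m: "?g \<in> borel_measurable borel" by (rule borel_measurable_continuous_onI)
    have "(LINT y:cbox a b|lborel. ?F (y, z)) = (LINT y|lborel. ?g y)"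
      unfolding set_lebesgue_integral_def
      by (rule Bochner_Integration.integral_cong) (use supp in \<open>auto simp: indicator_def\<close>)
    also have "\<dots> = (LINT y|distr lborel borel ((+) z). ?g y)" by (simp only: lborel_distr_plus)
    also have "\<dots> = (LINT y|lborel. ?g (z + y))" by (rule integral_distr) (use m in auto)
    also have "\<dots> = J e (x, z)"
      unfolding J_def set_lebesgue_integral_def
    proof (rule Bochner_Integration.integral_cong)
      fix y :: 'b
      have "\<Theta> e y = 0" if "y \<notin> cball 0 1"
      proof (rule Theta_eq_0[OF \<rho> \<kappa>])
        have "2 * 1 \<le> \<bar>ln e\<bar> * norm y" using that e(3) by (intro mult_mono) auto
        then show "2 \<le> \<bar>ln e\<bar> * norm y" by simp
      qed
      then show "?g (z + y) = indicator (cball 0 1) y *\<^sub>R (H (fst (x, z), snd (x, z) + y) * \<Theta> e y)"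
        by (auto simp: indicator_def)
    qed simp
    finally show "(LINT y:cbox a b|lborel. ?F (y, z)) = J e (x, z)" .
  qed
  finally show ?thesis .
qed

end

section \<open>The cut-off kernel and the generalized operator\<close>

context
  fixes X :: "'a::euclidean_space set" and h :: "'a \<times> 'b \<Rightarrow> complex"
  assumes X: "open X" and h: "h \<in> smooth_fns (X \<times> Y)"
begin

abbreviation "H \<equiv> \<lambda>p. h p * complex_of_real (\<eta> (snd p))"

lemma H: "H \<in> smooth_fns (X \<times> UNIV)"
  by (rule smooth_mult_cutoff[OF X Y h eta(1)])

text \<open>For small \<open>e\<close> and \<open>x \<in> X\<close> the difference is
  \<open>T\<close> applied to \<open>J H e - H\<close> in the second variable. Its
  \<open>x\<close>-derivatives pass to the kernel, and \<open>J_order\<close> gives arbitrary decay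
  on \<open>A \<times> K\<close>, which is all that \<open>T\<close> sees.\<close>

lemma null_integral_w:
  assumes Q: "L \<subseteq> cbox a b"
  shows "(\<lambda>e x. (LINT y:cbox a b|lborel. H (x, y) * w e y) - classical_op h T x) \<in> null_nets X"
    (is "?N \<in> _")
proof (rule null_netsI[OF X])
  fix e :: real assume e: "0 < e" "e \<le> 1"
  have W: "(\<lambda>\<phi>. LINT y:cbox a b|lborel. \<phi> y * w e y) \<in> compact_distributions UNIV"
    by (rule set_integral_distribution[OF compact_cbox subset_UNIV open_UNIV
          continuous_on_subset[OF smooth_continuous[OF smooth_w[OF e]] subset_UNIV]])
  have "(\<lambda>x. LINT y:cbox a b|lborel. H (x, y) * w e y) \<in> smooth_fns X"
    using smooth_classical_op[OF X open_UNIV W H] by (simp add: classical_op_def[abs_def])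
  then show "?N e \<in> smooth_fns X"
    by (rule smooth_diff[OF X _ smooth_classical_op[OF X Y T h]])
next
  fix A :: "'a set" and bs :: "'a list" and k
  assume A: "compact A" "A \<subseteq> X" and bs: "set bs \<subseteq> Basis"
  define M where "M e = (\<lambda>p. J H e p - H p)" for e
  let ?bs = "map (\<lambda>b. (b, 0)) bs :: ('a \<times> 'b) list"
  have bs': "set ?bs \<subseteq> Basis" using bs by (auto intro: Pair_Basis)
  have M': "M e \<in> smooth_fns (X \<times> UNIV)" if "0 < e" "e \<le> 1" for e
    unfolding M_def by (rule smooth_diff[OF open_Times[OF X open_UNIV] smooth_J[OF X H that] H])
  have M: "M e \<in> smooth_fns (X \<times> Y)" if "0 < e" "e \<le> 1" for e
    by (rule smooth_mono[OF M'[OF that]]) auto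
  have ord: "order_on A (\<lambda>e. classical_op (pd ?bs (M e)) T) k"
  proof (rule order_on_classical_op[OF X Y T c _ A(2)])
    show "pd ?bs (M e) \<in> smooth_fns (X \<times> Y)" if "0 < e" "e < 1" for e
      using that by (intro smooth_pd[OF M bs']) auto
    fix cs :: "'b list" assume "set cs \<subseteq> Basis"
    then have "set (map (Pair 0) cs @ ?bs) \<subseteq> Basis" using bs by (auto intro: Pair_Basis)
    from J_order[OF X H A this]
    show "order_on (A \<times> K) (\<lambda>e. pd (map (Pair 0) cs) (pd ?bs (M e))) k"
      unfolding M_def pd_append .
  qed
  have "\<forall>\<^sub>F e in at_right 0. \<forall>x\<in>A. norm (pd bs (?N e) x) \<le> norm (classical_op (pd ?bs (M e)) T x)"
    using eventually_at_right_real[OF e0(1)] eventually_abs_ln_ge[of 2]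
  proof eventually_elim
    case (elim e)
    then have e: "0 < e" "e \<le> e0" "e \<le> 1" using e0 by auto
    have eq: "?N e x = classical_op (M e) T x" if x: "x \<in> X" for x
    proof -
      have 1: "(LINT y:cbox a b|lborel. H (x, y) * w e y) = T (\<lambda>z. J H e (x, z))"
        by (rule integral_w_eq[OF X H e(1,2) elim(2) x]) (use Q L(3) in auto)
      have sH: "(\<lambda>z. H (x, z)) \<in> smooth_fns Y"
        by (rule smooth_mono[OF smooth_slice(1)[OF X open_UNIV H x]]) simp
      have sJ: "(\<lambda>z. J H e (x, z)) \<in> smooth_fns Y"
        by (rule smooth_mono[OF smooth_slice(1)[OF X open_UNIV smooth_J[OF X H e(1,3)] x]]) simp
      \<comment> \<open>\<open>T\<close> cannot distinguish \<open>h\<close> from \<open>H\<close>,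
        because \<open>\<eta> = 1\<close> on the neighbourhood \<open>U\<close> of
        \<open>K\<close>.\<close>
      have 2: "T (\<lambda>z. h (x, z)) = T (\<lambda>z. H (x, z))"
        by (rule distr_local[OF Y T c smooth_slice(1)[OF X Y h x] sH U(1,2)]) (simp add: eta(2))
      show ?thesis
        unfolding 1 classical_op_def 2 M_def by (rule distr_diff[OF Y T sJ sH, symmetric])
    qed
    have "pd bs (?N e) x = classical_op (pd ?bs (M e)) T x" if "x \<in> A" for x
    proof -
      have x: "x \<in> X" using that A by auto
      have "pd bs (?N e) x = pd bs (classical_op (M e) T) x" by (rule pd_cong[OF X eq x])
      then show ?thesis using pd_classical_op[OF X Y T M[OF e(1,3)] x bs] by simp
    qed
    then show ?case by simp
  qed
  from order_on_dominated[OF ord this] show "order_on A (\<lambda>e. pd bs (?N e)) k" .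
qed

text \<open>The difference telescopes into three null nets: \<open>u\<close> is replaced by
  \<open>h\<close>, then \<open>f\<close> by \<open>f0\<close>, and the integral of \<open>h\<close>
  against \<open>f0\<close> is that of \<open>H\<close> against \<open>w\<close>.\<close>

lemma integral_op_class:
  assumes u: "u \<in> sigma_emb (X \<times> Y) h" and f: "f \<in> i_S Y \<rho> \<kappa> \<gamma> T"
    and K': "compact K'" "K' \<subseteq> Y" "\<And>e. e \<in> {0<..1} \<Longrightarrow> support_on Y (f e) \<subseteq> K'"
  shows "Cl X (\<lambda>e x. LINT y:K'|lborel. u e (x, y) * f e y) = sigma_emb X (classical_op h T)"
proof (rule Cl_eq_const[OF X smooth_classical_op[OF X Y T h]])
  note XY = open_Times[OF X Y]
  have um: "u \<in> moderate_nets (X \<times> Y)" and un: "(\<lambda>e p. h p - u e p) \<in> null_nets (X \<times> Y)"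
    using u by (auto simp: sigma_emb_def Cl_def net_rel_def)
  have fm: "f \<in> moderate_nets Y" and fn: "(\<lambda>e y. w e y - f e y) \<in> null_nets Y"
    using f by (auto simp: i_S_eq Cl_def net_rel_def)
  have un': "(\<lambda>e p. u e p - h p) \<in> null_nets (X \<times> Y)" using null_minus[OF XY un] by simp
  have fn': "(\<lambda>e y. f e y - f0 e y) \<in> null_nets Y"
    using null_add[OF Y null_minus[OF Y fn] f0_diff_null] by simp
  let ?K = "K' \<union> L"
  have KL: "compact ?K" "?K \<subseteq> Y" using K' L by (auto intro: compact_Un)
  obtain a b where Q: "L \<subseteq> cbox a b"
    using bounded_subset_cbox_symmetric[OF compact_imp_bounded[OF L(1)]] by blast
  note 1 = null_integral_op[OF X Y K'(1,2) null_imp_moderate[OF XY un'] fm disjI1[OF un']]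
  note 2 = null_integral_op[OF X Y KL moderate_const[OF XY h] null_imp_moderate[OF Y fn'] disjI2[OF fn']]
  note 3 = null_integral_w[OF Q]
  show "(\<lambda>e x. (LINT y:K'|lborel. u e (x, y) * f e y) - classical_op h T x) \<in> null_nets X"
  proof (rule null_cong[OF X null_add[OF X null_add[OF X 1 2] 3]])
    fix e :: real and x assume e: "0 < e" "e \<le> 1" and x: "x \<in> X"
    have cu: "continuous_on Y (\<lambda>y. u e (x, y))" and ch: "continuous_on Y (\<lambda>y. h (x, y))"
      and cf: "continuous_on Y (f e)" and cf0: "continuous_on Y (f0 e)"
      by (intro smooth_continuous smooth_slice(1)[OF X Y _ x] moderate_smooth[OF XY um e] h
          moderate_smooth[OF Y fm e] moderate_smooth[OF Y f0_moderate e])+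
    have int: "set_integrable lborel S (\<lambda>y. p y * q y)"
      if "compact S" "S \<subseteq> Y" "continuous_on Y p" "continuous_on Y q" for S and p q :: "'b \<Rightarrow> complex"
      using that by (intro set_integrable_compact continuous_on_mult) (auto intro: continuous_on_subset)
    have f0': "f e y = 0" if "y \<in> Y" "y \<notin> K'" for y
      using K'(3)[of e] e that by (auto simp: support_on_def)
    have "(LINT y:K'|lborel. u e (x, y) * f e y)
        = (LINT y:K'|lborel. (u e (x, y) - h (x, y)) * f e y + h (x, y) * f e y)"
      by (simp add: algebra_simps)
    also have "\<dots> = (LINT y:K'|lborel. (u e (x, y) - h (x, y)) * f e y) + (LINT y:K'|lborel. h (x, y) * f e y)"
      by (intro set_integral_add(2) int K' continuous_on_diff cu ch cf)
    \<comment> \<open>\<open>f\<close> and \<open>f0\<close> have different supports, so both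
      integrals are first brought to the common domain \<open>?K\<close>.\<close>
    also have "(LINT y:K'|lborel. h (x, y) * f e y) = (LINT y:?K|lborel. h (x, y) * f e y)"
      unfolding set_lebesgue_integral_def
      by (rule Bochner_Integration.integral_cong) (use f0' L(2) in \<open>auto simp: indicator_def\<close>)
    also have "\<dots> = (LINT y:?K|lborel. h (x, y) * (f e y - f0 e y) + h (x, y) * f0 e y)"
      by (simp add: algebra_simps)
    also have "\<dots> = (LINT y:?K|lborel. h (x, y) * (f e y - f0 e y)) + (LINT y:?K|lborel. h (x, y) * f0 e y)"
      by (intro set_integral_add(2) int KL continuous_on_diff ch cf cf0)
    \<comment> \<open>The box may leave \<open>Y\<close>, but both integrands vanish off
      \<open>L\<close>.\<close>
    also have "(LINT y:?K|lborel. h (x, y) * f0 e y) = (LINT y:cbox a b|lborel. H (x, y) * w e y)"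
      unfolding set_lebesgue_integral_def
      by (rule Bochner_Integration.integral_cong) (use Q L(3) in \<open>auto simp: indicator_def f0_def\<close>)
    finally show "(LINT y:K'|lborel. u e (x, y) * f e y) - classical_op h T x
      = (LINT y:K'|lborel. (u e (x, y) - h (x, y)) * f e y) + (LINT y:?K|lborel. h (x, y) * (f e y - f0 e y))
        + ((LINT y:cbox a b|lborel. H (x, y) * w e y) - classical_op h T x)"
      by simp
  qed
qed

text \<open>\<open>integral_op_class\<close> shows that the class satisfies the description. For
  uniqueness the condition must not be vacuous: the constant net \<open>h\<close>, the net
  \<open>f0\<close> and the compact set \<open>L\<close> form an admissible choice that determines
  the class.\<close>

lemma gen_op_i_S: "gen_op X Y (sigma_emb (X \<times> Y) h) (i_S Y \<rho> \<kappa> \<gamma> T) = sigma_emb X (classical_op h T)"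
  unfolding gen_op_def
proof (rule the_equality)
  show "\<forall>u\<in>sigma_emb (X \<times> Y) h. \<forall>f\<in>i_S Y \<rho> \<kappa> \<gamma> T. \<forall>K.
      compact K \<and> K \<subseteq> Y \<and> (\<forall>e\<in>{0<..1}. support_on Y (f e) \<subseteq> K) \<longrightarrow>
      sigma_emb X (classical_op h T) = Cl X (\<lambda>e x. LINT y:K|lborel. u e (x, y) * f e y)"
    by (intro ballI allI impI integral_op_class[symmetric]) blast+
  fix G
  assume G: "\<forall>u\<in>sigma_emb (X \<times> Y) h. \<forall>f\<in>i_S Y \<rho> \<kappa> \<gamma> T. \<forall>K.
      compact K \<and> K \<subseteq> Y \<and> (\<forall>e\<in>{0<..1}. support_on Y (f e) \<subseteq> K) \<longrightarrow>
      G = Cl X (\<lambda>e x. LINT y:K|lborel. u e (x, y) * f e y)"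
  have u: "(\<lambda>e. h) \<in> sigma_emb (X \<times> Y) h"
    unfolding sigma_emb_def Cl_def
    by (rule equiv_class_self[OF equiv_net_rel[OF open_Times[OF X Y]] moderate_const[OF open_Times[OF X Y] h]])
  have supp: "support_on Y (f0 e) \<subseteq> L" for e
    using L(3) by (auto simp: support_on_def f0_def)
  have "G = Cl X (\<lambda>e x. LINT y:L|lborel. h (x, y) * f0 e y)"
    using bspec[OF bspec[OF G u] f0_in_i_S] L(1,2) supp by blast
  then show "G = sigma_emb X (classical_op h T)"
    using integral_op_class[OF u f0_in_i_S L(1,2) supp] by simp
qed

end

end

theorem theorem25:
  fixes X :: "'a::euclidean_space set" and Y :: "'b::euclidean_space set"
    and h :: "'a \<times> 'b \<Rightarrow> complex"
    and \<rho> :: "'b \<Rightarrow> complex" and \<kappa> :: "'b \<Rightarrow> real" and \<gamma> :: "real \<Rightarrow> 'b \<Rightarrow> real"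
  assumes "open X" and "open Y"
    and "h \<in> smooth_fns (X \<times> Y)"
    and "mollifier \<rho>" and "cutoff \<kappa>" and "truncation_net Y \<gamma>"
  shows "classical_op h \<in> compact_distributions Y \<rightarrow> smooth_fns X \<and>
    i_S Y \<rho> \<kappa> \<gamma> \<in> compact_distributions Y \<rightarrow> gen_fns_C Y \<and>
    (\<forall>T\<in>compact_distributions Y.
       (sigma_emb X \<circ> classical_op h) T =
       (gen_op X Y (sigma_emb (X \<times> Y) h) \<circ> i_S Y \<rho> \<kappa> \<gamma>) T)"
proof -
  have "classical_op h T \<in> smooth_fns X \<and> i_S Y \<rho> \<kappa> \<gamma> T \<in> gen_fns_C Y \<and>
      gen_op X Y (sigma_emb (X \<times> Y) h) (i_S Y \<rho> \<kappa> \<gamma> T) = sigma_emb X (classical_op h T)"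
    if T: "T \<in> compact_distributions Y" for T
  proof -
    obtain K l C where c: "controlled T Y K l C" by (rule compact_distribution_controlled[OF T])
    then have K: "compact K" "K \<subseteq> Y" by (auto simp: controlled_def)
    obtain e0 U where "0 < e0" "e0 \<le> 1" "open U" "K \<subseteq> U" "U \<subseteq> Y"
      "\<And>e x. 0 < e \<Longrightarrow> e \<le> e0 \<Longrightarrow> x \<in> U \<Longrightarrow> \<gamma> e x = 1"
      by (rule truncation_net_eq_1[OF assms(6,2) K]) blast
    \<comment> \<open>The support data and the threshold depend on \<open>T\<close>, so the locale
      is interpreted separately for each distribution.\<close>
    then interpret embedding Y \<rho> \<kappa> \<gamma> T K l C e0 U
      using assms T c by unfold_locales auto
    show ?thesis
      using smooth_classical_op[OF assms(1,2) T assms(3)] i_S_in_gen_fns_C gen_op_i_S[OF assms(1,3)] by blast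
  qed
  then show ?thesis by simp
qed

end
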